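(* Let $N\ge1$. There exist constants $A_1,A_2>0$ depending only on $N$ such that the following holds. Assume $f\in C^0([0,\infty))\cap C^2((0,\infty))$ is nondecreasing and convex, $f>0$ in $(0,\infty)$, $f(0)=0$, and the limit $q_0=\lim_{u\to0^+}q(u)$ exists in $\overline{\mathbb{R}}$; let $p_0$ be the conjugate exponent of $q_0$. Assume $u\in C^2(\mathbb{R}^N)$ is a bounded positive solution of $-\Delta u=f(u)$ in $\mathbb{R}^N$ which is stable outside a compact set. If any of the following conditions holds: 1. $1\le N\le9$; 2. $N=10$ and $p_0<+\infty$; 3. $N\ge11$ and $p_0<p_c(N)$, then there exists a constant $C>0$ such that for all $x\in\mathbb{R}^N$ with $|x|$ sufficiently large, $$u(x)\le C\,s(|x|),$$ where, for $R>0$ sufficiently large, $s=s(R)$ is the unique positive solution of $$f\big(A_1R^2f(s)\big)=A_2f(s).$$ In other words, $s(R)=f^{-1}\big(C_1R^{-2}g(C_2R^{-2})\big)$, where $C_1,C_2$ are two positive constants depending on $N$ only and $g$ is the inverse function of $t\mapsto f(t)/t$ (both $f$ and $t\mapsto f(t)/t$ being inverted for small $t>0$).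
   Context: For $u>0$, $q(u)=\dfrac{f'(u)^2}{f(u)f''(u)}$ if $f(u)f''(u)\ne0$, and $q(u)=+\infty$ otherwise. The conjugate exponent $p_0\in\overline{\mathbb{R}}$ of $q_0$ is defined by $1/p_0+1/q_0=1$, i.e. $p_0=q_0/(q_0-1)$ if $q_0\notin\{1,+\infty\}$, $p_0=+\infty$ if $q_0=1$, $p_0=1$ if $q_0=+\infty$. For $N\ge 11$, $p_c(N)=\dfrac{(N-2)^2-4N+8\sqrt{N-1}}{(N-2)(N-10)}$. A solution $u$ of $-\Delta u=f(u)$ in $\mathbb{R}^N$ is stable outside a compact set if there is a compact set $K\subset\mathbb{R}^N$ such that $\int_{\mathbb{R}^N} f'(u)\varphi^2\,dx\le\int_{\mathbb{R}^N}|\nabla\varphi|^2\,dx$ for all $\varphi\in C^1_c(\mathbb{R}^N\setminus K)$. *)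

theory Defs
  imports "HOL-Analysis.Analysis"
begin

definition partial_deriv :: "'n::finite \<Rightarrow> (real^'n \<Rightarrow> real) \<Rightarrow> real^'n \<Rightarrow> real" where
  "partial_deriv i g x = deriv (\<lambda>t. g (x + t *\<^sub>R axis i 1)) 0"

definition gradient :: "(real^'n::finite \<Rightarrow> real) \<Rightarrow> real^'n \<Rightarrow> real^'n" where
  "gradient g x = (\<chi> i. partial_deriv i g x)"

definition laplacian :: "(real^'n::finite \<Rightarrow> real) \<Rightarrow> real^'n \<Rightarrow> real" where
  "laplacian g x = (\<Sum>i\<in>UNIV. partial_deriv i (partial_deriv i g) x)"

definition C1_fun :: "(real^'n::finite \<Rightarrow> real) \<Rightarrow> bool" where
  "C1_fun g \<longleftrightarrow> (\<forall>x. g differentiable (at x)) \<and> (\<forall>i. continuous_on UNIV (partial_deriv i g))"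

definition C2_fun :: "(real^'n::finite \<Rightarrow> real) \<Rightarrow> bool" where
  "C2_fun g \<longleftrightarrow> C1_fun g \<and> (\<forall>i. C1_fun (partial_deriv i g))"

definition C2_on_pos :: "(real \<Rightarrow> real) \<Rightarrow> bool" where
  "C2_on_pos f \<longleftrightarrow> (\<forall>t>0. f differentiable (at t)) \<and> (\<forall>t>0. deriv f differentiable (at t)) \<and>
     continuous_on {0<..} (deriv (deriv f))"

(* A function in C^1_c(R^N - K) is identified with its extension by zero to R^N. *)
definition C1_compact_support_off :: "(real^'n::finite) set \<Rightarrow> (real^'n \<Rightarrow> real) set" where
  "C1_compact_support_off K =
     {\<phi>. C1_fun \<phi> \<and> compact (closure {x. \<phi> x \<noteq> 0}) \<and> closure {x. \<phi> x \<noteq> 0} \<subseteq> - K}"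

(* For positive u and f, u of class C^2, both integrands are continuous with compact support,
   so the totalised Lebesgue integrals are genuine ones. *)
definition stable_outside_compact :: "(real \<Rightarrow> real) \<Rightarrow> (real^'n::finite \<Rightarrow> real) \<Rightarrow> bool" where
  "stable_outside_compact f u \<longleftrightarrow>
     (\<exists>K. compact K \<and> (\<forall>\<phi>\<in>C1_compact_support_off K.
        (LINT x|lborel. deriv f (u x) * (\<phi> x)\<^sup>2) \<le> (LINT x|lborel. (norm (gradient \<phi> x))\<^sup>2)))"

definition q_fun :: "(real \<Rightarrow> real) \<Rightarrow> real \<Rightarrow> ereal" where
  "q_fun f u = (if f u * deriv (deriv f) u \<noteq> 0
     then ereal ((deriv f u)\<^sup>2 / (f u * deriv (deriv f) u)) else \<infinity>)"

definition conj_exponent :: "ereal \<Rightarrow> ereal" where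
  "conj_exponent q = (if q = 1 then \<infinity> else if q = \<infinity> then 1 else q / (q - 1))"

(* Only meaningful for N at least 11. *)
definition p_crit :: "nat \<Rightarrow> real" where
  "p_crit N = ((real N - 2)\<^sup>2 - 4 * real N + 8 * sqrt (real N - 1)) /
     ((real N - 2) * (real N - 10))"

definition s_eq :: "real \<Rightarrow> real \<Rightarrow> (real \<Rightarrow> real) \<Rightarrow> real \<Rightarrow> real \<Rightarrow> bool" where
  "s_eq A1 A2 f R s \<longleftrightarrow> s > 0 \<and> f (A1 * R\<^sup>2 * f s) = A2 * f s"

definition s_fun :: "real \<Rightarrow> real \<Rightarrow> (real \<Rightarrow> real) \<Rightarrow> real \<Rightarrow> real" where
  "s_fun A1 A2 f R = (THE s. s_eq A1 A2 f R s)"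

(* s(R) = f^{-1}(C1 R^{-2} g(C2 R^{-2})), where f and t -> f(t)/t are inverted on a small interval
   (0, d); invertibility there, and membership of the arguments in the domains of the inverses,
   are part of the claim. *)
definition s_inverse_formula ::
    "real \<Rightarrow> real \<Rightarrow> (real \<Rightarrow> real) \<Rightarrow> (real \<Rightarrow> real) \<Rightarrow> bool" where
  "s_inverse_formula C1 C2 f s \<longleftrightarrow>
     (\<exists>d>0. inj_on f {0<..<d} \<and> inj_on (\<lambda>t. f t / t) {0<..<d} \<and>
        (let finv = the_inv_into {0<..<d} f; g = the_inv_into {0<..<d} (\<lambda>t. f t / t) in
         \<forall>\<^sub>F R in at_top.
           C2 / R\<^sup>2 \<in> (\<lambda>t. f t / t) ` {0<..<d} \<and>
           C1 / R\<^sup>2 * g (C2 / R\<^sup>2) \<in> f ` {0<..<d} \<and>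
           s R = finv (C1 / R\<^sup>2 * g (C2 / R\<^sup>2))))"

end

(* With A2 = 1 the equation for s(R) reads f(s)/s = c/R^2, so it has to be shown that u(x) <= C u(y) for
   some y near x with f(u(y))/u(y) <= c/|x|^2. Such a y exists in every ball of radius |x|/2, by comparison
   with the first eigenvalue, and this is where c depends on N only. The first inequality is Harnack's
   inequality for -Lap u = V u with V = f(u)/u <= f'(u), which is elementary once f'(u) <= C/|x|^2.
   That bound comes from stability: testing with powers f(u)^a, (a - 1)^2 < 1/q0, controls the integral of
   f'(u) f(u)^(2a) on balls in a scale invariant way, and w = f(u) satisfies -Lap w <= f'(u) w, so that
   point picking and the mean value inequality turn the integral bound into a pointwise one. The growth of
   f' relative to f is governed by f f'' / f'^2 -> 1/q0, and the exponents match exactly when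
   N - 2 < 4 q0 + 4 sqrt q0, which is the condition on p0. If q0 is infinite, f is so close to linear that
   the polynomial lower bound for positive superharmonic functions contradicts the eigenvalue comparison. *)
theory Submission
  imports Defs
begin

section \<open>Gradients and integration by parts\<close>

text \<open>Where \<open>(a - 1)\<^sup>2 < 1 / q0\<close> comes from: testing stability with f(u)^a
  puts a^2 in front of the integral of f(u)^(2a-2) f'(u)^2 |grad u|^2, while the equation bounds 2a
  - 1 + 1/q0 times that integral by the integral of f'(u) f(u)^(2a). Absorption needs a^2 < 2a - 1 +
  1/q0. Where the dimension condition comes from: on a ball of radius R everything is measured
  against the level t with f'(t) = 1/R^2. At the picked point, of scale r, put q = R/r and v =
  f(u)/f(t). The energy gives v^(2a) <= C q^(N-2), the growth of f' gives q^2 <= C v^\<sigma> with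
  \<sigma> near 1/q0. Hence q^(4a/\<sigma>) <= C q^(N-2), which bounds q when N - 2 < 4a/\<sigma>;
  for a near 1 + 1/sqrt q0 this is the stated inequality. The obstacle: q0 controls f only near 0,
  whereas u is merely bounded by some M and its decay is what has to be proved. So every inequality
  for f is needed on all of (0, M], with constants depending on f and M; these may enter the final
  C, but not A1, A2, C1, C2.\<close>

lemma has_derivative_along_line:
  fixes g :: "'a::real_inner \<Rightarrow> real"
  assumes "(g has_derivative (\<lambda>h. v \<bullet> h)) (at (x + t *\<^sub>R e))"
  shows "((\<lambda>t. g (x + t *\<^sub>R e)) has_real_derivative v \<bullet> e) (at t)"
proof -
  have "((\<lambda>t. g (x + t *\<^sub>R e)) has_derivative (\<lambda>s. v \<bullet> (s *\<^sub>R e))) (at t)"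
    by (rule has_derivative_compose[where g=g and f="\<lambda>t. x + t *\<^sub>R e"])
       (auto intro!: derivative_eq_intros simp: assms)
  thus ?thesis
    by (simp add: has_field_derivative_def mult_commute_abs)
qed

lemma partial_deriv_eq:
  fixes g :: "real^'n::finite \<Rightarrow> real"
  assumes "(g has_derivative (\<lambda>h. v \<bullet> h)) (at x)"
  shows "partial_deriv i g x = v $ i"
  using has_derivative_along_line[of g v x 0 "axis i 1"] assms
  unfolding partial_deriv_def by (auto simp: inner_axis intro: DERIV_imp_deriv)

lemma gradient_eq:
  fixes g :: "real^'n::finite \<Rightarrow> real"
  assumes "(g has_derivative (\<lambda>h. v \<bullet> h)) (at x)"
  shows "gradient g x = v"
  by (simp add: gradient_def vec_eq_iff partial_deriv_eq[OF assms])

lemma differentiable_gradient: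
  fixes g :: "real^'n::finite \<Rightarrow> real"
  assumes "g differentiable (at x)"
  shows "(g has_derivative (\<lambda>h. gradient g x \<bullet> h)) (at x)"
proof -
  obtain g' where g': "(g has_derivative g') (at x)"
    using assms by (auto simp: differentiable_def)
  interpret linear g' using g' by (simp add: has_derivative_linear)
  have "g' h = (\<chi> i. g' (axis i 1)) \<bullet> h" for h
  proof -
    have "g' h = g' (\<Sum>i\<in>UNIV. (h $ i) *\<^sub>R axis i 1)"
      by (simp add: basis_expansion flip: scalar_mult_eq_scaleR)
    thus ?thesis by (simp add: sum scale inner_vec_def mult.commute)
  qed
  hence "g' = (\<lambda>h. (\<chi> i. g' (axis i 1)) \<bullet> h)" by blast
  with g' have *: "(g has_derivative (\<lambda>h. (\<chi> i. g' (axis i 1)) \<bullet> h)) (at x)" by simp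
  from gradient_eq[OF *] * show ?thesis by simp
qed

lemma C1_has_derivative:
  "C1_fun g \<Longrightarrow> (g has_derivative (\<lambda>h. gradient g x \<bullet> h)) (at x)"
  by (simp add: C1_fun_def differentiable_gradient)

lemma C1_continuous_gradient: "C1_fun g \<Longrightarrow> continuous_on UNIV (gradient g)"
  unfolding C1_fun_def gradient_def by (auto intro!: continuous_intros)

lemma C1I:
  fixes g :: "real^'n::finite \<Rightarrow> real"
  assumes "\<And>x. (g has_derivative (\<lambda>h. G x \<bullet> h)) (at x)" "continuous_on UNIV G"
  shows "C1_fun g" "gradient g = G"
proof -
  have p: "partial_deriv i g = (\<lambda>x. G x $ i)" for i
    using partial_deriv_eq[OF assms(1)] by auto
  show "C1_fun g"
    using assms unfolding C1_fun_def p
    by (auto simp: differentiable_def intro!: continuous_intros)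
  show "gradient g = G" using gradient_eq[OF assms(1)] by auto
qed

lemma continuous_compact_support_integrable:
  fixes F :: "'a::euclidean_space \<Rightarrow> real"
  assumes "continuous_on UNIV F" "compact S" "\<And>x. x \<notin> S \<Longrightarrow> F x = 0"
  shows "integrable lborel F"
proof -
  have "integrable lborel (\<lambda>x. indicator S x *\<^sub>R F x)"
    using assms by (intro borel_integrable_compact) (auto intro: continuous_on_subset)
  also have "(\<lambda>x. indicator S x *\<^sub>R F x) = F"
    using assms(3) by (auto simp: fun_eq_iff indicator_def)
  finally show ?thesis .
qed

lemma integral_lborel_shift:
  fixes F :: "'a::euclidean_space \<Rightarrow> real"
  assumes "F \<in> borel_measurable borel"
  shows "(LINT x|lborel. F (x + v)) = (LINT x|lborel. F x)"
proof -
  have "(LINT x|lborel. F x) = (LINT x|distr lborel borel ((+) v). F x)"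
    by (simp add: lborel_distr_plus)
  also have "\<dots> = (LINT x|lborel. F (v + x))"
    using assms by (intro integral_distr) auto
  finally show ?thesis by (simp add: add.commute)
qed

lemma has_derivative_zero_off_support:
  fixes g :: "'a::euclidean_space \<Rightarrow> real"
  assumes d: "(g has_derivative (\<lambda>h. v \<bullet> h)) (at x)" and S: "closed S" "\<And>y. y \<notin> S \<Longrightarrow> g y = 0" and x: "x \<notin> S"
  shows "v = 0"
proof -
  have "((\<lambda>x. 0) has_derivative (\<lambda>h. 0)) (at x)" by simp
  hence "(g has_derivative (\<lambda>h. 0)) (at x)"
    by (rule has_derivative_transform_within_open[where s="- S"]) (use S x in auto)
  from has_derivative_unique[OF this d] have "v \<bullet> v = 0" by metis
  thus ?thesis by simp
qed

text \<open>Translation invariance makes the integral of every difference quotient in direction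
  \<open>v\<close> vanish; the gradient bound and the bounded support dominate these quotients. All
  integrations by parts below reduce to this.\<close>

lemma integral_directional_derivative_zero:
  fixes g :: "'a::euclidean_space \<Rightarrow> real"
  assumes d: "\<And>x. (g has_derivative (\<lambda>h. G x \<bullet> h)) (at x)" and G: "continuous_on UNIV G"
    and S: "\<And>x. norm x > B \<Longrightarrow> g x = 0"
  shows "(LINT x|lborel. G x \<bullet> v) = 0"
proof -
  have cg: "continuous_on UNIV g"
    using d by (meson differentiable_at_withinI differentiable_def differentiable_imp_continuous_on
        differentiable_on_def)
  have G0: "G x = 0" if "norm x > B" for x
    by (rule has_derivative_zero_off_support[OF d closed_cball[of 0 B]]) (use S that in auto)
  obtain L where L: "\<And>x. norm (G x) \<le> L"
  proof -
    have "compact (G ` cball 0 B)"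
      by (intro compact_continuous_image continuous_on_subset[OF G]) auto
    then obtain L where L: "\<forall>y \<in> G ` cball 0 B. norm y \<le> L"
      using compact_imp_bounded bounded_iff by metis
    hence "norm (G x) \<le> max L 0" for x
    proof (cases "norm x \<le> B")
      case True
      thus ?thesis using L by (simp add: le_max_iff_disj)
    qed (simp add: G0)
    thus ?thesis using that by blast
  qed
  have L0: "0 \<le> L" using norm_ge_zero L by (rule order_trans)
  have lip: "\<bar>g (x + h) - g x\<bar> \<le> L * norm h" for x h
  proof -
    have "norm (g (x + h) - g x) \<le> L * norm (x + h - x)"
      using d L
      by (intro differentiable_bound[where S=UNIV and f'="\<lambda>x h. G x \<bullet> h"])
         (auto intro!: onorm_bound order_trans[OF Cauchy_Schwarz_ineq2] mult_right_mono
           simp: order_trans[OF norm_ge_zero L])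
    thus ?thesis by simp
  qed
  define e :: "nat \<Rightarrow> real" where "e n = 1 / real (Suc n)" for n
  have e: "e n > 0" "e n \<le> 1" "e n \<noteq> 0" for n by (auto simp: e_def)
  have e0: "e \<longlonglongrightarrow> 0" unfolding e_def by (rule LIMSEQ_Suc[OF lim_1_over_n])
  define q where "q n x = (g (x + e n *\<^sub>R v) - g x) / e n" for n x
  \<comment> \<open>Since \<open>e n \<le> 1\<close>, the shift moves the support by at most
    \<open>norm v\<close>; hence the radius in the dominating function.\<close>
  have "((\<lambda>n. LINT x|lborel. q n x) \<longlonglongrightarrow> (LINT x|lborel. G x \<bullet> v))"
  proof (rule integral_dominated_convergence[where w="\<lambda>x. indicator (cball 0 (B + norm v)) x * (L * norm v)"])
    show "AE x in lborel. (\<lambda>n. q n x) \<longlonglongrightarrow> G x \<bullet> v"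
    proof (rule AE_I2)
      fix x
      have "((\<lambda>t. g (x + t *\<^sub>R v)) has_real_derivative G x \<bullet> v) (at 0)"
        by (rule has_derivative_along_line) (simp add: d)
      hence "((\<lambda>t. (g (x + t *\<^sub>R v) - g x) / t) \<longlongrightarrow> G x \<bullet> v) (at 0)"
        by (simp add: DERIV_def)
      moreover have "filterlim e (at 0) sequentially"
        using e0 e by (auto simp: filterlim_at)
      ultimately show "(\<lambda>n. q n x) \<longlonglongrightarrow> G x \<bullet> v"
        unfolding q_def by (rule filterlim_compose)
    qed
    show "integrable lborel (\<lambda>x. indicator (cball 0 (B + norm v)) x * (L * norm v))"
      by (intro integrable_mult_left) (auto intro!: integrable_real_indicator emeasure_bounded_finite)
    show "AE x in lborel. norm (q n x) \<le> indicator (cball 0 (B + norm v)) x * (L * norm v)" for n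
    proof (rule AE_I2)
      fix x
      show "norm (q n x) \<le> indicator (cball 0 (B + norm v)) x * (L * norm v)"
      proof (cases "norm x \<le> B + norm v")
        case True
        have "\<bar>g (x + e n *\<^sub>R v) - g x\<bar> \<le> L * norm v * e n"
          using lip[of x "e n *\<^sub>R v"] e[of n] by (simp add: mult_ac)
        thus ?thesis using True e[of n] by (simp add: q_def divide_simps mult_ac)
      next
        case False
        have "norm (x + e n *\<^sub>R v) \<ge> norm x - norm (e n *\<^sub>R v)"
          by (metis add.commute norm_diff_ineq)
        moreover have "norm (e n *\<^sub>R v) \<le> norm v"
          using e[of n] by (simp add: mult_left_le_one_le)
        ultimately have "norm (x + e n *\<^sub>R v) > B" "norm x > B"
          using False norm_ge_zero[of v] by linarith+
        thus ?thesis using S L0 by (simp add: q_def)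
      qed
    qed
  qed (auto simp: q_def e intro!: borel_measurable_continuous_onI continuous_intros
        continuous_on_compose2[OF cg] G)
  moreover have "(LINT x|lborel. q n x) = 0" for n
  proof -
    have i: "integrable lborel g"
      by (rule continuous_compact_support_integrable[OF cg compact_cball[of 0 B]]) (auto intro: S)
    have j: "integrable lborel (\<lambda>x. g (x + e n *\<^sub>R v))"
    proof (rule continuous_compact_support_integrable[OF _ compact_cball[of 0 "B + norm (e n *\<^sub>R v)"]])
      show "continuous_on UNIV (\<lambda>x. g (x + e n *\<^sub>R v))"
        by (auto intro!: continuous_intros continuous_on_compose2[OF cg])
      show "g (x + e n *\<^sub>R v) = 0" if "x \<notin> cball 0 (B + norm (e n *\<^sub>R v))" for x
        using that norm_diff_ineq[of x "e n *\<^sub>R v"] by (intro S) (auto simp: add.commute)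
    qed
    have "(LINT x|lborel. q n x) = ((LINT x|lborel. g (x + e n *\<^sub>R v)) - (LINT x|lborel. g x)) / e n"
      unfolding q_def using i j by simp
    also have "(LINT x|lborel. g (x + e n *\<^sub>R v)) = (LINT x|lborel. g x)"
      using i by (intro integral_lborel_shift) auto
    finally show ?thesis by simp
  qed
  ultimately show ?thesis by (simp add: LIMSEQ_const_iff)
qed


lemma integral_lborel_scale:
  fixes F :: "'a::euclidean_space \<Rightarrow> real"
  assumes F: "F \<in> borel_measurable borel" and r: "r > 0"
  shows "(LINT x|lborel. F x) = r ^ DIM('a) * (LINT z|lborel. F (c + r *\<^sub>R z))"
proof -
  have "(LINT x|lborel. F x) =
      (LINT x|density (distr lborel borel (\<lambda>x. c + r *\<^sub>R x)) (\<lambda>_. \<bar>r\<bar>^DIM('a)). F x)"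
    using lborel_affine[of r c] r by simp
  also have "\<dots> = (LINT x|distr lborel borel (\<lambda>x. c + r *\<^sub>R x). \<bar>r\<bar>^DIM('a) * F x)"
    using F by (subst integral_density) auto
  also have "\<dots> = (LINT z|lborel. \<bar>r\<bar>^DIM('a) * F (c + r *\<^sub>R z))"
    using F by (subst integral_distr) auto
  finally show ?thesis using r by simp
qed

section \<open>Averages over balls\<close>

text \<open>\<open>bump n\<close> is of class C^1 for \<open>n \<ge> 2\<close>, its gradient is a
  multiple of \<open>bump (n - 1) z *\<^sub>R z\<close>, and powers stay in the family. So it
  supplies both the weights of the means and the cutoffs in the stability inequality.\<close>

definition bump :: "nat \<Rightarrow> 'a::real_inner \<Rightarrow> real" where
  "bump n z = (max 0 (1 - z \<bullet> z)) ^ n"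

lemma max_power_has_derivative:
  fixes s :: real
  assumes "n \<ge> 1"
  shows "((\<lambda>s. (max 0 s) ^ Suc n) has_real_derivative real (Suc n) * (max 0 s) ^ n) (at s)"
proof -
  consider "s < 0" | "s > 0" | "s = 0" by linarith
  thus ?thesis
  proof cases
    case 1
    have "((\<lambda>s. 0) has_real_derivative 0) (at s)" by simp
    hence "((\<lambda>s. (max 0 s) ^ Suc n) has_real_derivative 0) (at s)"
      by (rule has_field_derivative_transform_within_open[where S="{..<0}"]) (use 1 in \<open>auto simp: max_def\<close>)
    thus ?thesis using 1 assms by (simp add: max_def power_0_left del: power_Suc)
  next
    case 2
    have "((\<lambda>s. s ^ Suc n) has_real_derivative real (Suc n) * s ^ n) (at s)"
      using DERIV_pow[of "Suc n" s] by simp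
    hence "((\<lambda>s. (max 0 s) ^ Suc n) has_real_derivative real (Suc n) * s ^ n) (at s)"
      by (rule has_field_derivative_transform_within_open[where S="{0<..}"]) (use 2 in \<open>auto simp: max_def\<close>)
    thus ?thesis using 2 by (simp add: max_def)
  next
    case 3
    have "((\<lambda>h::real. (max 0 h) ^ Suc n / h) \<longlongrightarrow> 0) (at 0)"
    proof (rule Lim_null_comparison)
      show "\<forall>\<^sub>F h in at 0. norm ((max 0 h) ^ Suc n / h) \<le> \<bar>h\<bar> ^ n"
        by (rule always_eventually) (auto simp: max_def divide_simps intro!: mult_nonneg_nonpos)
      have "((\<lambda>h. \<bar>h\<bar> ^ n) \<longlongrightarrow> \<bar>0\<bar> ^ n) (at (0::real))"
        by (intro tendsto_intros)
      thus "((\<lambda>h. \<bar>h\<bar> ^ n) \<longlongrightarrow> 0) (at (0::real))"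
        using assms by (cases n) auto
    qed
    thus ?thesis using 3 assms by (simp add: DERIV_def power_0_left)
  qed
qed

lemma bump_has_derivative:
  assumes "n \<ge> 1"
  shows "(bump (Suc n) has_derivative (\<lambda>h. ((- 2 * real (Suc n) * bump n z) *\<^sub>R z) \<bullet> h)) (at z)"
proof -
  have "((\<lambda>s. (max 0 s) ^ Suc n) has_derivative (\<lambda>k. real (Suc n) * (max 0 (1 - z \<bullet> z)) ^ n * k))
      (at (1 - z \<bullet> z))"
    using max_power_has_derivative[OF assms] by (simp add: has_field_derivative_def)
  moreover have "((\<lambda>z. 1 - z \<bullet> z) has_derivative (\<lambda>h. - 2 * (z \<bullet> h))) (at z)"
    by (auto intro!: derivative_eq_intros simp: inner_commute)
  ultimately have "((\<lambda>z. (max 0 (1 - z \<bullet> z)) ^ Suc n) has_derivative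
      (\<lambda>h. real (Suc n) * (max 0 (1 - z \<bullet> z)) ^ n * (- 2 * (z \<bullet> h)))) (at z)"
    by (rule has_derivative_compose[rotated])
  moreover have "(\<lambda>h. real (Suc n) * (max 0 (1 - z \<bullet> z)) ^ n * (- 2 * (z \<bullet> h))) =
      (\<lambda>h. ((- 2 * real (Suc n) * bump n z) *\<^sub>R z) \<bullet> h)"
    by (simp add: bump_def fun_eq_iff algebra_simps)
  ultimately show ?thesis by (simp add: bump_def[abs_def])
qed

lemma continuous_bump [continuous_intros]:
  "continuous_on S f \<Longrightarrow> continuous_on S (\<lambda>x. bump n (f x))"
  unfolding bump_def by (intro continuous_intros)

lemma bump_nonneg: "0 \<le> bump n z"
  by (simp add: bump_def)

lemma bump_antimono: "m \<le> n \<Longrightarrow> bump n z \<le> bump m z"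
  unfolding bump_def by (rule power_decreasing) auto

lemma bump_eq_0: "n \<ge> 1 \<Longrightarrow> norm z \<ge> 1 \<Longrightarrow> bump n z = 0"
  by (simp add: bump_def flip: power2_norm_eq_inner)

lemma bump_le_1: "bump n z \<le> 1"
  unfolding bump_def by (rule power_le_one) auto

text \<open>Differentiation under the integral sign is done over a compact box, the estimates over
  the whole space. The cube of half side 1 contains the unit ball, where the integrands are
  supported.\<close>

lemma integral_cbox_eq_lborel:
  fixes F :: "'a::euclidean_space \<Rightarrow> real"
  assumes F: "continuous_on UNIV F" and z: "\<And>z. norm z > 1 \<Longrightarrow> F z = 0"
  shows "integral (cbox (-One) One) F = (LINT z|lborel. F z)" "integrable lborel F"
proof -
  show i: "integrable lborel F"
    by (rule continuous_compact_support_integrable[OF F compact_cball[of 0 1]]) (auto intro: z)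
  have "F z = 0" if "z \<notin> cbox (-One) One" for z
  proof (rule z, rule ccontr)
    assume "\<not> norm z > 1"
    hence "\<bar>z \<bullet> i\<bar> \<le> 1" if "i \<in> Basis" for i using Basis_le_norm[OF that, of z] by linarith
    moreover have "One \<bullet> i = 1" if "i \<in> Basis" for i :: 'a
      using that by (simp add: inner_sum_left inner_Basis)
    ultimately show False using that by (auto simp: mem_box abs_le_iff minus_le_iff)
  qed
  hence "F = (\<lambda>z. if z \<in> cbox (-One) One then F z else 0)" by auto
  hence "integral (cbox (-One) One) F = integral UNIV F"
    by (metis integral_restrict_UNIV)
  thus "integral (cbox (-One) One) F = (LINT z|lborel. F z)"
    using integral_lborel[OF i] by simp
qed

text \<open>A solid mean without normalisation: division by the integral of \<open>bump 1\<close>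
  gives the average. The weight 1 - |z|^2 is chosen because \<open>bump 1 z *\<^sub>R z\<close> is
  the gradient of \<open>bump 2\<close> divided by -4, so the derivative in \<open>s\<close> becomes
  an integral of the Laplacian.\<close>

definition bump_mean :: "('a::euclidean_space \<Rightarrow> real) \<Rightarrow> 'a \<Rightarrow> real \<Rightarrow> real" where
  "bump_mean w x s = (LINT z|lborel. w (x + s *\<^sub>R z) * bump 1 z)"

lemma integrable_bump:
  fixes w :: "'a::euclidean_space \<Rightarrow> real"
  assumes "continuous_on UNIV w" "n \<ge> 1"
  shows "integrable lborel (\<lambda>z. w (x + s *\<^sub>R z) * bump n z)"
proof (rule integral_cbox_eq_lborel)
  show "continuous_on UNIV (\<lambda>z. w (x + s *\<^sub>R z) * bump n z)"
    by (intro continuous_intros continuous_on_compose2[OF assms(1)]) auto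
qed (use assms(2) in \<open>auto simp: bump_eq_0\<close>)

lemma C2_C1: "C2_fun w \<Longrightarrow> C1_fun w" "C2_fun w \<Longrightarrow> C1_fun (partial_deriv i w)"
  by (auto simp: C2_fun_def)

lemma C1_continuous: "C1_fun g \<Longrightarrow> continuous_on UNIV g"
  by (meson C1_fun_def differentiable_imp_continuous_on differentiable_on_def differentiable_at_withinI)

lemma gradient_nth: "gradient g x $ i = partial_deriv i g x"
  by (simp add: gradient_def)

lemma continuous_laplacian: "C2_fun w \<Longrightarrow> continuous_on UNIV (laplacian w)"
  unfolding laplacian_def C2_fun_def C1_fun_def by (auto intro!: continuous_intros)

text \<open>The field \<open>bump 2 z *\<^sub>R gradient w (x + s *\<^sub>R z)\<close> has compact
  support, so its divergence in \<open>z\<close> has integral zero. The chain rule supplies the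
  factor \<open>s\<close>, the gradient of \<open>bump 2\<close> the factor 4.\<close>

lemma bump_divergence:
  fixes w :: "real^'n::finite \<Rightarrow> real"
  assumes w: "C2_fun w"
  shows "(LINT z|lborel. (gradient w (x + s *\<^sub>R z) \<bullet> z) * bump 1 z) =
      s / 4 * (LINT z|lborel. laplacian w (x + s *\<^sub>R z) * bump 2 z)"
proof -
  define P where "P i = partial_deriv i w" for i
  define G where "G i z = (bump 2 z * s) *\<^sub>R gradient (P i) (x + s *\<^sub>R z) +
      (P i (x + s *\<^sub>R z) * (- 4 * bump 1 z)) *\<^sub>R z" for i z
  have P: "C1_fun (P i)" for i using w by (simp add: P_def C2_C1)
  have cont: "continuous_on UNIV (\<lambda>z. P i (x + s *\<^sub>R z))"
       "continuous_on UNIV (\<lambda>z. gradient (P i) (x + s *\<^sub>R z))"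
       "continuous_on UNIV (\<lambda>z. gradient w (x + s *\<^sub>R z))" for i
    by (intro continuous_intros continuous_on_compose2[OF C1_continuous[OF P]]
        continuous_on_compose2[OF C1_continuous_gradient[OF P]]
        continuous_on_compose2[OF C1_continuous_gradient[OF C2_C1(1)[OF w]]]; simp)+
  have Gd: "((\<lambda>z. P i (x + s *\<^sub>R z) * bump 2 z) has_derivative (\<lambda>h. G i z \<bullet> h)) (at z)" for i z
  proof -
    have "((\<lambda>z. P i (x + s *\<^sub>R z)) has_derivative (\<lambda>h. gradient (P i) (x + s *\<^sub>R z) \<bullet> (s *\<^sub>R h))) (at z)"
      by (rule has_derivative_compose[where f="\<lambda>z. x + s *\<^sub>R z", OF _ C1_has_derivative[OF P]])
         (auto intro!: derivative_eq_intros)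
    moreover have "(bump 2 has_derivative (\<lambda>h. ((- 2 * 2 * bump 1 z) *\<^sub>R z) \<bullet> h)) (at z)"
      using bump_has_derivative[of 1 z] by (simp add: numeral_2_eq_2)
    ultimately have "((\<lambda>z. P i (x + s *\<^sub>R z) * bump 2 z) has_derivative
      (\<lambda>h. P i (x + s *\<^sub>R z) * (((- 2 * 2 * bump 1 z) *\<^sub>R z) \<bullet> h) +
        gradient (P i) (x + s *\<^sub>R z) \<bullet> (s *\<^sub>R h) * bump 2 z)) (at z)"
      by (rule has_derivative_mult)
    moreover have "(\<lambda>h. P i (x + s *\<^sub>R z) * (((- 2 * 2 * bump 1 z) *\<^sub>R z) \<bullet> h) +
        gradient (P i) (x + s *\<^sub>R z) \<bullet> (s *\<^sub>R h) * bump 2 z) = (\<lambda>h. G i z \<bullet> h)"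
      by (simp add: fun_eq_iff G_def inner_add_left inner_diff_left algebra_simps)
    ultimately show ?thesis by simp
  qed
  have Gc: "continuous_on UNIV (G i)" for i
    unfolding G_def by (intro continuous_intros cont)
  have Gi: "integrable lborel (\<lambda>z. G i z \<bullet> axis i 1)" for i
    by (rule integral_cbox_eq_lborel(2)) (intro continuous_intros Gc, simp add: G_def bump_eq_0)
  have "0 = (\<Sum>i\<in>UNIV. LINT z|lborel. G i z \<bullet> axis i 1)"
    by (subst integral_directional_derivative_zero[OF Gd Gc, where B=1]) (auto simp: bump_eq_0)
  also have "\<dots> = (LINT z|lborel. (\<Sum>i\<in>UNIV. G i z \<bullet> axis i 1))"
    using Gi by (subst Bochner_Integration.integral_sum) auto
  also have "(\<lambda>z. \<Sum>i\<in>UNIV. G i z \<bullet> axis i 1) =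
      (\<lambda>z. s * (laplacian w (x + s *\<^sub>R z) * bump 2 z) - 4 * ((gradient w (x + s *\<^sub>R z) \<bullet> z) * bump 1 z))"
  proof
    fix z
    have "G i z \<bullet> axis i 1 = s * (partial_deriv i (P i) (x + s *\<^sub>R z) * bump 2 z) -
        4 * (P i (x + s *\<^sub>R z) * z $ i * bump 1 z)" for i
      by (simp add: G_def inner_axis gradient_nth)
    thus "(\<Sum>i\<in>UNIV. G i z \<bullet> axis i 1) =
      s * (laplacian w (x + s *\<^sub>R z) * bump 2 z) - 4 * ((gradient w (x + s *\<^sub>R z) \<bullet> z) * bump 1 z)"
      by (simp add: laplacian_def inner_vec_def gradient_nth P_def sum_subtractf sum_distrib_left
          sum_distrib_right)
  qed
  also have "(LINT z|lborel. \<dots> z) = s * (LINT z|lborel. laplacian w (x + s *\<^sub>R z) * bump 2 z) -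
      4 * (LINT z|lborel. (gradient w (x + s *\<^sub>R z) \<bullet> z) * bump 1 z)"
  proof (subst Bochner_Integration.integral_diff)
    show "integrable lborel (\<lambda>z. s * (laplacian w (x + s *\<^sub>R z) * bump 2 z))"
      by (intro integrable_mult_right integrable_bump continuous_laplacian w) simp
    show "integrable lborel (\<lambda>z. 4 * ((gradient w (x + s *\<^sub>R z) \<bullet> z) * bump 1 z))"
      by (rule integral_cbox_eq_lborel) (auto intro!: continuous_intros cont simp: bump_eq_0)
  qed simp
  finally show ?thesis by simp
qed

lemma bump_mean_has_derivative:
  fixes w :: "real^'n::finite \<Rightarrow> real"
  assumes w: "C2_fun w"
  shows "(bump_mean w x has_real_derivative
      s / 4 * (LINT z|lborel. laplacian w (x + s *\<^sub>R z) * bump 2 z)) (at s)"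
proof -
  note w1 = C2_C1(1)[OF w]
  have c: "continuous_on UNIV (\<lambda>z. w (x + s *\<^sub>R z) * bump 1 z)" for s
    by (intro continuous_intros continuous_on_compose2[OF C1_continuous[OF w1]]) auto
  have eq: "bump_mean w x = (\<lambda>s. integral (cbox (-One) One) (\<lambda>z. w (x + s *\<^sub>R z) * bump 1 z))"
    unfolding bump_mean_def by (rule ext, subst integral_cbox_eq_lborel[OF c]) (auto simp: bump_eq_0)
  have cg: "continuous_on UNIV (\<lambda>z. (gradient w (x + s *\<^sub>R z) \<bullet> z) * bump 1 z)"
    by (intro continuous_intros continuous_on_compose2[OF C1_continuous_gradient[OF w1]]) auto
  have "((\<lambda>s. integral (cbox (-One) One) (\<lambda>z. w (x + s *\<^sub>R z) * bump 1 z)) has_real_derivative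
     integral (cbox (-One) One) (\<lambda>z. (gradient w (x + s *\<^sub>R z) \<bullet> z) * bump 1 z)) (at s)"
  proof (rule leibniz_rule_field_derivative)
    show "((\<lambda>s. w (x + s *\<^sub>R z) * bump 1 z) has_real_derivative
        (gradient w (x + s *\<^sub>R z) \<bullet> z) * bump 1 z) (at s)" for s z
      by (intro DERIV_cmult_right has_derivative_along_line C1_has_derivative w1)
    show "(\<lambda>z. w (x + s *\<^sub>R z) * bump 1 z) integrable_on cbox (-One) One" for s
      by (rule integrable_continuous[OF continuous_on_subset[OF c]]) auto
    show "continuous_on (UNIV \<times> cbox (-One) One)
        (\<lambda>(s, z). (gradient w (x + s *\<^sub>R z) \<bullet> z) * bump 1 z)"
      unfolding case_prod_beta
      by (intro continuous_intros continuous_on_compose2[OF C1_continuous_gradient[OF w1]]) auto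
  qed auto
  also have "integral (cbox (-One) One) (\<lambda>z. (gradient w (x + s *\<^sub>R z) \<bullet> z) * bump 1 z) =
      (LINT z|lborel. (gradient w (x + s *\<^sub>R z) \<bullet> z) * bump 1 z)"
    by (rule integral_cbox_eq_lborel[OF cg]) (simp add: bump_eq_0)
  finally show ?thesis unfolding eq bump_divergence[OF w] .
qed

lemma bump_mean_0:
  fixes x :: "'a::euclidean_space"
  shows "bump_mean w x 0 = w x * (LINT z|lborel. bump 1 (z::'a))"
  by (simp add: bump_mean_def)

text \<open>A Gronwall argument: as \<open>bump 2 \<le> bump 1\<close>, the derivative of the mean
  in \<open>s\<close> is at least \<open>- L * s\<close> times the mean, so the mean times
  \<open>exp (L * s\<^sup>2)\<close> is nondecreasing. At \<open>s = 0\<close> the mean is the value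
  at the centre times the mass of the weight.\<close>

lemma subsolution_le_bump_mean:
  fixes w :: "real^'n::finite \<Rightarrow> real"
  assumes w: "C2_fun w" and L: "0 \<le> L" and r: "0 \<le> r"
    and sub: "\<And>y. dist x y \<le> r \<Longrightarrow> - laplacian w y \<le> L * w y"
    and pos: "\<And>y. 0 \<le> w y"
  shows "w x * (LINT z|lborel. bump 1 (z::real^'n)) \<le> exp (L * r\<^sup>2) * bump_mean w x r"
proof -
  define M' where "M' s = s / 4 * (LINT z|lborel. laplacian w (x + s *\<^sub>R z) * bump 2 z)" for s
  have cw: "continuous_on UNIV w" using w by (simp add: C1_continuous C2_C1)
  have M'_ge: "M' s \<ge> - (L * s * bump_mean w x s)" if s: "0 \<le> s" "s \<le> r" for s
  proof -
    have "- L * bump_mean w x s = (LINT z|lborel. - L * (w (x + s *\<^sub>R z) * bump 1 z))"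
      by (simp add: bump_mean_def)
    also have "\<dots> \<le> (LINT z|lborel. laplacian w (x + s *\<^sub>R z) * bump 2 z)"
    proof (rule integral_mono)
      show "integrable lborel (\<lambda>z. - L * (w (x + s *\<^sub>R z) * bump 1 z))"
        by (intro integrable_mult_right integrable_bump cw) simp
      show "integrable lborel (\<lambda>z. laplacian w (x + s *\<^sub>R z) * bump 2 z)"
        by (intro integrable_bump continuous_laplacian w) simp
      fix z :: "real^'n"
      show "- L * (w (x + s *\<^sub>R z) * bump 1 z) \<le> laplacian w (x + s *\<^sub>R z) * bump 2 z"
      proof (cases "norm z \<le> 1")
        case True
        have "s * norm z \<le> r * 1" using True s by (intro mult_mono) auto
        hence "- laplacian w (x + s *\<^sub>R z) \<le> L * w (x + s *\<^sub>R z)"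
          using s by (intro sub) (simp add: dist_norm)
        hence "- laplacian w (x + s *\<^sub>R z) * bump 2 z \<le> L * w (x + s *\<^sub>R z) * bump 2 z"
          by (rule mult_right_mono) (rule bump_nonneg)
        also have "\<dots> \<le> L * w (x + s *\<^sub>R z) * bump 1 z"
          using L pos by (intro mult_left_mono bump_antimono) auto
        finally show ?thesis by (simp add: mult_ac)
      qed (simp add: bump_eq_0)
    qed
    finally have "s / 4 * (- L * bump_mean w x s) \<le> M' s"
      unfolding M'_def using s by (intro mult_left_mono) auto
    moreover have "0 \<le> s * (L * bump_mean w x s)"
      unfolding bump_mean_def using s L pos by (intro mult_nonneg_nonneg integral_nonneg) (auto simp: bump_nonneg)
    ultimately show ?thesis by (simp add: field_simps)
  qed
  have "bump_mean w x 0 * exp (L * 0\<^sup>2) \<le> bump_mean w x r * exp (L * r\<^sup>2)"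
  proof (rule DERIV_nonneg_imp_nondecreasing[OF r])
    fix s assume s: "0 \<le> s" "s \<le> r"
    have "((\<lambda>s. bump_mean w x s * exp (L * s\<^sup>2)) has_real_derivative
        (M' s + 2 * (L * s * bump_mean w x s)) * exp (L * s\<^sup>2)) (at s)"
      unfolding M'_def
      by (rule derivative_eq_intros bump_mean_has_derivative[OF w] refl)+ (simp add: algebra_simps)
    moreover have "0 \<le> s * (L * bump_mean w x s)"
      unfolding bump_mean_def using s L pos by (intro mult_nonneg_nonneg integral_nonneg) (auto simp: bump_nonneg)
    ultimately show "\<exists>y. ((\<lambda>s. bump_mean w x s * exp (L * s\<^sup>2)) has_real_derivative y) (at s) \<and> 0 \<le> y"
      using M'_ge[OF s] by (intro exI conjI) (assumption, simp add: mult_ac)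
  qed
  thus ?thesis by (simp add: bump_mean_0 mult.commute)
qed

lemma superharmonic_ge_bump_mean:
  fixes w :: "real^'n::finite \<Rightarrow> real"
  assumes w: "C2_fun w" and r: "0 \<le> r" and sup: "\<And>y. laplacian w y \<le> 0"
  shows "bump_mean w x r \<le> w x * (LINT z|lborel. bump 1 (z::real^'n))"
proof -
  have "bump_mean w x r \<le> bump_mean w x 0"
  proof (rule DERIV_nonpos_imp_nonincreasing[OF r])
    fix s :: real assume s: "0 \<le> s" "s \<le> r"
    have "(LINT z|lborel. laplacian w (x + s *\<^sub>R z) * bump 2 z) \<le> (LINT z|(lborel :: (real^'n) measure). 0 :: real)"
      by (rule integral_mono)
         (auto intro!: integrable_bump continuous_laplacian w mult_nonpos_nonneg sup bump_nonneg)
    hence "s / 4 * (LINT z|lborel. laplacian w (x + s *\<^sub>R z) * bump 2 z) \<le> 0"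
      using s by (intro mult_nonneg_nonpos) auto
    thus "\<exists>y. (bump_mean w x has_real_derivative y) (at s) \<and> y \<le> 0"
      using bump_mean_has_derivative[OF w] by blast
  qed
  thus ?thesis by (simp add: bump_mean_0)
qed

section \<open>Comparison with the first eigenvalue of a ball\<close>

lemma local_min_second_deriv_nonneg:
  fixes g :: "real \<Rightarrow> real"
  assumes g: "\<And>t. (g has_real_derivative g' t) (at t)" and g2: "(g' has_real_derivative l) (at 0)"
    and d: "0 < d" "\<And>t. \<bar>t\<bar> < d \<Longrightarrow> g 0 \<le> g t"
  shows "0 \<le> l"
proof (rule ccontr)
  assume "\<not> 0 \<le> l"
  have z: "g' 0 = 0"
    by (rule DERIV_local_min[OF g d(1)]) (use d in auto)
  obtain e where e: "0 < e" "\<And>h. 0 < h \<Longrightarrow> h < e \<Longrightarrow> g' h < 0"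
    using DERIV_neg_dec_right[OF g2] \<open>\<not> 0 \<le> l\<close> z by auto
  define t where "t = min d e / 2"
  have t: "0 < t" "t < d" "t < e" using d e by (auto simp: t_def)
  obtain c where "0 < c" "c < t" "g t - g 0 = (t - 0) * g' c"
    using MVT2[OF t(1), of g g'] g by auto
  moreover have "g' c < 0" using e t \<open>0 < c\<close> \<open>c < t\<close> by auto
  ultimately have "g t < g 0" using t by (smt (verit) mult_pos_neg)
  with d(2)[of t] t show False by auto
qed

text \<open>Comparison of a positive supersolution with \<open>(r\<^sup>2 - |y - x|\<^sup>2)\<^sup>2\<close>, at the maximum of the
  quotient; this bounds the first Dirichlet eigenvalue of the ball.\<close>

lemma exists_small_potential:
  fixes u :: "real^'n::finite \<Rightarrow> real"
  assumes u: "C2_fun u" and pos: "\<And>y. 0 < u y" and r: "0 < r"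
  shows "\<exists>y. dist x y < r \<and> - laplacian u y \<le> ((real CARD('n) + 2)\<^sup>2 / 2) / r\<^sup>2 * u y"
proof -
  define S where "S y = r\<^sup>2 - (y - x) \<bullet> (y - x)" for y
  have cu: "continuous_on UNIV u" using u by (simp add: C1_continuous C2_C1)
  have "\<exists>y\<in>cball x r. \<forall>z\<in>cball x r. (S z)\<^sup>2 / u z \<le> (S y)\<^sup>2 / u y"
    by (rule continuous_attains_sup)
       (use r pos in \<open>auto simp: S_def intro!: continuous_intros continuous_on_subset[OF cu] simp: less_imp_neq[OF pos, symmetric]\<close>)
  then obtain y where y: "dist x y \<le> r" "\<And>z. dist x z \<le> r \<Longrightarrow> (S z)\<^sup>2 / u z \<le> (S y)\<^sup>2 / u y"
    by auto
  define m where "m = (S y)\<^sup>2 / u y"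
  have "(S x)\<^sup>2 / u x > 0" using r pos by (simp add: S_def)
  with y(2)[of x] r have m: "m > 0" by (auto simp: m_def)
  have Sy: "S y \<noteq> 0" using m by (auto simp: m_def)
  have S_dist: "S z = r\<^sup>2 - (dist x z)\<^sup>2" for z
    by (subst dist_commute) (simp add: S_def dist_norm power2_norm_eq_inner)
  have "(dist x y)\<^sup>2 \<le> r\<^sup>2" using y(1) by (intro power_mono) auto
  with Sy have Sp: "S y > 0" by (simp add: S_dist)
  hence yr: "dist x y < r" using y(1) by (auto simp: S_dist order_less_le)
  \<comment> \<open>\<open>m * u - S\<^sup>2\<close> vanishes at \<open>y\<close> and is nonnegative
    around it, so its pure second derivatives at \<open>y\<close> are nonnegative; those of
    \<open>S\<^sup>2\<close> are \<open>8 * ((y - x) $ i)\<^sup>2 - 4 * S y\<close>.\<close>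
  have second: "0 \<le> m * partial_deriv i (partial_deriv i u) y - (8 * ((y - x) $ i)\<^sup>2 - 4 * S y)" for i
  proof -
    define e :: "real^'n" where "e = axis i 1"
    define p where "p = partial_deriv i u"
    have ee: "e \<bullet> e = 1" by (simp add: e_def inner_axis)
    have Sline: "((\<lambda>t. S (y + t *\<^sub>R e)) has_real_derivative - 2 * ((y - x) \<bullet> e + t)) (at t)" for t
    proof -
      have "S (y + t *\<^sub>R e) = S y - 2 * t * ((y - x) \<bullet> e) - t\<^sup>2" for t
        by (simp add: S_def inner_simps inner_commute ee power2_eq_square algebra_simps)
      thus ?thesis by (auto intro!: derivative_eq_intros)
    qed
    have uline: "((\<lambda>t. u (y + t *\<^sub>R e)) has_real_derivative p (y + t *\<^sub>R e)) (at t)" for t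
    proof -
      have "((\<lambda>t. u (y + t *\<^sub>R e)) has_real_derivative gradient u (y + t *\<^sub>R e) \<bullet> e) (at t)"
        by (intro has_derivative_along_line C1_has_derivative C2_C1 u)
      thus ?thesis by (simp add: e_def p_def inner_axis gradient_nth)
    qed
    have pline: "((\<lambda>t. p (y + t *\<^sub>R e)) has_real_derivative partial_deriv i p y) (at 0)"
    proof -
      have "((\<lambda>t. p (y + t *\<^sub>R e)) has_real_derivative gradient p (y + 0 *\<^sub>R e) \<bullet> e) (at 0)"
        unfolding p_def by (intro has_derivative_along_line C1_has_derivative C2_C1 u)
      thus ?thesis by (simp add: e_def inner_axis gradient_nth)
    qed
    show ?thesis unfolding p_def[symmetric]
    proof (rule local_min_second_deriv_nonneg)
      show "((\<lambda>t. m * u (y + t *\<^sub>R e) - (S (y + t *\<^sub>R e))\<^sup>2) has_real_derivative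
         m * p (y + t *\<^sub>R e) + 4 * (S (y + t *\<^sub>R e) * ((y - x) \<bullet> e + t))) (at t)" for t
        by (rule derivative_eq_intros uline Sline refl)+ (simp add: power2_eq_square algebra_simps)
      show "((\<lambda>t. m * p (y + t *\<^sub>R e) + 4 * (S (y + t *\<^sub>R e) * ((y - x) \<bullet> e + t)))
         has_real_derivative m * partial_deriv i p y - (8 * ((y - x) $ i)\<^sup>2 - 4 * S y)) (at 0)"
        by (rule derivative_eq_intros pline Sline refl)+
           (simp add: e_def inner_axis power2_eq_square algebra_simps)
      show "0 < r - dist x y" using yr by simp
      fix t :: real assume t: "\<bar>t\<bar> < r - dist x y"
      have "dist x (y + t *\<^sub>R e) \<le> dist x y + dist y (y + t *\<^sub>R e)" by (rule dist_triangle)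
      also have "dist y (y + t *\<^sub>R e) = \<bar>t\<bar>" by (simp add: dist_norm e_def)
      finally have "(S (y + t *\<^sub>R e))\<^sup>2 / u (y + t *\<^sub>R e) \<le> m"
        using t unfolding m_def by (intro y(2)) auto
      hence "(S (y + t *\<^sub>R e))\<^sup>2 \<le> m * u (y + t *\<^sub>R e)"
        using pos by (simp add: divide_simps)
      moreover have "m * u y - (S y)\<^sup>2 = 0" using pos[of y] by (simp add: m_def)
      ultimately show "m * u (y + 0 *\<^sub>R e) - (S (y + 0 *\<^sub>R e))\<^sup>2 \<le> m * u (y + t *\<^sub>R e) - (S (y + t *\<^sub>R e))\<^sup>2"
        by simp
    qed
  qed
  define n where "n = real CARD('n)"
  have "0 \<le> (\<Sum>i\<in>UNIV. m * partial_deriv i (partial_deriv i u) y - (8 * ((y - x) $ i)\<^sup>2 - 4 * S y))"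
    by (intro sum_nonneg second)
  also have "\<dots> = m * laplacian u y - 8 * ((y - x) \<bullet> (y - x)) + 4 * n * S y"
    by (simp add: laplacian_def inner_vec_def sum_subtractf sum.distrib sum_distrib_left power2_eq_square n_def)
  also have "(y - x) \<bullet> (y - x) = r\<^sup>2 - S y" by (simp add: S_def)
  finally have "m * (- laplacian u y) \<le> 4 * (n + 2) * S y - 8 * r\<^sup>2"
    by (simp add: algebra_simps)
  \<comment> \<open>Completing the square in \<open>S y\<close>; \<open>(n + 2)\<^sup>2 / 2\<close>
    is the smallest factor that works for every real value of \<open>S y\<close>.\<close>
  also have "\<dots> \<le> ((n + 2)\<^sup>2 / 2) / r\<^sup>2 * (S y)\<^sup>2"
  proof -
    have "0 \<le> ((n + 2) * S y / r - 4 * r)\<^sup>2" by simp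
    also have "\<dots> = 2 * (((n + 2)\<^sup>2 / 2) / r\<^sup>2 * (S y)\<^sup>2 - (4 * (n + 2) * S y - 8 * r\<^sup>2))"
      using r by (simp add: power2_eq_square field_simps)
    finally show ?thesis by simp
  qed
  also have "\<dots> = m * (((n + 2)\<^sup>2 / 2) / r\<^sup>2 * u y)"
    using pos[of y] by (simp add: m_def)
  finally have "- laplacian u y \<le> ((n + 2)\<^sup>2 / 2) / r\<^sup>2 * u y"
    using m by (subst (asm) mult_le_cancel_left_pos) auto
  with yr show ?thesis by (auto simp: n_def)
qed

section \<open>Convex nonlinearities\<close>

locale convex_nonlinearity =
  fixes f :: "real \<Rightarrow> real"
  assumes cont: "continuous_on {0..} f" and C2: "C2_on_pos f" and convex: "convex_on {0..} f"
    and pos: "\<And>t. 0 < t \<Longrightarrow> 0 < f t" and zero [simp]: "f 0 = 0"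
begin

abbreviation f' :: "real \<Rightarrow> real" where "f' \<equiv> deriv f"
abbreviation f'' :: "real \<Rightarrow> real" where "f'' \<equiv> deriv (deriv f)"

lemma has_deriv: "0 < t \<Longrightarrow> (f has_real_derivative f' t) (at t)"
  using C2 by (auto simp: C2_on_pos_def DERIV_deriv_iff_real_differentiable)

lemma has_deriv2: "0 < t \<Longrightarrow> (f' has_real_derivative f'' t) (at t)"
  using C2 by (auto simp: C2_on_pos_def DERIV_deriv_iff_real_differentiable)

lemma above_tangent: "0 < c \<Longrightarrow> 0 \<le> x \<Longrightarrow> f' c * (x - c) \<le> f x - f c"
  by (rule convex_on_imp_above_tangent[OF convex])
     (auto intro: has_field_derivative_at_within has_deriv simp: connected_iff_interval)

lemma deriv_mono:
  assumes "0 < s" "s \<le> t"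
  shows "f' s \<le> f' t"
proof (cases "s = t")
  case False
  have "f' s * (t - s) \<le> f' t * (t - s)"
    using above_tangent[of s t] above_tangent[of t s] assms minus_mult_right[of "f' t" "t - s"] by simp
  thus ?thesis using assms False by simp
qed simp

lemma le_deriv: "0 < t \<Longrightarrow> f t \<le> t * f' t"
  using above_tangent[of t 0] by (simp add: algebra_simps)

lemma deriv_pos:
  assumes "0 < t"
  shows "0 < f' t"
proof -
  have "0 < t * f' t" using le_deriv[OF assms] pos[OF assms] by linarith
  thus ?thesis using assms by (rule zero_less_mult_pos)
qed

lemma deriv2_nonneg: "0 < t \<Longrightarrow> 0 \<le> f'' t"
proof (rule ccontr)
  assume t: "0 < t" "\<not> 0 \<le> f'' t"
  obtain d where "0 < d" "\<And>h. 0 < h \<Longrightarrow> h < d \<Longrightarrow> f' (t + h) < f' t"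
    using DERIV_neg_dec_right[OF has_deriv2[OF t(1)]] t(2) by auto
  from this(1) this(2)[of "d / 2"] deriv_mono[OF t(1), of "t + d / 2"] show False by auto
qed

lemma strict_mono: "0 \<le> s \<Longrightarrow> s < t \<Longrightarrow> f s < f t"
proof (cases "s = 0")
  case False
  assume st: "0 \<le> s" "s < t"
  have "0 < f' s * (t - s)" using st False deriv_pos[of s] by (intro mult_pos_pos) auto
  with False above_tangent[of s t] st show ?thesis by simp
qed (use pos in auto)

lemma mono: "0 \<le> s \<Longrightarrow> s \<le> t \<Longrightarrow> f s \<le> f t"
  using strict_mono[of s t] by (cases "s = t") auto

lemma tendsto_0: "(f \<longlongrightarrow> 0) (at_right 0)"
proof -
  have "(f \<longlongrightarrow> f 0) (at 0 within {0..})"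
    using cont unfolding continuous_on_def by (metis atLeast_iff order_refl)
  hence "(f \<longlongrightarrow> f 0) (at_right 0)"
    by (rule tendsto_within_subset) auto
  thus ?thesis by simp
qed

lemma quotient_mono: "0 < s \<Longrightarrow> s \<le> t \<Longrightarrow> f s / s \<le> f t / t"
proof -
  assume st: "0 < s" "s \<le> t"
  have "f ((1 - s / t) *\<^sub>R 0 + (s / t) *\<^sub>R t) \<le> (1 - s / t) * f 0 + s / t * f t"
    by (rule convex_onD[OF convex]) (use st in auto)
  thus ?thesis using st by (simp add: field_simps)
qed

text \<open>The hypothesis says that \<open>f' * f powr (-\<sigma>)\<close> is nonincreasing near 0.
  Away from 0 and up to \<open>M\<close>, both \<open>f\<close> and \<open>f'\<close> lie between
  positive constants, which costs the factor \<open>C\<close>. In this way a condition at 0 reaches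
  all values of a bounded solution.\<close>

lemma deriv_growth_upper:
  assumes ev: "\<forall>\<^sub>F t in at_right 0. f t * f'' t \<le> \<sigma> * (f' t)\<^sup>2" and M: "0 < M" and s0: "0 \<le> \<sigma>"
  obtains C where "0 < C"
    "\<And>s t. 0 < s \<Longrightarrow> s \<le> t \<Longrightarrow> t \<le> M \<Longrightarrow> f' t * f s powr \<sigma> \<le> C * (f' s * f t powr \<sigma>)"
proof -
  obtain b where b: "0 < b" "\<And>t. 0 < t \<Longrightarrow> t < b \<Longrightarrow> f t * f'' t \<le> \<sigma> * (f' t)\<^sup>2"
    using ev by (auto simp: eventually_at_right_field)
  define a where "a = b / 2"
  have a: "0 < a" "a < b" using b by (auto simp: a_def)
  have base: "f' t * f s powr \<sigma> \<le> f' s * f t powr \<sigma>" if st: "0 < s" "s \<le> t" "t \<le> a" for s t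
  proof -
    have "f' t * f t powr (-\<sigma>) \<le> f' s * f s powr (-\<sigma>)"
    proof (rule DERIV_nonpos_imp_nonincreasing[OF st(2)])
      fix x assume x: "s \<le> x" "x \<le> t"
      hence x0: "0 < x" "x < b" using st a by auto
      have fx: "0 < f x" using x0 pos by auto
      have "((\<lambda>x. f' x * f x powr (-\<sigma>)) has_real_derivative
          (f x * f'' x - \<sigma> * (f' x)\<^sup>2) * f x powr (-\<sigma> - 1)) (at x)"
      proof -
        have "((\<lambda>x. f' x * f x powr (-\<sigma>)) has_real_derivative
            f' x * (-\<sigma> * f x powr (-\<sigma> - 1) * f' x) + f'' x * f x powr (-\<sigma>)) (at x)"
          using DERIV_mult'[OF has_deriv2[OF x0(1)] DERIV_fun_powr[OF has_deriv[OF x0(1)] fx, of "-\<sigma>"]]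
          by simp
        moreover have "f x powr (-\<sigma>) = f x * f x powr (-\<sigma> - 1)"
          using fx powr_mult_base[of "f x" "-\<sigma> - 1"] by simp
        ultimately show ?thesis by (simp add: algebra_simps power2_eq_square)
      qed
      moreover have "(f x * f'' x - \<sigma> * (f' x)\<^sup>2) * f x powr (-\<sigma> - 1) \<le> 0"
        using b(2)[OF x0] by (intro mult_nonpos_nonneg) auto
      ultimately show "\<exists>y. ((\<lambda>x. f' x * f x powr (-\<sigma>)) has_real_derivative y) (at x) \<and> y \<le> 0"
        by blast
    qed
    moreover have "0 < f s" "0 < f t" using pos st by auto
    ultimately show ?thesis by (simp add: powr_minus field_simps)
  qed
  define C where "C = 1 + f' M / f' a"
  have fa: "0 < f' a" "0 < f' M" using deriv_pos a M by auto
  have C1: "1 \<le> C" using fa by (simp add: C_def)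
  have CM: "f' M \<le> C * f' a" using fa by (simp add: C_def field_simps)
  show thesis
  proof
    show "0 < C" using C1 by simp
    fix s t assume st: "0 < s" "s \<le> t" "t \<le> M"
    have nn: "0 \<le> f' s * f t powr \<sigma>" "0 \<le> f s powr \<sigma>" using deriv_pos[OF st(1)] by auto
    show "f' t * f s powr \<sigma> \<le> C * (f' s * f t powr \<sigma>)"
    proof (cases "t \<le> a")
      case True
      have "f' t * f s powr \<sigma> \<le> 1 * (f' s * f t powr \<sigma>)" using base[OF st(1,2) True] by simp
      also have "\<dots> \<le> C * (f' s * f t powr \<sigma>)" by (intro mult_right_mono C1 nn)
      finally show ?thesis .
    next
      case False
      have "f' t * f s powr \<sigma> \<le> C * f' a * f s powr \<sigma>"
        using deriv_mono[of t M] st CM nn by (intro mult_right_mono) auto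
      also have "f' a * f s powr \<sigma> \<le> f' s * f t powr \<sigma>"
      proof (cases "s \<le> a")
        case True
        have "f' a * f s powr \<sigma> \<le> f' s * f a powr \<sigma>" using base[OF st(1) True] by simp
        also have "\<dots> \<le> f' s * f t powr \<sigma>"
          using False a pos[of a] deriv_pos[OF st(1)] mono[of a t] s0
          by (intro mult_left_mono powr_mono2) auto
        finally show ?thesis .
      next
        case False
        show ?thesis
          using False a st deriv_pos[of s] deriv_mono[of a s] mono[of s t] pos[of s] s0
          by (intro mult_mono powr_mono2) auto
      qed
      hence "C * f' a * f s powr \<sigma> \<le> C * (f' s * f t powr \<sigma>)"
        using C1 by (simp add: mult.assoc)
      finally show ?thesis .
    qed
  qed
qed

text \<open>The mirror image: \<open>f' * f powr (-\<sigma>)\<close> is nondecreasing near 0, and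
  beyond that range the factor \<open>(f a / f M) powr \<sigma>\<close> brings \<open>f t\<close>
  down to \<open>f a\<close>.\<close>

lemma deriv_growth_lower:
  assumes ev: "\<forall>\<^sub>F t in at_right 0. \<sigma> * (f' t)\<^sup>2 \<le> f t * f'' t" and M: "0 < M" and s0: "0 \<le> \<sigma>"
  obtains c where "0 < c"
    "\<And>s t. 0 < s \<Longrightarrow> s \<le> t \<Longrightarrow> t \<le> M \<Longrightarrow> c * (f' s * f t powr \<sigma>) \<le> f' t * f s powr \<sigma>"
proof -
  obtain b where b: "0 < b" "\<And>t. 0 < t \<Longrightarrow> t < b \<Longrightarrow> \<sigma> * (f' t)\<^sup>2 \<le> f t * f'' t"
    using ev by (auto simp: eventually_at_right_field)
  define a where "a = min (b / 2) M"
  have a: "0 < a" "a < b" "a \<le> M" using b M by (auto simp: a_def)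
  have base: "f' s * f t powr \<sigma> \<le> f' t * f s powr \<sigma>" if st: "0 < s" "s \<le> t" "t \<le> a" for s t
  proof -
    have "f' s * f s powr (-\<sigma>) \<le> f' t * f t powr (-\<sigma>)"
    proof (rule DERIV_nonneg_imp_nondecreasing[OF st(2)])
      fix x assume x: "s \<le> x" "x \<le> t"
      hence x0: "0 < x" "x < b" using st a by auto
      have fx: "0 < f x" using x0 pos by auto
      have "((\<lambda>x. f' x * f x powr (-\<sigma>)) has_real_derivative
          (f x * f'' x - \<sigma> * (f' x)\<^sup>2) * f x powr (-\<sigma> - 1)) (at x)"
      proof -
        have "((\<lambda>x. f' x * f x powr (-\<sigma>)) has_real_derivative
            f' x * (-\<sigma> * f x powr (-\<sigma> - 1) * f' x) + f'' x * f x powr (-\<sigma>)) (at x)"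
          using DERIV_mult'[OF has_deriv2[OF x0(1)] DERIV_fun_powr[OF has_deriv[OF x0(1)] fx, of "-\<sigma>"]]
          by simp
        moreover have "f x powr (-\<sigma>) = f x * f x powr (-\<sigma> - 1)"
          using fx powr_mult_base[of "f x" "-\<sigma> - 1"] by simp
        ultimately show ?thesis by (simp add: algebra_simps power2_eq_square)
      qed
      moreover have "0 \<le> (f x * f'' x - \<sigma> * (f' x)\<^sup>2) * f x powr (-\<sigma> - 1)"
        using b(2)[OF x0] by (intro mult_nonneg_nonneg) auto
      ultimately show "\<exists>y. ((\<lambda>x. f' x * f x powr (-\<sigma>)) has_real_derivative y) (at x) \<and> 0 \<le> y"
        by blast
    qed
    moreover have "0 < f s" "0 < f t" using pos st by auto
    ultimately show ?thesis by (simp add: powr_minus field_simps)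
  qed
  define c where "c = (f a / f M) powr \<sigma>"
  have fa: "0 < f a" "0 < f M" "f a \<le> f M" using pos a M mono[of a M] by auto
  have c1: "c \<le> 1" unfolding c_def using fa s0 by (intro powr_le1) auto
  have c0: "0 < c" using fa by (simp add: c_def)
  have ca: "c * f t powr \<sigma> \<le> f a powr \<sigma>" if "0 < t" "t \<le> M" for t
  proof -
    have "c * f t powr \<sigma> \<le> c * f M powr \<sigma>"
      using that pos[of t] mono[of t M] s0 c0 by (intro mult_left_mono powr_mono2) auto
    also have "\<dots> = f a powr \<sigma>" using fa by (simp add: c_def powr_divide)
    finally show ?thesis .
  qed
  show thesis
  proof
    show "0 < c" by (rule c0)
    fix s t assume st: "0 < s" "s \<le> t" "t \<le> M"
    have nn: "0 \<le> f' s * f t powr \<sigma>" "0 \<le> f s powr \<sigma>" "0 < f' s" using deriv_pos[OF st(1)] by auto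
    show "c * (f' s * f t powr \<sigma>) \<le> f' t * f s powr \<sigma>"
    proof (cases "t \<le> a")
      case True
      have "c * (f' s * f t powr \<sigma>) \<le> 1 * (f' s * f t powr \<sigma>)" by (intro mult_right_mono c1 nn)
      also have "\<dots> \<le> f' t * f s powr \<sigma>" using base[OF st(1,2) True] by simp
      finally show ?thesis .
    next
      case False
      have "c * (f' s * f t powr \<sigma>) = f' s * (c * f t powr \<sigma>)" by simp
      also have "\<dots> \<le> f' s * f a powr \<sigma>" using ca[of t] st nn by (intro mult_left_mono) auto
      also have "\<dots> \<le> f' t * f s powr \<sigma>"
      proof (cases "s \<le> a")
        case True
        have "f' s * f a powr \<sigma> \<le> f' a * f s powr \<sigma>" using base[OF st(1) True] by simp
        also have "\<dots> \<le> f' t * f s powr \<sigma>"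
          using False a deriv_mono[of a t] nn by (intro mult_right_mono) auto
        finally show ?thesis .
      next
        case False
        show ?thesis
          using False a st deriv_pos[of s] deriv_mono[of s t] mono[of a s] fa s0
          by (intro mult_mono powr_mono2) auto
      qed
      finally show ?thesis .
    qed
  qed
qed

text \<open>If \<sigma> were larger than 1, then \<open>f' \<le> C * f powr \<sigma>\<close> and
  \<open>f t \<le> t * f' t\<close> would give 1 <= C t f(t)^(\<sigma> - 1), which fails as t tends
  to 0. This is what yields \<open>1 \<le> q0\<close>.\<close>

lemma growth_exponent_le_1:
  assumes ev: "\<forall>\<^sub>F t in at_right 0. \<sigma> * (f' t)\<^sup>2 \<le> f t * f'' t"
  shows "\<sigma> \<le> 1"
proof (rule ccontr)
  assume "\<not> \<sigma> \<le> 1"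
  hence s: "1 < \<sigma>" by simp
  obtain c where c: "0 < c" "\<And>s t. 0 < s \<Longrightarrow> s \<le> t \<Longrightarrow> t \<le> 1 \<Longrightarrow>
      c * (f' s * f t powr \<sigma>) \<le> f' t * f s powr \<sigma>"
    using deriv_growth_lower[OF ev, of 1] s by auto
  define K where "K = f' 1 * f 1 powr (\<sigma> - 1)"
  define d where "d = c * f 1 powr \<sigma>"
  have Kd: "0 < K" "0 < d" using deriv_pos[of 1] pos[of 1] c by (auto simp: K_def d_def)
  have *: "d \<le> K * s" if s': "0 < s" "s \<le> 1" for s
  proof -
    have fs: "0 < f s" "0 < f' s" using pos deriv_pos s' by auto
    have "d * f' s \<le> f' 1 * f s powr \<sigma>" using c(2)[of s 1] s' by (simp add: d_def mult_ac)
    also have "f s powr \<sigma> = f s * f s powr (\<sigma> - 1)" using fs by (simp add: powr_diff)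
    also have "\<dots> \<le> (s * f' s) * f 1 powr (\<sigma> - 1)"
      using le_deriv[of s] s' fs mono[of s 1] s by (intro mult_mono powr_mono2) auto
    hence "f' 1 * (f s * f s powr (\<sigma> - 1)) \<le> f' 1 * ((s * f' s) * f 1 powr (\<sigma> - 1))"
      using deriv_pos[of 1] by (intro mult_left_mono) auto
    finally have "d * f' s \<le> (K * s) * f' s" by (simp add: K_def mult_ac)
    thus ?thesis using fs by simp
  qed
  define s where "s = min 1 (d / (2 * K))"
  have "d \<le> K * s" using Kd by (intro *) (auto simp: s_def)
  also have "K * s \<le> K * (d / (2 * K))" using Kd by (intro mult_left_mono) (auto simp: s_def)
  finally show False using Kd by simp
qed

text \<open>The growth estimate with upper end \<open>M\<close> reads
  \<open>f' \<ge> k * f powr \<sigma>\<close>, and this is integrated from 0. For small \<sigma> it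
  bounds \<open>f\<close> from below by a power of \<open>t\<close> with exponent close to
  1.\<close>

lemma lower_power_bound:
  assumes ev: "\<forall>\<^sub>F t in at_right 0. f t * f'' t \<le> \<sigma> * (f' t)\<^sup>2" and M: "0 < M"
    and s: "0 \<le> \<sigma>" "\<sigma> < 1"
  obtains c where "0 < c" "\<And>t. 0 < t \<Longrightarrow> t \<le> M \<Longrightarrow> c * t \<le> f t powr (1 - \<sigma>)"
proof -
  obtain C where C: "0 < C"
    "\<And>s t. 0 < s \<Longrightarrow> s \<le> t \<Longrightarrow> t \<le> M \<Longrightarrow> f' t * f s powr \<sigma> \<le> C * (f' s * f t powr \<sigma>)"
    using deriv_growth_upper[OF ev M s(1)] by metis
  define k where "k = f' M / (C * f M powr \<sigma>)"
  have k: "0 < k" using C deriv_pos[OF M] pos[OF M] by (simp add: k_def)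
  have low: "k * f t powr \<sigma> \<le> f' t" if "0 < t" "t \<le> M" for t
    using C(2)[of t M] that C(1) pos[OF M] by (simp add: k_def field_simps)
  define G where "G t = f t powr (1 - \<sigma>) - k * (1 - \<sigma>) * t" for t
  have G: "G r \<le> G t" if rt: "0 < r" "r \<le> t" "t \<le> M" for r t
  proof (rule DERIV_nonneg_imp_nondecreasing[OF rt(2)])
    fix x assume x: "r \<le> x" "x \<le> t"
    hence x0: "0 < x" "x \<le> M" using rt by auto
    have fx: "0 < f x" using x0 pos by auto
    have "((\<lambda>x. f x powr (1 - \<sigma>)) has_real_derivative (1 - \<sigma>) * f x powr (-\<sigma>) * f' x) (at x)"
      using DERIV_fun_powr[OF has_deriv[OF x0(1)] fx, of "1 - \<sigma>"] by simp
    moreover have "((\<lambda>x. k * (1 - \<sigma>) * x) has_real_derivative k * (1 - \<sigma>)) (at x)"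
      by (rule DERIV_cmult_Id)
    ultimately have "(G has_real_derivative (1 - \<sigma>) * f x powr (-\<sigma>) * f' x - k * (1 - \<sigma>)) (at x)"
      unfolding G_def by (rule DERIV_diff)
    hence "(G has_real_derivative (1 - \<sigma>) * (f x powr (-\<sigma>) * f' x - k)) (at x)"
      by (simp add: algebra_simps)
    moreover have "0 \<le> f x powr (-\<sigma>) * f' x - k"
      using low[OF x0] fx by (simp add: powr_minus field_simps)
    ultimately show "\<exists>y. (G has_real_derivative y) (at x) \<and> 0 \<le> y"
      using s by (intro exI conjI) (assumption, simp)
  qed
  have Gpos: "0 \<le> G t" if t: "0 < t" "t \<le> M" for t
  proof (rule ccontr)
    assume neg: "\<not> 0 \<le> G t"
    define K where "K = k * (1 - \<sigma>)"
    have K: "0 < K" using k s by (simp add: K_def)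
    \<comment> \<open>A negative value of \<open>G\<close> would persist to the left by
      monotonicity, while \<open>G r\<close> is at least \<open>- (K * r)\<close>; this
      \<open>r\<close> is small enough for a contradiction.\<close>
    define r where "r = min t (- G t / (2 * K))"
    have r: "0 < r" "r \<le> t" using t neg K by (auto simp: r_def divide_neg_pos)
    have "K * r \<le> K * (- G t / (2 * K))" using K by (intro mult_left_mono) (auto simp: r_def)
    hence "K * r \<le> - G t / 2" using K by simp
    moreover have "- (K * r) \<le> G r" by (simp add: G_def K_def)
    ultimately show False using G[OF r t(2)] neg by simp
  qed
  show thesis
  proof
    show "0 < k * (1 - \<sigma>)" using k s by simp
    show "k * (1 - \<sigma>) * t \<le> f t powr (1 - \<sigma>)" if "0 < t" "t \<le> M" for t
      using Gpos[OF that] by (simp add: G_def)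
  qed
qed

text \<open>The multiplier \<open>f powr a\<close> only works while \<open>f f'' \<ge> \<sigma> f'\<^sup>2\<close>, that is near \<open>0\<close>. Further away, where
  merely \<open>f'' \<ge> 0\<close> is known, it has to be replaced by a function close to an affine function of \<open>f\<close>;
  \<open>f powr a * (f + c) powr (1 - a)\<close> interpolates between the two.\<close>

lemma exists_multipliers:
  assumes a: "1 < a" and sig: "(a - 1)\<^sup>2 < \<sigma>" and M: "0 < M"
    and ev: "\<forall>\<^sub>F t in at_right 0. \<sigma> * (f' t)\<^sup>2 \<le> f t * f'' t"
  obtains \<alpha> \<alpha>' \<beta> :: "real \<Rightarrow> real" and \<kappa> c1 c2 :: real
  where "0 < \<kappa>" "\<kappa> < 1" "0 < c1" "0 < c2"
    "\<And>t. 0 < t \<Longrightarrow> 0 < \<alpha> t" "\<And>t. 0 < t \<Longrightarrow> 0 \<le> \<alpha>' t"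
    "\<And>t. 0 < t \<Longrightarrow> (\<alpha> has_real_derivative \<alpha>' t) (at t)" "continuous_on {0<..} \<alpha>'"
    "\<And>t. 0 < t \<Longrightarrow> (\<beta> has_real_derivative (\<alpha>' t)\<^sup>2) (at t)"
    "\<And>t. 0 < t \<Longrightarrow> 0 \<le> \<beta> t"
    "\<And>t. 0 < t \<Longrightarrow> t \<le> M \<Longrightarrow> \<beta> t \<le> \<alpha> t * \<alpha>' t"
    "\<And>t. 0 < t \<Longrightarrow> t \<le> M \<Longrightarrow> \<beta> t * f t \<le> \<kappa> * (f' t * (\<alpha> t)\<^sup>2)"
    "\<And>t. 0 < t \<Longrightarrow> t \<le> M \<Longrightarrow> c1 * f t powr (2 * a) \<le> (\<alpha> t)\<^sup>2"
    "\<And>t. 0 < t \<Longrightarrow> t \<le> M \<Longrightarrow> (\<alpha> t)\<^sup>2 \<le> c2 * f t powr (2 * a)"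
proof -
  obtain b where b: "0 < b" "\<And>t. 0 < t \<Longrightarrow> t < b \<Longrightarrow> \<sigma> * (f' t)\<^sup>2 \<le> f t * f'' t"
    using ev by (auto simp: eventually_at_right_field)
  define t0 where "t0 = min (b / 2) M"
  have t0: "0 < t0" "t0 < b" "t0 \<le> M" using b M by (auto simp: t0_def)
  have sig0: "0 < \<sigma>" using sig zero_le_power2[of "a - 1"] by linarith
  \<comment> \<open>The first entry is the ratio that belongs to \<open>f powr a\<close>; it is
    below 1 exactly when \<open>(a - 1)\<^sup>2 < \<sigma>\<close>. The second entry is the same
    ratio at exponent 1.\<close>
  define k where "k = max (a\<^sup>2 / (2 * a - 1 + \<sigma>)) (1 / (1 + \<sigma>))"
  have k: "0 < k" "k < 1" "a\<^sup>2 \<le> k * (2 * a - 1 + \<sigma>)" "1 \<le> k * (1 + \<sigma>)"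
  proof -
    have "a\<^sup>2 < 2 * a - 1 + \<sigma>" using sig by (simp add: power2_eq_square algebra_simps)
    thus "k < 1" using a sig0 by (simp add: k_def)
    have "1 / (1 + \<sigma>) \<le> k" by (simp add: k_def)
    moreover have "0 < 1 / (1 + \<sigma>)" using sig0 by simp
    ultimately show "0 < k" by linarith
    show "1 \<le> k * (1 + \<sigma>)" using \<open>1 / (1 + \<sigma>) \<le> k\<close> sig0 by (simp add: field_simps)
    have "a\<^sup>2 / (2 * a - 1 + \<sigma>) \<le> k" by (simp add: k_def)
    thus "a\<^sup>2 \<le> k * (2 * a - 1 + \<sigma>)" using a sig0 by (simp add: field_simps)
  qed
  \<comment> \<open>Right side minus left side is concave in \<open>e\<close>, so the endpoints 1
    and \<open>a\<close> suffice; the identity displays it as their interpolation plus a nonnegative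
    remainder.\<close>
  have k_conv: "e\<^sup>2 \<le> k * (2 * e - 1 + \<sigma>)" if e: "1 \<le> e" "e \<le> a" for e
  proof -
    have "(a - 1) * (k * (2 * e - 1 + \<sigma>) - e\<^sup>2) =
        (a - e) * (k * (1 + \<sigma>) - 1) + (e - 1) * (k * (2 * a - 1 + \<sigma>) - a\<^sup>2) + (a - 1) * ((a - e) * (e - 1))"
      by (simp add: power2_eq_square algebra_simps)
    also have "0 \<le> \<dots>" using k e a by (intro add_nonneg_nonneg mult_nonneg_nonneg) auto
    finally show ?thesis using a by (simp add: zero_le_mult_iff)
  qed
  define w0 where "w0 = f t0"
  have w0: "0 < w0" using pos t0 by (simp add: w0_def)
  \<comment> \<open>\<open>d\<close> is half of the margin \<open>(1 - k) * w0\<close> available at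
    \<open>t0\<close>, and \<open>c\<close> satisfies \<open>(a - 1) * c = d / 2\<close>, which
    keeps \<open>A w\<close> within \<open>d / 2\<close> of \<open>w\<close>.\<close>
  define d where "d = (1 - k) * w0 / 2"
  have d: "0 < d" using k w0 by (simp add: d_def)
  define c where "c = d / (2 * (a - 1))"
  have c: "0 < c" "2 * (a - 1) * c = d" using a d by (auto simp: c_def)

  define A where "A w = exp (a * ln w - (a - 1) * ln (w + c))" for w
  \<comment> \<open>The local exponent w A'(w) / A(w) of \<open>A\<close>: close to \<open>a\<close>
    for small \<open>w\<close>, close to 1 for large \<open>w\<close>.\<close>
  define e where "e w = a - (a - 1) * w / (w + c)" for w
  have Apos: "0 < A w" for w by (simp add: A_def)
  have e: "1 \<le> e w" "e w \<le> a" if "0 < w" for w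
  proof -
    have "(a - 1) * w \<le> (a - 1) * (w + c)" using a c by (intro mult_left_mono) auto
    thus "1 \<le> e w" "e w \<le> a" using that c a by (auto simp: e_def field_simps)
  qed
  have A_deriv: "(A has_real_derivative A w * e w / w) (at w)" if w: "0 < w" for w
  proof -
    have "w + c \<noteq> 0" using w c by simp
    have "(A has_real_derivative A w * (a * (1 / w) - (a - 1) * (1 / (w + c)))) (at w)"
      unfolding A_def using w c by (auto intro!: derivative_eq_intros simp: divide_inverse)
    also have "A w * (a * (1 / w) - (a - 1) * (1 / (w + c))) = A w * e w / w"
      using w \<open>w + c \<noteq> 0\<close> by (simp add: e_def diff_divide_distrib right_diff_distrib)
    finally show ?thesis .
  qed
  \<comment> \<open>With \<open>y = w + c\<close> the derivative of \<open>A\<close> equals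
    \<open>(w / y) powr (a - 1) * ((w + a * c) / y)\<close>. Bounding each logarithm by its tangent
    at 1 gives terms that cancel.\<close>
  have A_deriv_le: "A w * e w / w \<le> 1" if w: "0 < w" for w
  proof -
    define y where "y = w + c"
    have y: "0 < y" "y \<noteq> 0" using w c by (auto simp: y_def)
    have z: "0 < w + a * c" using w a c by (simp add: add_pos_pos)
    have "(a - 1) * (ln w - ln y) \<le> (a - 1) * ((w - y) / y)"
      using a w y by (intro mult_left_mono ln_diff_le) auto
    moreover have "ln (w + a * c) - ln y \<le> (w + a * c - y) / y"
      using z y(1) by (rule ln_diff_le)
    moreover have "(a - 1) * ((w - y) / y) + (w + a * c - y) / y = 0"
      using y(2) by (simp add: y_def divide_simps) (simp add: algebra_simps)
    ultimately have le: "(a - 1) * (ln w - ln y) + (ln (w + a * c) - ln y) \<le> 0" by linarith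
    have "e w = (w + a * c) / y" using y(2) by (simp add: e_def y_def divide_simps) (simp add: algebra_simps)
    hence "e w / w = exp (ln (w + a * c) - ln y - ln w)"
      using z y w by (simp add: exp_diff)
    hence "A w * (e w / w) = exp (a * ln w - (a - 1) * ln y + (ln (w + a * c) - ln y - ln w))"
      by (simp add: A_def y_def flip: exp_add)
    also have "\<dots> \<le> 1" using le by (simp add: algebra_simps)
    finally show ?thesis by simp
  qed
  have A_le: "A w \<le> w" if w: "0 < w" for w
  proof -
    have "A w \<le> A w * e w" using e[OF w] Apos[of w] by simp
    also have "\<dots> \<le> w" using A_deriv_le[OF w] w by (simp add: divide_simps)
    finally show ?thesis .
  qed
  have A_ge: "w - (a - 1) * c \<le> A w" if w: "0 < w" for w
  proof -
    have "ln (w + c) - ln w \<le> (w + c - w) / w" using w c by (intro ln_diff_le) auto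
    hence "(a - 1) * (ln (w + c) - ln w) \<le> (a - 1) * (c / w)" using a by (intro mult_left_mono) auto
    hence "1 - (a - 1) * (c / w) \<le> 1 + (- ((a - 1) * (ln (w + c) - ln w)))" by simp
    also have "\<dots> \<le> exp (- ((a - 1) * (ln (w + c) - ln w)))" by (rule exp_ge_add_one_self)
    finally have "w * (1 - (a - 1) * (c / w)) \<le> w * exp (- ((a - 1) * (ln (w + c) - ln w)))"
      using w by (intro mult_left_mono) auto
    also have "\<dots> = exp (ln w + - ((a - 1) * (ln (w + c) - ln w)))"
      using w by (simp only: exp_add exp_ln)
    also have "\<dots> = A w" by (simp add: A_def algebra_simps)
    finally have "w * (1 - (a - 1) * (c / w)) \<le> A w" .
    moreover have "w * (1 - (a - 1) * (c / w)) = w - (a - 1) * c" using w by (simp add: right_diff_distrib)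
    ultimately show ?thesis by simp
  qed

  define \<alpha> where "\<alpha> t = A (f t)" for t
  define \<alpha>' where "\<alpha>' t = A (f t) * e (f t) / f t * f' t" for t
  have \<alpha>_deriv: "(\<alpha> has_real_derivative \<alpha>' t) (at t)" if "0 < t" for t
    unfolding \<alpha>_def \<alpha>'_def using A_deriv[OF pos[OF that]] has_deriv[OF that] by (rule DERIV_chain2)
  have cont_f: "continuous_on {0<..} f" by (rule continuous_on_subset[OF cont]) auto
  have cont_f': "continuous_on {0<..} f'"
    by (auto intro!: continuous_at_imp_continuous_on DERIV_isCont has_deriv2)
  have cont_\<alpha>': "continuous_on {0<..} \<alpha>'"
  proof -
    have "f t + c \<noteq> 0" "f t \<noteq> 0" if "0 < t" for t using pos[OF that] c by auto
    thus ?thesis unfolding \<alpha>'_def A_def e_def by (auto intro!: continuous_intros cont_f cont_f')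
  qed
  have \<alpha>'_le: "\<alpha>' t \<le> f' t" if "0 < t" for t
    unfolding \<alpha>'_def using A_deriv_le[OF pos[OF that]] deriv_pos[OF that] mult_right_mono by fastforce
  have \<alpha>'_nonneg: "0 \<le> \<alpha>' t" if "0 < t" for t
    unfolding \<alpha>'_def using pos[OF that] deriv_pos[OF that] Apos[of "f t"] e[OF pos[OF that]] by auto

  \<comment> \<open>\<beta> will be the integral of \<open>\<alpha>'\<^sup>2\<close> from 0. The
    integrand extends continuously by 0 because \<alpha>' is at most a constant times
    \<open>f powr (a - 1)\<close> near 0 and \<open>a > 1\<close>.\<close>
  have ex_anti: "\<exists>B. (\<forall>t>0. (B has_real_derivative (\<alpha>' t)\<^sup>2) (at t)) \<and> (\<forall>t>0. 0 \<le> B t) \<and> (B \<longlongrightarrow> 0) (at_right 0)"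
  proof -
    define h where "h t = (if 0 < t then (\<alpha>' t)\<^sup>2 else 0)" for t
    have lim0: "(h \<longlongrightarrow> 0) (at_right 0)"
    proof (rule tendsto_sandwich)
      define P where "P t = ((f t powr (a - 1)) * (a * f' 1 * c powr (1 - a)))\<^sup>2" for t
      show "\<forall>\<^sub>F t in at_right 0. 0 \<le> h t" by (simp add: h_def)
      show "\<forall>\<^sub>F t in at_right 0. h t \<le> P t"
      proof (rule eventually_at_rightI[of 0 1])
        fix t :: real assume t: "t \<in> {0<..<1}"
        have w: "0 < f t" using pos t by auto
        have "A (f t) / f t = f t powr (a - 1) * (f t + c) powr (1 - a)"
        proof -
          have "A (f t) / f t = exp (a * ln (f t) - (a - 1) * ln (f t + c) - ln (f t))"
            using w by (simp only: A_def exp_diff[of _ "ln (f t)"] exp_ln)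
          also have "\<dots> = exp ((a - 1) * ln (f t) + (1 - a) * ln (f t + c))"
            by (simp add: algebra_simps)
          also have "\<dots> = f t powr (a - 1) * (f t + c) powr (1 - a)"
            using w c by (simp add: powr_def exp_add)
          finally show ?thesis .
        qed
        also have "\<dots> \<le> f t powr (a - 1) * c powr (1 - a)"
          using w c a by (intro mult_left_mono powr_mono2') auto
        finally have "A (f t) / f t * e (f t) * f' t \<le> f t powr (a - 1) * c powr (1 - a) * a * f' 1"
          using e[OF w] deriv_mono[of t 1] deriv_pos[of t] t a
          by (intro mult_mono) (auto simp: w less_imp_le Apos)
        hence "\<alpha>' t \<le> f t powr (a - 1) * (a * f' 1 * c powr (1 - a))" by (simp add: \<alpha>'_def mult_ac)
        thus "h t \<le> P t" using \<alpha>'_nonneg t by (simp add: h_def P_def power_mono)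
      qed simp
      have "((\<lambda>t. f t powr (a - 1)) \<longlongrightarrow> 0) (at_right 0)"
        using a by (intro tendsto_zero_powrI[OF tendsto_0 tendsto_const])
          (auto intro!: eventually_at_rightI[of 0 1] less_imp_le pos)
      hence "(P \<longlongrightarrow> (0 * (a * f' 1 * c powr (1 - a)))\<^sup>2) (at_right 0)"
        unfolding P_def by (intro tendsto_intros)
      thus "(P \<longlongrightarrow> 0) (at_right 0)" by simp
    qed simp
    have conth: "continuous_on {0..T} h" for T
      unfolding continuous_on_def
    proof
      fix t assume t: "t \<in> {0..T}"
      show "(h \<longlongrightarrow> h t) (at t within {0..T})"
      proof (cases "t = 0")
        case True
        have "at 0 within {0..T} = at 0 within ({0..T} - {0})" by (simp add: at_within_def)
        moreover have "(h \<longlongrightarrow> 0) (at 0 within ({0..T} - {0}))"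
          by (rule tendsto_within_subset[OF lim0]) auto
        ultimately have "(h \<longlongrightarrow> 0) (at 0 within {0..T})" by simp
        thus ?thesis using True by (simp add: h_def)
      next
        case False
        hence t0: "0 < t" using t by auto
        have "isCont (\<lambda>t. (\<alpha>' t)\<^sup>2) t"
          using cont_\<alpha>' t0 by (intro continuous_intros) (simp add: continuous_on_eq_continuous_at)
        hence "((\<lambda>t. (\<alpha>' t)\<^sup>2) \<longlongrightarrow> (\<alpha>' t)\<^sup>2) (at t)" by (simp add: isCont_def)
        hence "(h \<longlongrightarrow> (\<alpha>' t)\<^sup>2) (at t)"
          by (rule Lim_transform_within_open[where s="{0<..}"]) (use t0 in \<open>auto simp: h_def\<close>)
        hence "(h \<longlongrightarrow> (\<alpha>' t)\<^sup>2) (at t within {0..T})" by (rule tendsto_within_subset) auto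
        thus ?thesis using t0 by (simp add: h_def)
      qed
    qed
    define B where "B t = integral {0..t} h" for t
    have deriv: "(B has_real_derivative (\<alpha>' t)\<^sup>2) (at t)" if "0 < t" for t
    proof -
      have "(B has_real_derivative h t) (at t within {0..t + 1})"
        unfolding B_def using that by (intro integral_has_real_derivative conth) auto
      moreover have "at t within {0..t + 1} = at t"
        using that by (intro at_within_interior) auto
      ultimately show ?thesis using that by (simp add: h_def)
    qed
    have nonneg: "0 \<le> B t" for t
      unfolding B_def by (rule Henstock_Kurzweil_Integration.integral_nonneg)
        (auto simp: h_def intro!: integrable_continuous_real conth)
    have "(B \<longlongrightarrow> 0) (at_right 0)"
    proof -
      have "continuous_on {0..1} B"
        unfolding B_def by (intro indefinite_integral_continuous_1 integrable_continuous_real conth)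
      hence "(B \<longlongrightarrow> B 0) (at 0 within {0..1})"
        unfolding continuous_on_def by (rule bspec) simp
      thus ?thesis by (simp add: B_def at_within_Icc_at_right)
    qed
    with deriv nonneg show ?thesis by blast
  qed
  then obtain \<beta> where \<beta>_deriv: "\<And>t. 0 < t \<Longrightarrow> (\<beta> has_real_derivative (\<alpha>' t)\<^sup>2) (at t)"
    and \<beta>_nonneg: "\<And>t. 0 < t \<Longrightarrow> 0 \<le> \<beta> t" and \<beta>_0: "(\<beta> \<longlongrightarrow> 0) (at_right 0)" by blast

  \<comment> \<open>Up to \<open>t0\<close> the right side minus \<beta> is nondecreasing: this is
    \<open>f * f'' \<ge> \<sigma> * f'\<^sup>2\<close> combined with \<open>k_conv\<close> at the
    local exponent. It cannot be negative because \<beta> tends to 0 at 0.\<close>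
  have near0: "\<beta> t \<le> k * (f' t * (\<alpha> t)\<^sup>2 / f t)" if t: "0 < t" "t \<le> t0" for t
  proof -
    define D where "D t = k * (f' t * (\<alpha> t)\<^sup>2 / f t) - \<beta> t" for t
    have "D s \<le> D t" if s: "0 < s" "s \<le> t" for s
    proof (rule DERIV_nonneg_imp_nondecreasing[OF s(2)])
      fix x assume x: "s \<le> x" "x \<le> t"
      hence x0: "0 < x" "x < b" using s t t0 by auto
      have w: "0 < f x" "f x \<noteq> 0" using pos[OF x0(1)] by auto
      define E where "E = e (f x)"
      have \<alpha>'E: "\<alpha>' x = \<alpha> x * E * f' x / f x" by (simp add: \<alpha>'_def \<alpha>_def E_def)
      have "(D has_real_derivative k * (((f'' x * (\<alpha> x)\<^sup>2 + 2 * (\<alpha> x * \<alpha>' x) * f' x) * f x -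
          f' x * (\<alpha> x)\<^sup>2 * f' x) / (f x * f x)) - (\<alpha>' x)\<^sup>2) (at x)"
        unfolding D_def using w(2)
        by (auto intro!: derivative_eq_intros has_deriv has_deriv2 \<alpha>_deriv \<beta>_deriv x0 simp: power2_eq_square)
           (simp add: algebra_simps)
      also have "k * (((f'' x * (\<alpha> x)\<^sup>2 + 2 * (\<alpha> x * \<alpha>' x) * f' x) * f x -
          f' x * (\<alpha> x)\<^sup>2 * f' x) / (f x * f x)) - (\<alpha>' x)\<^sup>2 =
          (\<alpha> x / f x)\<^sup>2 * (k * (f x * f'' x + (2 * E - 1) * (f' x)\<^sup>2) - E\<^sup>2 * (f' x)\<^sup>2)"
        unfolding \<alpha>'E using w(2) by (simp add: power2_eq_square divide_simps) (simp add: algebra_simps)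
      finally have "(D has_real_derivative
          (\<alpha> x / f x)\<^sup>2 * (k * (f x * f'' x + (2 * E - 1) * (f' x)\<^sup>2) - E\<^sup>2 * (f' x)\<^sup>2)) (at x)" .
      moreover have "0 \<le> k * (f x * f'' x + (2 * E - 1) * (f' x)\<^sup>2) - E\<^sup>2 * (f' x)\<^sup>2"
      proof -
        have "E\<^sup>2 * (f' x)\<^sup>2 \<le> (k * (2 * E - 1 + \<sigma>)) * (f' x)\<^sup>2"
          using k_conv[OF e[OF w(1)]] by (intro mult_right_mono) (auto simp: E_def)
        also have "\<dots> = k * (\<sigma> * (f' x)\<^sup>2 + (2 * E - 1) * (f' x)\<^sup>2)" by (simp add: algebra_simps)
        also have "\<dots> \<le> k * (f x * f'' x + (2 * E - 1) * (f' x)\<^sup>2)"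
          using b(2)[OF x0] k by (intro mult_left_mono add_right_mono) auto
        finally show ?thesis by simp
      qed
      ultimately show "\<exists>y. (D has_real_derivative y) (at x) \<and> 0 \<le> y"
        by (intro exI conjI) (assumption, simp)
    qed
    moreover have "- \<beta> s \<le> D s" if "0 < s" for s
      unfolding D_def using k deriv_pos[OF that] pos[OF that] by simp
    ultimately have Dge: "- \<beta> s \<le> D t" if "0 < s" "s \<le> t" for s using that by (meson order_trans)
    have "- 0 \<le> D t"
    proof (rule tendsto_upperbound)
      show "((\<lambda>s. - \<beta> s) \<longlongrightarrow> - 0) (at_right 0)" by (intro tendsto_minus \<beta>_0)
      show "\<forall>\<^sub>F s in at_right 0. - \<beta> s \<le> D t"
        using Dge t by (intro eventually_at_rightI[of 0 t]) auto
    qed simp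
    thus ?thesis by (simp add: D_def)
  qed
  define b0 where "b0 = k * (\<alpha> t0)\<^sup>2 / w0"
  \<comment> \<open>Beyond \<open>t0\<close> only \<open>f'' \<ge> 0\<close> is available, but there
    \<open>\<alpha>' \<le> f'\<close> already makes \<open>f' * (b0 + f - w0)\<close> grow at least
    as fast as \<beta>.\<close>
  have far: "\<beta> t \<le> f' t * (b0 + f t - w0)" if t: "t0 \<le> t" for t
  proof -
    define D where "D t = f' t * (b0 + f t - w0) - \<beta> t" for t
    have "D t0 \<le> D t"
    proof (rule DERIV_nonneg_imp_nondecreasing[OF t])
      fix x assume x: "t0 \<le> x" "x \<le> t"
      hence x0: "0 < x" using t0 by auto
      have "(D has_real_derivative f'' x * (b0 + f x - w0) + (f' x)\<^sup>2 - (\<alpha>' x)\<^sup>2) (at x)"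
        unfolding D_def
        by (auto intro!: derivative_eq_intros has_deriv has_deriv2 \<beta>_deriv x0 simp: power2_eq_square)
      moreover have "0 \<le> f'' x * (b0 + f x - w0)"
      proof (intro mult_nonneg_nonneg deriv2_nonneg x0)
        have "0 \<le> b0" using k w0 by (simp add: b0_def)
        thus "0 \<le> b0 + f x - w0" using mono[of t0 x] t0 x by (simp add: w0_def)
      qed
      moreover have "(\<alpha>' x)\<^sup>2 \<le> (f' x)\<^sup>2" using \<alpha>'_le[OF x0] \<alpha>'_nonneg[OF x0] by (rule power_mono)
      ultimately show "\<exists>y. (D has_real_derivative y) (at x) \<and> 0 \<le> y"
        by (intro exI conjI) (assumption, simp)
    qed
    moreover have "0 \<le> D t0" using near0[OF t0(1)] by (simp add: D_def b0_def w0_def mult_ac)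
    ultimately show ?thesis by (simp add: D_def)
  qed
  define \<kappa> where "\<kappa> = max k (1 - d / f M)"
  have fM: "0 < f M" using pos M by simp
  have \<kappa>: "k \<le> \<kappa>" "1 - d / f M \<le> \<kappa>" "\<kappa> < 1" using k d fM by (auto simp: \<kappa>_def)
  have main: "\<beta> t * f t \<le> \<kappa> * (f' t * (\<alpha> t)\<^sup>2)" if t: "0 < t" "t \<le> M" for t
  proof (cases "t \<le> t0")
    case True
    have "\<beta> t * f t \<le> k * (f' t * (\<alpha> t)\<^sup>2 / f t) * f t"
      using near0[OF t(1) True] pos[OF t(1)] by (intro mult_right_mono) auto
    also have "\<dots> = k * (f' t * (\<alpha> t)\<^sup>2)" using pos[OF t(1)] by simp
    also have "\<dots> \<le> \<kappa> * (f' t * (\<alpha> t)\<^sup>2)"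
      using \<kappa> deriv_pos[OF t(1)] by (intro mult_right_mono) auto
    finally show ?thesis .
  next
    case False
    hence tt: "t0 \<le> t" by simp
    define w where "w = f t"
    have w: "0 < w" "w \<le> f M" "w0 \<le> w" using pos[OF t(1)] mono[of t M] mono[of t0 t] t tt t0
      by (auto simp: w_def w0_def)
    have b0: "b0 \<le> k * w0"
    proof -
      have "(\<alpha> t0)\<^sup>2 \<le> w0\<^sup>2" using A_le[OF w0] Apos[of w0] by (intro power_mono) (auto simp: \<alpha>_def w0_def)
      hence "k * (\<alpha> t0)\<^sup>2 / w0 \<le> k * w0\<^sup>2 / w0" using k w0 by (intro divide_right_mono mult_left_mono) auto
      thus ?thesis using w0 by (simp add: b0_def power2_eq_square)
    qed
    have Asq: "(A w)\<^sup>2 \<le> w\<^sup>2" using A_le[OF w(1)] Apos[of w] by (intro power_mono) auto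
    \<comment> \<open>The margin \<open>2 * d\<close>, due to \<open>b0 \<le> k * w0\<close>, is
      spent in halves: one pays for the gap between \<open>A w\<close> and \<open>w\<close>, the
      other produces the factor \<open>1 - d / f M\<close>, strictly below 1.\<close>
    have "w * (b0 + w - w0) \<le> w * (w - 2 * d)"
    proof (rule mult_left_mono)
      have "2 * d = (1 - k) * w0" by (simp add: d_def)
      thus "b0 + w - w0 \<le> w - 2 * d" using b0 by (simp add: left_diff_distrib)
    qed (use w in simp)
    also have "\<dots> \<le> (1 - d / f M) * (A w)\<^sup>2"
    proof -
      have "w * (w - d) \<le> (A w)\<^sup>2"
      proof -
        have d2: "(a - 1) * c = d / 2" using c by (simp add: field_simps)
        have wd: "d \<le> w" using w(3) w0 k by (simp add: d_def) (smt (verit) mult_left_le_one_le)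
        have "w * (w - d) \<le> (w - d / 2)\<^sup>2" by (simp add: power2_eq_square algebra_simps)
        also have "\<dots> \<le> (A w)\<^sup>2" using A_ge[OF w(1)] wd d by (intro power_mono) (auto simp: d2)
        finally show ?thesis .
      qed
      moreover have "d / f M * (A w)\<^sup>2 \<le> d * w"
      proof -
        have "d / f M * (A w)\<^sup>2 \<le> d / w * w\<^sup>2"
          using d w fM Asq by (intro mult_mono divide_left_mono) auto
        thus ?thesis using w by (simp add: power2_eq_square)
      qed
      ultimately show ?thesis by (simp add: algebra_simps)
    qed
    also have "\<dots> \<le> \<kappa> * (A w)\<^sup>2" using \<kappa> by (intro mult_right_mono) auto
    finally have "f' t * (w * (b0 + w - w0)) \<le> f' t * (\<kappa> * (A w)\<^sup>2)"
      using deriv_pos[OF t(1)] by (intro mult_left_mono) auto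
    moreover have "\<beta> t * f t \<le> f' t * (b0 + f t - w0) * f t"
      using far[OF tt] pos[OF t(1)] by (intro mult_right_mono) auto
    ultimately show ?thesis by (simp add: w_def \<alpha>_def mult_ac)
  qed
  have pw: "(\<alpha> t)\<^sup>2 = (f t + c) powr (- 2 * (a - 1)) * f t powr (2 * a)" if "0 < t" for t
  proof -
    have "0 < f t" "0 < f t + c" using pos[OF that] c by auto
    thus ?thesis
      by (simp add: \<alpha>_def A_def powr_def power2_eq_square algebra_simps flip: exp_add)
  qed
  show thesis
  proof (rule that[of \<kappa> "(f M + c) powr (- 2 * (a - 1))" "c powr (- 2 * (a - 1))" \<alpha> \<alpha>' \<beta>])
    show "0 < \<kappa>" "\<kappa> < 1" using k \<kappa> by auto
    show "0 < (f M + c) powr (- 2 * (a - 1))" "0 < c powr (- 2 * (a - 1))" using fM c by auto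
    show "0 < \<alpha> t" if "0 < t" for t using Apos by (simp add: \<alpha>_def)
    show "\<beta> t \<le> \<alpha> t * \<alpha>' t" if t: "0 < t" "t \<le> M" for t
    proof -
      have w: "0 < f t" using pos t by auto
      have "\<beta> t * f t \<le> 1 * (f' t * (\<alpha> t)\<^sup>2)"
        using main[OF t] \<kappa>(3) deriv_pos[OF t(1)]
        by (elim order_trans, intro mult_right_mono) auto
      also have "\<dots> \<le> (e (f t)) * (f' t * (\<alpha> t)\<^sup>2)"
        using e[OF w] deriv_pos[OF t(1)] by (intro mult_right_mono) auto
      also have "\<dots> = (\<alpha> t * \<alpha>' t) * f t" using w by (simp add: \<alpha>'_def \<alpha>_def power2_eq_square)
      finally show ?thesis using w by simp
    qed
    show "(f M + c) powr (- 2 * (a - 1)) * f t powr (2 * a) \<le> (\<alpha> t)\<^sup>2" if t: "0 < t" "t \<le> M" for t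
      unfolding pw[OF t(1)] using pos[OF t(1)] c a mono[of t M] t
      by (intro mult_right_mono powr_mono2') auto
    show "(\<alpha> t)\<^sup>2 \<le> c powr (- 2 * (a - 1)) * f t powr (2 * a)" if t: "0 < t" "t \<le> M" for t
      unfolding pw[OF t(1)] using pos[OF t(1)] c a
      by (intro mult_right_mono powr_mono2') auto
  qed (use \<alpha>'_nonneg \<alpha>_deriv cont_\<alpha>' \<beta>_deriv \<beta>_nonneg main in auto)
qed

end

section \<open>Stability\<close>

locale bounded_solution = convex_nonlinearity f for f :: "real \<Rightarrow> real" +
  fixes u :: "real^'n::finite \<Rightarrow> real" and M :: real
  assumes u2: "C2_fun u" and u_pos: "\<And>x. 0 < u x" and u_le: "\<And>x. u x \<le> M"
    and lap: "\<And>x. laplacian u x = - f (u x)"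
begin

lemma M_pos: "0 < M"
  using u_pos[of 0] u_le[of 0] by linarith

lemma cont_u: "continuous_on S u"
  using C1_continuous[OF C2_C1(1)[OF u2]] by (rule continuous_on_subset) simp

lemma cont_grad: "continuous_on S (gradient u)"
  using C1_continuous_gradient[OF C2_C1(1)[OF u2]] by (rule continuous_on_subset) simp

lemma cont_compose_u: "continuous_on {0<..} h \<Longrightarrow> continuous_on S (\<lambda>x. h (u x))"
  by (rule continuous_on_compose2[OF _ cont_u]) (auto simp: u_pos)

lemma cont_f'_u: "continuous_on S (\<lambda>x. f' (u x))"
  by (rule cont_compose_u) (auto intro!: continuous_at_imp_continuous_on DERIV_isCont has_deriv2)

lemma cont_f_u: "continuous_on S (\<lambda>x. f (u x))"
  by (rule cont_compose_u) (auto intro!: continuous_at_imp_continuous_on DERIV_isCont has_deriv)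

lemma compose_u_has_derivative:
  assumes "\<And>t. 0 < t \<Longrightarrow> (h has_real_derivative h' t) (at t)"
  shows "((\<lambda>x. h (u x)) has_derivative (\<lambda>k. (h' (u x) *\<^sub>R gradient u x) \<bullet> k)) (at x)"
proof -
  have "(h has_derivative (\<lambda>k. h' (u x) * k)) (at (u x))"
    using assms[OF u_pos] by (simp add: has_field_derivative_def)
  from has_derivative_compose[OF C1_has_derivative[OF C2_C1(1)[OF u2]] this]
  show ?thesis by simp
qed

lemma f_u_C2: "C2_fun (\<lambda>x. f (u x))"
  and laplacian_f_u: "- laplacian (\<lambda>x. f (u x)) x \<le> f' (u x) * f (u x)"
proof -
  define p where "p i = partial_deriv i u" for i
  define G where "G i x = (f'' (u x) * p i x) *\<^sub>R gradient u x + f' (u x) *\<^sub>R gradient (p i) x" for i x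
  have p: "C1_fun (p i)" for i using u2 by (simp add: p_def C2_C1)
  have w: "((\<lambda>x. f (u x)) has_derivative (\<lambda>k. (f' (u x) *\<^sub>R gradient u x) \<bullet> k)) (at x)" for x
    by (rule compose_u_has_derivative[OF has_deriv])
  have c: "continuous_on UNIV (\<lambda>x. f' (u x) *\<^sub>R gradient u x)"
    by (intro continuous_intros cont_f'_u cont_grad)
  have w1: "C1_fun (\<lambda>x. f (u x))" by (rule C1I[OF w c])
  have wp: "partial_deriv i (\<lambda>x. f (u x)) = (\<lambda>x. f' (u x) * p i x)" for i
    using partial_deriv_eq[OF w] by (auto simp: p_def gradient_nth)
  have d: "((\<lambda>x. f' (u x) * p i x) has_derivative (\<lambda>k. G i x \<bullet> k)) (at x)" for i x
  proof -
    have "((\<lambda>x. f' (u x) * p i x) has_derivative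
      (\<lambda>k. f' (u x) * (gradient (p i) x \<bullet> k) + ((f'' (u x) *\<^sub>R gradient u x) \<bullet> k) * p i x)) (at x)"
      by (intro has_derivative_mult compose_u_has_derivative has_deriv2 C1_has_derivative p)
    moreover have "(\<lambda>k. f' (u x) * (gradient (p i) x \<bullet> k) + ((f'' (u x) *\<^sub>R gradient u x) \<bullet> k) * p i x) =
        (\<lambda>k. G i x \<bullet> k)"
      by (simp add: fun_eq_iff G_def inner_add_left)
    ultimately show ?thesis by simp
  qed
  have "continuous_on {0<..} f''" using C2 by (simp add: C2_on_pos_def)
  hence cG: "continuous_on UNIV (G i)" for i
    unfolding G_def
    by (intro continuous_intros cont_f'_u cont_grad cont_compose_u C1_continuous[OF p] C1_continuous_gradient[OF p])
  have "C1_fun (\<lambda>x. f' (u x) * p i x)" for i by (rule C1I[OF d cG])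
  with w1 wp show "C2_fun (\<lambda>x. f (u x))" by (simp add: C2_fun_def)
  have "laplacian (\<lambda>x. f (u x)) x = (\<Sum>i\<in>UNIV. G i x $ i)"
    unfolding laplacian_def wp using partial_deriv_eq[OF d] by simp
  also have "\<dots> = (\<Sum>i\<in>UNIV. f'' (u x) * (p i x)\<^sup>2) + f' (u x) * laplacian u x"
    by (simp add: G_def gradient_nth laplacian_def p_def sum.distrib sum_distrib_left power2_eq_square mult_ac)
  also have "\<dots> \<ge> f' (u x) * laplacian u x"
    using deriv2_nonneg[OF u_pos] by (simp add: sum_nonneg)
  finally show "- laplacian (\<lambda>x. f (u x)) x \<le> f' (u x) * f (u x)" by (simp add: lap)
qed

text \<open>Stability is tested with \<open>\<alpha> (u x) * \<eta> x\<close>, whose gradient is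
  \<open>P x + Q x\<close>. As \<beta> is an antiderivative of \<open>\<alpha>'\<^sup>2\<close>, the
  equation multiplied by \<open>\<beta> (u x) * (\<eta> x)\<^sup>2\<close> evaluates the integral of
  |P|^2; its main part is at most \<kappa> times the integral on the left and is absorbed. The bound
  \<open>\<beta> \<le> \<alpha> * \<alpha>'\<close> reduces the cross term to |P| |Q|.\<close>

lemma stable_energy:
  fixes \<eta> :: "real^'n \<Rightarrow> real"
  assumes K: "\<And>\<phi>. \<phi> \<in> C1_compact_support_off K \<Longrightarrow>
        (LINT x|lborel. f' (u x) * (\<phi> x)\<^sup>2) \<le> (LINT x|lborel. (norm (gradient \<phi> x))\<^sup>2)"
    and \<kappa>: "0 < \<kappa>" "\<kappa> < 1"
    and \<alpha>_pos: "\<And>t. 0 < t \<Longrightarrow> 0 < \<alpha> t" and \<alpha>'_nonneg: "\<And>t. 0 < t \<Longrightarrow> 0 \<le> \<alpha>' t"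
    and \<alpha>: "\<And>t. 0 < t \<Longrightarrow> (\<alpha> has_real_derivative \<alpha>' t) (at t)" and c\<alpha>': "continuous_on {0<..} \<alpha>'"
    and \<beta>: "\<And>t. 0 < t \<Longrightarrow> (\<beta> has_real_derivative (\<alpha>' t)\<^sup>2) (at t)"
    and \<beta>_nonneg: "\<And>t. 0 < t \<Longrightarrow> 0 \<le> \<beta> t"
    and \<beta>_le: "\<And>t. 0 < t \<Longrightarrow> t \<le> M \<Longrightarrow> \<beta> t \<le> \<alpha> t * \<alpha>' t"
    and \<beta>_f: "\<And>t. 0 < t \<Longrightarrow> t \<le> M \<Longrightarrow> \<beta> t * f t \<le> \<kappa> * (f' t * (\<alpha> t)\<^sup>2)"
    and \<eta>: "\<And>x. (\<eta> has_derivative (\<lambda>h. E x \<bullet> h)) (at x)" and cE: "continuous_on UNIV E"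
    and S: "compact S" "\<And>x. x \<notin> S \<Longrightarrow> \<eta> x = 0" "S \<inter> K = {}"
  shows "(1 - \<kappa>)\<^sup>2 * (LINT x|lborel. f' (u x) * (\<alpha> (u x))\<^sup>2 * (\<eta> x)\<^sup>2) \<le>
      32 * (LINT x|lborel. (\<alpha> (u x))\<^sup>2 * (norm (E x))\<^sup>2)"
proof -
  have clS: "closed S" using S(1) by (rule compact_imp_closed)
  have E0: "E x = 0" if "x \<notin> S" for x
    by (rule has_derivative_zero_off_support[OF \<eta> clS S(2) that])
  have c\<eta>: "continuous_on UNIV \<eta>"
    by (rule C1_continuous[OF C1I(1)[OF \<eta> cE]])
  have c\<alpha>: "continuous_on {0<..} \<alpha>" "continuous_on {0<..} \<beta>"
    by (auto intro!: continuous_at_imp_continuous_on DERIV_isCont \<alpha> \<beta>)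
  note cc = cont_compose_u[OF c\<alpha>(1)] cont_compose_u[OF c\<alpha>(2)] cont_compose_u[OF c\<alpha>'] c\<eta> cE
    cont_f'_u cont_f_u cont_grad
  define g where "g = gradient u"
  have cg: "continuous_on UNIV g" unfolding g_def by (rule cont_grad)
  \<comment> \<open>Small enough to keep half of the gap after absorption: \<open>(1 - \<epsilon>) -
    (1 + \<epsilon>) * \<kappa> \<ge> (1 - \<kappa>) / 2\<close>.\<close>
  define \<epsilon> where "\<epsilon> = (1 - \<kappa>) / 4"
  have \<epsilon>: "0 < \<epsilon>" "\<epsilon> \<le> 1" using \<kappa> by (auto simp: \<epsilon>_def)

  define \<phi> where "\<phi> x = \<alpha> (u x) * \<eta> x" for x
  define P where "P x = (\<eta> x * \<alpha>' (u x)) *\<^sub>R g x" for x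
  define Q where "Q x = \<alpha> (u x) *\<^sub>R E x" for x
  have cP: "continuous_on UNIV P" "continuous_on UNIV Q"
    unfolding P_def Q_def by (intro continuous_intros cc cg)+
  have P0: "P x = 0" "Q x = 0" if "x \<notin> S" for x
    using S(2)[OF that] E0[OF that] by (auto simp: P_def Q_def)
  have \<phi>_deriv: "(\<phi> has_derivative (\<lambda>h. (P x + Q x) \<bullet> h)) (at x)" for x
  proof -
    have "(\<phi> has_derivative (\<lambda>k. \<alpha> (u x) * (E x \<bullet> k) + ((\<alpha>' (u x) *\<^sub>R gradient u x) \<bullet> k) * \<eta> x)) (at x)"
      unfolding \<phi>_def by (intro has_derivative_mult compose_u_has_derivative \<alpha> \<eta>)
    moreover have "(\<lambda>k. \<alpha> (u x) * (E x \<bullet> k) + ((\<alpha>' (u x) *\<^sub>R gradient u x) \<bullet> k) * \<eta> x) = (\<lambda>h. (P x + Q x) \<bullet> h)"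
      by (simp add: fun_eq_iff P_def Q_def g_def inner_add_left)
    ultimately show ?thesis by simp
  qed
  have cPQ: "continuous_on UNIV (\<lambda>x. P x + Q x)" by (intro continuous_intros cP)
  have sub: "closure {x. \<phi> x \<noteq> 0} \<subseteq> S"
    by (rule closure_minimal[OF _ clS]) (use S(2) in \<open>auto simp: \<phi>_def\<close>)
  have "compact (closure {x. \<phi> x \<noteq> 0})"
    using compact_Int_closed[OF S(1) closed_closure, of "{x. \<phi> x \<noteq> 0}"] sub
    by (simp add: Int_absorb1)
  hence mem: "\<phi> \<in> C1_compact_support_off K"
    using C1I(1)[OF \<phi>_deriv cPQ] sub S(3)
    by (auto simp: C1_compact_support_off_def)
  define I where "I = (LINT x|lborel. f' (u x) * (\<alpha> (u x))\<^sup>2 * (\<eta> x)\<^sup>2)"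
  define J where "J = (LINT x|lborel. (norm (P x))\<^sup>2)"
  define L where "L = (LINT x|lborel. (norm (Q x))\<^sup>2)"
  have iI: "integrable lborel (\<lambda>x. f' (u x) * (\<alpha> (u x))\<^sup>2 * (\<eta> x)\<^sup>2)"
    by (rule continuous_compact_support_integrable[OF _ S(1)]) (intro continuous_intros cc, simp add: S)
  have iJ: "integrable lborel (\<lambda>x. (norm (P x))\<^sup>2)"
    by (rule continuous_compact_support_integrable[OF _ S(1)]) (intro continuous_intros cP, simp add: P0)
  have iL: "integrable lborel (\<lambda>x. (norm (Q x))\<^sup>2)"
    by (rule continuous_compact_support_integrable[OF _ S(1)]) (intro continuous_intros cP, simp add: P0)
  have iPQ: "integrable lborel (\<lambda>x. (norm (P x + Q x))\<^sup>2)"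
    by (rule continuous_compact_support_integrable[OF _ S(1)]) (intro continuous_intros cP, simp add: P0)
  have young: "2 * (x * y) \<le> \<epsilon> * x\<^sup>2 + y\<^sup>2 / \<epsilon>" for x y :: real
  proof -
    have "0 \<le> (\<epsilon> * x - y)\<^sup>2 / \<epsilon>" using \<epsilon> by simp
    also have "\<dots> = \<epsilon> * x\<^sup>2 + y\<^sup>2 / \<epsilon> - 2 * (x * y)"
      using \<epsilon> by (simp add: power2_eq_square field_simps)
    finally show ?thesis by simp
  qed

  have "I = (LINT x|lborel. f' (u x) * (\<phi> x)\<^sup>2)"
    by (simp add: I_def \<phi>_def power_mult_distrib mult_ac)
  also have "\<dots> \<le> (LINT x|lborel. (norm (P x + Q x))\<^sup>2)"
    using K[OF mem] by (simp add: C1I(2)[OF \<phi>_deriv cPQ])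
  also have "\<dots> \<le> (LINT x|lborel. (1 + \<epsilon>) * (norm (P x))\<^sup>2 + (1 + 1 / \<epsilon>) * (norm (Q x))\<^sup>2)"
  proof (rule integral_mono[OF iPQ])
    show "integrable lborel (\<lambda>x. (1 + \<epsilon>) * (norm (P x))\<^sup>2 + (1 + 1 / \<epsilon>) * (norm (Q x))\<^sup>2)"
      using iJ iL by (intro Bochner_Integration.integrable_add integrable_mult_right)
    fix x
    have "(norm (P x + Q x))\<^sup>2 \<le> (norm (P x) + norm (Q x))\<^sup>2"
      by (intro power_mono norm_triangle_ineq norm_ge_zero)
    also have "\<dots> = (norm (P x))\<^sup>2 + (norm (Q x))\<^sup>2 + 2 * (norm (P x) * norm (Q x))"
      by (simp add: power2_eq_square algebra_simps)
    finally show "(norm (P x + Q x))\<^sup>2 \<le> (1 + \<epsilon>) * (norm (P x))\<^sup>2 + (1 + 1 / \<epsilon>) * (norm (Q x))\<^sup>2"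
      using young[of "norm (P x)" "norm (Q x)"] by (simp add: algebra_simps)
  qed
  also have "\<dots> = (1 + \<epsilon>) * J + (1 + 1 / \<epsilon>) * L"
    unfolding J_def L_def using iJ iL by (subst Bochner_Integration.integral_add) auto
  finally have 1: "I \<le> (1 + \<epsilon>) * J + (1 + 1 / \<epsilon>) * L" .

  have 2: "(1 - \<epsilon>) * J \<le> \<kappa> * I + L / \<epsilon>"
  proof -
    \<comment> \<open>The gradient of the \<open>i\<close>-th component of the field \<beta>(u)
      \<eta>^2 grad u, so that the sum of the entries \<open>H i x $ i\<close> is its
      divergence.\<close>
    define H where "H i x = (\<beta> (u x) * (\<eta> x)\<^sup>2) *\<^sub>R gradient (partial_deriv i u) x +
        (g x $ i) *\<^sub>R ((2 * \<eta> x * \<beta> (u x)) *\<^sub>R E x + ((\<eta> x)\<^sup>2 * (\<alpha>' (u x))\<^sup>2) *\<^sub>R g x)" for i x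
    define T where "T x = 2 * \<eta> x * \<beta> (u x) * (g x \<bullet> E x)" for x
    have p: "C1_fun (partial_deriv i u)" for i using u2 by (rule C2_C1)
    have H: "((\<lambda>x. \<beta> (u x) * (\<eta> x)\<^sup>2 * partial_deriv i u x) has_derivative (\<lambda>h. H i x \<bullet> h)) (at x)" for i x
    proof -
      have "((\<lambda>x. (\<eta> x)\<^sup>2) has_derivative (\<lambda>h. 2 * \<eta> x * (E x \<bullet> h))) (at x)"
        using has_derivative_power[OF \<eta>, of 2] by (simp add: mult_ac)
      hence "((\<lambda>x. \<beta> (u x) * (\<eta> x)\<^sup>2 * partial_deriv i u x) has_derivative
          (\<lambda>h. \<beta> (u x) * (\<eta> x)\<^sup>2 * (gradient (partial_deriv i u) x \<bullet> h) +
            (\<beta> (u x) * (2 * \<eta> x * (E x \<bullet> h)) + (((\<alpha>' (u x))\<^sup>2 *\<^sub>R gradient u x) \<bullet> h) * (\<eta> x)\<^sup>2) *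
              partial_deriv i u x)) (at x)"
        by (intro has_derivative_mult compose_u_has_derivative \<beta> C1_has_derivative p)
      moreover have "(\<lambda>h. \<beta> (u x) * (\<eta> x)\<^sup>2 * (gradient (partial_deriv i u) x \<bullet> h) +
            (\<beta> (u x) * (2 * \<eta> x * (E x \<bullet> h)) + (((\<alpha>' (u x))\<^sup>2 *\<^sub>R gradient u x) \<bullet> h) * (\<eta> x)\<^sup>2) *
              partial_deriv i u x) = (\<lambda>h. H i x \<bullet> h)"
        by (simp add: fun_eq_iff H_def g_def gradient_nth inner_add_left algebra_simps)
      ultimately show ?thesis by simp
    qed
    have cH: "continuous_on UNIV (H i)" for i
      unfolding H_def by (intro continuous_intros cc cg C1_continuous_gradient[OF p])
    have H0: "H i x = 0" if "x \<notin> S" for i x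
      using S(2)[OF that] by (simp add: H_def)
    have iH: "integrable lborel (\<lambda>x. H i x \<bullet> axis i 1)" for i
      by (rule continuous_compact_support_integrable[OF _ S(1)]) (intro continuous_intros cH, simp add: H0)
    obtain B where B: "\<And>x. x \<in> S \<Longrightarrow> norm x \<le> B"
      using compact_imp_bounded[OF S(1)] by (auto simp: bounded_iff)
    have iT: "integrable lborel T"
      unfolding T_def
      by (rule continuous_compact_support_integrable[OF _ S(1)]) (intro continuous_intros cc cg, simp add: S)
    have iF: "integrable lborel (\<lambda>x. \<beta> (u x) * f (u x) * (\<eta> x)\<^sup>2)"
      by (rule continuous_compact_support_integrable[OF _ S(1)]) (intro continuous_intros cc, simp add: S)
    have "0 = (\<Sum>i\<in>UNIV. LINT x|lborel. H i x \<bullet> axis i 1)"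
      by (subst integral_directional_derivative_zero[OF H cH, where B=B]) (use B S(2) in force)+
    also have "\<dots> = (LINT x|lborel. (\<Sum>i\<in>UNIV. H i x \<bullet> axis i 1))"
      using iH by (subst Bochner_Integration.integral_sum) auto
    also have "(\<lambda>x. \<Sum>i\<in>UNIV. H i x \<bullet> axis i 1) =
        (\<lambda>x. (norm (P x))\<^sup>2 + T x - \<beta> (u x) * f (u x) * (\<eta> x)\<^sup>2)"
    proof
      fix x
      have "H i x \<bullet> axis i 1 = \<beta> (u x) * (\<eta> x)\<^sup>2 * partial_deriv i (partial_deriv i u) x +
          2 * \<eta> x * \<beta> (u x) * (g x $ i * E x $ i) + (\<eta> x)\<^sup>2 * (\<alpha>' (u x))\<^sup>2 * (g x $ i * g x $ i)" for i
        by (simp add: H_def inner_axis gradient_nth algebra_simps)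
      hence "(\<Sum>i\<in>UNIV. H i x \<bullet> axis i 1) = \<beta> (u x) * (\<eta> x)\<^sup>2 * laplacian u x +
          2 * \<eta> x * \<beta> (u x) * (g x \<bullet> E x) + (\<eta> x)\<^sup>2 * (\<alpha>' (u x))\<^sup>2 * (g x \<bullet> g x)"
        by (simp add: laplacian_def inner_vec_def sum.distrib sum_distrib_left)
      moreover have "(norm (P x))\<^sup>2 = (\<eta> x)\<^sup>2 * (\<alpha>' (u x))\<^sup>2 * (g x \<bullet> g x)"
        by (simp add: P_def power_mult_distrib power2_norm_eq_inner)
      ultimately show "(\<Sum>i\<in>UNIV. H i x \<bullet> axis i 1) = (norm (P x))\<^sup>2 + T x - \<beta> (u x) * f (u x) * (\<eta> x)\<^sup>2"
        by (simp add: T_def lap)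
    qed
    also have "(LINT x|lborel. (norm (P x))\<^sup>2 + T x - \<beta> (u x) * f (u x) * (\<eta> x)\<^sup>2) =
        J + (LINT x|lborel. T x) - (LINT x|lborel. \<beta> (u x) * f (u x) * (\<eta> x)\<^sup>2)"
      unfolding J_def using iJ iT iF by simp
    finally have "J = (LINT x|lborel. \<beta> (u x) * f (u x) * (\<eta> x)\<^sup>2) - (LINT x|lborel. T x)" by simp
    also have "\<dots> \<le> \<kappa> * I + (\<epsilon> * J + L / \<epsilon>)"
    proof -
      have "(LINT x|lborel. \<beta> (u x) * f (u x) * (\<eta> x)\<^sup>2) \<le>
          (LINT x|lborel. \<kappa> * (f' (u x) * (\<alpha> (u x))\<^sup>2 * (\<eta> x)\<^sup>2))"
      proof (rule integral_mono[OF iF])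
        fix x
        have "\<beta> (u x) * f (u x) * (\<eta> x)\<^sup>2 \<le> \<kappa> * (f' (u x) * (\<alpha> (u x))\<^sup>2) * (\<eta> x)\<^sup>2"
          by (intro mult_right_mono \<beta>_f u_pos u_le) auto
        thus "\<beta> (u x) * f (u x) * (\<eta> x)\<^sup>2 \<le> \<kappa> * (f' (u x) * (\<alpha> (u x))\<^sup>2 * (\<eta> x)\<^sup>2)"
          by (simp add: mult_ac)
      qed (intro integrable_mult_right iI)
      hence "(LINT x|lborel. \<beta> (u x) * f (u x) * (\<eta> x)\<^sup>2) \<le> \<kappa> * I" by (simp add: I_def)
      moreover have "(LINT x|lborel. - T x) \<le> (LINT x|lborel. \<epsilon> * (norm (P x))\<^sup>2 + (norm (Q x))\<^sup>2 / \<epsilon>)"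
      proof (rule integral_mono)
        show "integrable lborel (\<lambda>x. - T x)" using iT by simp
        show "integrable lborel (\<lambda>x. \<epsilon> * (norm (P x))\<^sup>2 + (norm (Q x))\<^sup>2 / \<epsilon>)"
          using iJ iL by (intro Bochner_Integration.integrable_add integrable_mult_right integrable_divide)
        fix x
        note ux = u_pos[of x] u_le[of x]
        have "- T x \<le> \<bar>T x\<bar>" by simp
        also have "\<bar>T x\<bar> = 2 * (\<bar>\<eta> x\<bar> * \<beta> (u x) * \<bar>g x \<bullet> E x\<bar>)"
          using \<beta>_nonneg[OF ux(1)] by (simp add: T_def abs_mult)
        also have "\<dots> \<le> 2 * (\<bar>\<eta> x\<bar> * (\<alpha> (u x) * \<alpha>' (u x)) * (norm (g x) * norm (E x)))"
          using \<beta>_nonneg[OF ux(1)] \<alpha>_pos[OF ux(1)] \<alpha>'_nonneg[OF ux(1)]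
          by (intro mult_left_mono mult_mono \<beta>_le ux Cauchy_Schwarz_ineq2) auto
        also have "\<dots> = 2 * (norm (P x) * norm (Q x))"
          using \<alpha>_pos[OF ux(1)] \<alpha>'_nonneg[OF ux(1)] by (simp add: P_def Q_def abs_mult)
        also have "\<dots> \<le> \<epsilon> * (norm (P x))\<^sup>2 + (norm (Q x))\<^sup>2 / \<epsilon>" by (rule young)
        finally show "- T x \<le> \<epsilon> * (norm (P x))\<^sup>2 + (norm (Q x))\<^sup>2 / \<epsilon>" .
      qed
      moreover have "(LINT x|lborel. \<epsilon> * (norm (P x))\<^sup>2 + (norm (Q x))\<^sup>2 / \<epsilon>) = \<epsilon> * J + L / \<epsilon>"
        unfolding J_def L_def using iJ iL by (subst Bochner_Integration.integral_add) auto
      ultimately show ?thesis by simp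
    qed
    finally show ?thesis by (simp add: algebra_simps)
  qed
  have L0: "0 \<le> L" "0 \<le> I"
    unfolding L_def I_def using deriv_pos u_pos by (auto intro!: integral_nonneg simp: less_imp_le)
  have "(1 - \<epsilon>) * I \<le> (1 - \<epsilon>) * ((1 + \<epsilon>) * J + (1 + 1 / \<epsilon>) * L)"
    using 1 \<epsilon> by (intro mult_left_mono) auto
  also have "\<dots> = (1 + \<epsilon>) * ((1 - \<epsilon>) * J) + (1 - \<epsilon>) * (1 + 1 / \<epsilon>) * L" by (simp add: algebra_simps)
  also have "\<dots> \<le> (1 + \<epsilon>) * (\<kappa> * I + L / \<epsilon>) + (1 - \<epsilon>) * (1 + 1 / \<epsilon>) * L"
    using 2 \<epsilon> by (intro add_right_mono mult_left_mono) auto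
  also have "\<dots> = (1 + \<epsilon>) * \<kappa> * I + ((1 + \<epsilon>) / \<epsilon> + (1 - \<epsilon>) * (1 + 1 / \<epsilon>)) * L" by (simp add: algebra_simps)
  finally have "((1 - \<epsilon>) - (1 + \<epsilon>) * \<kappa>) * I \<le> ((1 + \<epsilon>) / \<epsilon> + (1 - \<epsilon>) * (1 + 1 / \<epsilon>)) * L"
    by (simp add: algebra_simps)
  moreover have "(1 - \<kappa>) / 2 * I \<le> ((1 - \<epsilon>) - (1 + \<epsilon>) * \<kappa>) * I"
  proof (rule mult_right_mono[OF _ L0(2)])
    have "\<epsilon> * \<kappa> \<le> \<epsilon> * 1" using \<kappa> \<epsilon> by (intro mult_left_mono) auto
    moreover have "1 - \<kappa> = 4 * \<epsilon>" by (simp add: \<epsilon>_def)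
    ultimately show "(1 - \<kappa>) / 2 \<le> (1 - \<epsilon>) - (1 + \<epsilon>) * \<kappa>"
      by (simp add: distrib_right)
  qed
  moreover have "((1 + \<epsilon>) / \<epsilon> + (1 - \<epsilon>) * (1 + 1 / \<epsilon>)) * L \<le> 4 / \<epsilon> * L"
  proof (rule mult_right_mono[OF _ L0(1)])
    have "(1 + \<epsilon>) / \<epsilon> \<le> 2 / \<epsilon>" using \<epsilon> by (intro divide_right_mono) auto
    moreover have "(1 - \<epsilon>) * (1 + 1 / \<epsilon>) \<le> 1 * (2 / \<epsilon>)"
      using \<epsilon> by (intro mult_mono) (auto simp: field_simps)
    ultimately show "(1 + \<epsilon>) / \<epsilon> + (1 - \<epsilon>) * (1 + 1 / \<epsilon>) \<le> 4 / \<epsilon>" by simp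
  qed
  ultimately have "(1 - \<kappa>) / 2 * I \<le> 16 / (1 - \<kappa>) * L" by (simp add: \<epsilon>_def)
  hence "(1 - \<kappa>)\<^sup>2 * I \<le> 32 * L" using \<kappa> by (simp add: field_simps power2_eq_square)
  moreover have "L = (LINT x|lborel. (\<alpha> (u x))\<^sup>2 * (norm (E x))\<^sup>2)"
    by (simp add: L_def Q_def power_mult_distrib)
  ultimately show ?thesis by (simp add: I_def)
qed

end

section \<open>Interpolation inequalities between powers of \<open>f\<close> and
  \<open>f'\<close>\<close>

context convex_nonlinearity
begin

text \<open>A Young inequality with \<open>f'\<close> in the role of the higher power. Where
  \<open>f' s\<close> is at least \<open>f' t / (\<epsilon> * \<xi>\<^sup>2)\<close>, the first term
  on the right wins. Otherwise, for \<open>s > t\<close>, the lower growth estimate bounds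
  \<open>f s powr p\<close> by a multiple of \<open>f t powr p\<close> times \<xi> to the power
  -2p/\<sigma>, and the size of \<open>k\<close> leaves one spare factor \<xi>.\<close>

lemma young_absorb:
  assumes low: "0 < c"
    "\<And>s t. 0 < s \<Longrightarrow> s \<le> t \<Longrightarrow> t \<le> M \<Longrightarrow> c * (f' s * f t powr \<sigma>) \<le> f' t * f s powr \<sigma>"
    and \<epsilon>: "0 < \<epsilon>" and p: "0 < p" and \<sigma>: "0 < \<sigma>" and k: "2 * p / \<sigma> + 1 \<le> real (2 * k)"
  obtains C where "0 < C" "\<And>s t \<xi>. 0 < s \<Longrightarrow> s \<le> M \<Longrightarrow> 0 < t \<Longrightarrow> t \<le> M \<Longrightarrow> 0 \<le> \<xi> \<Longrightarrow> \<xi> \<le> 1 \<Longrightarrow>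
    f s powr p * \<xi> ^ (2 * k) \<le> \<epsilon> * (f' s / f' t) * f s powr p * \<xi> ^ (2 * k + 2) + C * f t powr p * \<xi>"
proof
  define C where "C = 1 + (c * \<epsilon>) powr (- (p / \<sigma>))"
  show "0 < C" by (simp add: C_def add_pos_nonneg)
  fix s t \<xi> :: real
  assume st: "0 < s" "s \<le> M" "0 < t" "t \<le> M" and \<xi>: "0 \<le> \<xi>" "\<xi> \<le> 1"
  have "0 < 2 * p / \<sigma>" using p \<sigma> by simp
  hence k1: "1 \<le> 2 * k" using k by linarith
  have fs: "0 < f s" "0 < f t" "0 < f' s" "0 < f' t" using pos deriv_pos st by auto
  have n1: "0 \<le> \<epsilon> * (f' s / f' t) * f s powr p * \<xi> ^ (2 * k + 2)" using fs \<epsilon> \<xi> by simp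
  have n2: "0 \<le> C * f t powr p * \<xi>" using \<open>0 < C\<close> \<xi> by simp
  have \<xi>k: "\<xi> ^ (2 * k) \<le> \<xi>" using power_decreasing[OF k1 \<xi>] by simp
  show "f s powr p * \<xi> ^ (2 * k) \<le> \<epsilon> * (f' s / f' t) * f s powr p * \<xi> ^ (2 * k + 2) + C * f t powr p * \<xi>"
  proof (cases "f' t \<le> \<epsilon> * f' s * \<xi>\<^sup>2")
    case True
    have "f s powr p * \<xi> ^ (2 * k) * 1 \<le> f s powr p * \<xi> ^ (2 * k) * (\<epsilon> * f' s * \<xi>\<^sup>2 / f' t)"
      using True fs \<xi> by (intro mult_left_mono) auto
    also have "\<dots> = \<epsilon> * (f' s / f' t) * f s powr p * \<xi> ^ (2 * k + 2)"
      by (simp add: power_add power2_eq_square)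
    finally show ?thesis using n2 by simp
  next
    case False
    hence \<xi>': "\<epsilon> * f' s * \<xi>\<^sup>2 < f' t" by simp
    have "f s powr p * \<xi> ^ (2 * k) \<le> C * f t powr p * \<xi>"
    proof (cases "s \<le> t")
      case True
      have "f s powr p * \<xi> ^ (2 * k) \<le> f t powr p * \<xi>"
        using mono[of s t] True st fs p \<xi>k \<xi> by (intro mult_mono powr_mono2) auto
      also have "\<dots> \<le> C * (f t powr p * \<xi>)" using \<xi> mult_right_mono[of 1 C "f t powr p * \<xi>"] by (simp add: C_def)
      finally show ?thesis by simp
    next
      case False
      show ?thesis
      proof (cases "\<xi> = 0")
        case True
        thus ?thesis using k1 by (simp add: power_0_left)
      next
        case False
        hence \<xi>0: "0 < \<xi>" using \<xi> by simp
        have "\<epsilon> * \<xi>\<^sup>2 * (c * (f' t * f s powr \<sigma>)) \<le> \<epsilon> * \<xi>\<^sup>2 * (f' s * f t powr \<sigma>)"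
          using low(2)[of t s] \<open>\<not> s \<le> t\<close> st \<epsilon> by (intro mult_left_mono) auto
        also have "\<dots> = (\<epsilon> * f' s * \<xi>\<^sup>2) * f t powr \<sigma>" by simp
        also have "\<dots> \<le> f' t * f t powr \<sigma>" using \<xi>' by (intro mult_right_mono) auto
        finally have "f' t * (c * \<epsilon> * \<xi>\<^sup>2 * f s powr \<sigma>) \<le> f' t * f t powr \<sigma>" by (simp add: mult_ac)
        hence "c * \<epsilon> * \<xi>\<^sup>2 * f s powr \<sigma> \<le> f t powr \<sigma>" using fs by simp
        hence "(c * \<epsilon> * \<xi>\<^sup>2 * f s powr \<sigma>) powr (p / \<sigma>) \<le> (f t powr \<sigma>) powr (p / \<sigma>)"
          using p \<sigma> low(1) \<epsilon> by (intro powr_mono2) auto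
        hence "(c * \<epsilon>) powr (p / \<sigma>) * \<xi> powr (2 * p / \<sigma>) * f s powr p \<le> f t powr p"
          using \<sigma> low(1) \<epsilon> \<xi>0 by (simp add: powr_mult powr_powr flip: powr_numeral)
        hence A: "\<xi> powr (2 * p / \<sigma>) * f s powr p \<le> (c * \<epsilon>) powr (- (p / \<sigma>)) * f t powr p"
          using low(1) \<epsilon> by (simp add: powr_minus field_simps)
        have "\<xi> ^ (2 * k) = \<xi> powr (2 * p / \<sigma> + (real (2 * k) - 2 * p / \<sigma>))"
          using \<xi>0 by (simp add: powr_realpow[symmetric])
        also have "\<dots> = \<xi> powr (2 * p / \<sigma>) * \<xi> powr (real (2 * k) - 2 * p / \<sigma>)" by (rule powr_add)
        also have "\<dots> \<le> \<xi> powr (2 * p / \<sigma>) * \<xi> powr 1"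
          using k \<xi>0 \<xi> by (intro mult_left_mono powr_mono') auto
        finally have "f s powr p * \<xi> ^ (2 * k) \<le> f s powr p * (\<xi> powr (2 * p / \<sigma>) * \<xi>)"
          using \<xi>0 by (intro mult_left_mono) auto
        also have "\<dots> = (\<xi> powr (2 * p / \<sigma>) * f s powr p) * \<xi>" by simp
        also have "\<dots> \<le> ((c * \<epsilon>) powr (- (p / \<sigma>)) * f t powr p) * \<xi>"
          using A \<xi> by (intro mult_right_mono) auto
        also have "\<dots> \<le> C * f t powr p * \<xi>"
          using \<xi> by (intro mult_right_mono) (auto simp: C_def)
        finally show ?thesis .
      qed
    qed
    thus ?thesis using n1 by simp
  qed
qed

text \<open>Bounds \<open>f s\<close> by the energy density \<open>f' s * f s powr p\<close>, up to
  a small multiple of \<open>f s0\<close> that can be absorbed. If \<open>f s / f s0\<close> exceeds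
  \<delta>, then \<open>f' s / f' s0\<close> is bounded below: by monotonicity for
  \<open>s \<ge> s0\<close>, by the upper growth estimate for \<open>s < s0\<close>.\<close>

lemma split_by_potential:
  assumes up: "0 < U"
    "\<And>s t. 0 < s \<Longrightarrow> s \<le> t \<Longrightarrow> t \<le> M \<Longrightarrow> f' t * f s powr \<sigma> \<le> U * (f' s * f t powr \<sigma>)"
    and \<delta>: "0 < \<delta>" and p: "1 \<le> p" and \<sigma>: "0 \<le> \<sigma>"
  obtains C where "0 < C" "\<And>s s0. 0 < s \<Longrightarrow> s \<le> M \<Longrightarrow> 0 < s0 \<Longrightarrow> s0 \<le> M \<Longrightarrow>
    f s \<le> \<delta> * f s0 + C * ((f' s / f' s0) * f s powr p * f s0 powr (1 - p))"
proof
  define C where "C = 1 + U * \<delta> powr (-\<sigma>) * \<delta> powr (1 - p)"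
  show C: "0 < C" using up by (simp add: C_def add_pos_nonneg)
  fix s s0 assume st: "0 < s" "s \<le> M" "0 < s0" "s0 \<le> M"
  have fs: "0 < f s" "0 < f s0" "0 < f' s" "0 < f' s0" using pos deriv_pos st by auto
  define v where "v = f s / f s0"
  have v: "0 < v" using fs by (simp add: v_def)
  have eq: "f s powr p * f s0 powr (1 - p) = f s * v powr (p - 1)"
    using fs by (simp add: v_def powr_diff powr_divide)
  have nn: "0 \<le> C * ((f' s / f' s0) * f s powr p * f s0 powr (1 - p))" using C fs by simp
  show "f s \<le> \<delta> * f s0 + C * ((f' s / f' s0) * f s powr p * f s0 powr (1 - p))"
  proof (cases "v \<le> \<delta>")
    case True
    hence "f s \<le> \<delta> * f s0" using fs by (simp add: v_def field_simps)
    thus ?thesis using nn by linarith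
  next
    case False
    have "1 \<le> C * ((f' s / f' s0) * v powr (p - 1))"
    proof (cases "s0 \<le> s")
      case True
      have "1 \<le> f' s / f' s0" using deriv_mono[OF st(3) True] fs by simp
      moreover have "1 \<le> v" using mono[of s0 s] True st fs by (simp add: v_def)
      hence "1 \<le> v powr (p - 1)" using p by (intro ge_one_powr_ge_zero) auto
      moreover have "1 \<le> C" using up by (simp add: C_def)
      ultimately have "1 * (1 * 1) \<le> C * ((f' s / f' s0) * v powr (p - 1))"
        using C fs by (intro mult_mono) auto
      thus ?thesis by simp
    next
      case False
      have "f' s0 * f s powr \<sigma> \<le> U * (f' s * f s0 powr \<sigma>)" using up(2)[of s s0] False st by auto
      hence "v powr \<sigma> \<le> U * (f' s / f' s0)" using fs by (simp add: v_def powr_divide field_simps)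
      moreover have "\<delta> powr \<sigma> \<le> v powr \<sigma>" using \<open>\<not> v \<le> \<delta>\<close> \<delta> \<sigma> by (intro powr_mono2) auto
      ultimately have a: "\<delta> powr \<sigma> \<le> U * (f' s / f' s0)" by linarith
      have b: "\<delta> powr (p - 1) \<le> v powr (p - 1)" using \<open>\<not> v \<le> \<delta>\<close> \<delta> p by (intro powr_mono2) auto
      have "1 = \<delta> powr (-\<sigma>) * \<delta> powr (1 - p) * (\<delta> powr \<sigma> * \<delta> powr (p - 1))"
        using \<delta> by (simp flip: powr_add)
      also have "\<dots> \<le> \<delta> powr (-\<sigma>) * \<delta> powr (1 - p) * (U * (f' s / f' s0) * v powr (p - 1))"
        using a b up(1) fs by (intro mult_left_mono mult_mono) auto
      also have "\<dots> = (U * \<delta> powr (-\<sigma>) * \<delta> powr (1 - p)) * ((f' s / f' s0) * v powr (p - 1))" by simp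
      also have "\<dots> \<le> C * ((f' s / f' s0) * v powr (p - 1))"
        using fs by (intro mult_right_mono) (auto simp: C_def)
      finally show ?thesis .
    qed
    hence "f s * 1 \<le> f s * (C * ((f' s / f' s0) * v powr (p - 1)))" using fs by (intro mult_left_mono) auto
    also have "\<dots> = C * ((f' s / f' s0) * (f s powr p * f s0 powr (1 - p)))" unfolding eq by simp
    finally have "f s \<le> C * ((f' s / f' s0) * f s powr p * f s0 powr (1 - p))" by (simp add: mult.assoc)
    moreover have "0 < \<delta> * f s0" using \<delta> fs by simp
    ultimately show ?thesis by linarith
  qed
qed

end

lemma bump_power: "(bump m z) ^ k = bump (m * k) z"
  by (simp add: bump_def power_mult)

lemma integral_bump_pos: "0 < (LINT z|lborel. bump 1 (z::'a::euclidean_space))"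
proof -
  have c: "continuous_on UNIV (\<lambda>z::'a. bump 1 z)" by (intro continuous_intros)
  have i: "integrable lborel (\<lambda>z::'a. bump 1 z)"
    by (rule integral_cbox_eq_lborel(2)[OF c]) (simp add: bump_eq_0)
  have "(LINT z|lborel. (3 / 4) * indicator (cball (0::'a) (1/2)) z) \<le> (LINT z|lborel. bump 1 (z::'a))"
  proof (rule integral_mono[OF _ i])
    show "integrable lborel (\<lambda>z. (3 / 4) * indicat_real (cball (0::'a) (1/2)) z)"
      by (intro integrable_mult_right integrable_real_indicator) (auto simp: emeasure_lborel_cball_finite[unfolded infinity_ennreal_def])
    fix z :: 'a
    show "3 / 4 * indicat_real (cball 0 (1/2)) z \<le> bump 1 z"
    proof (cases "norm z \<le> 1/2")
      case True
      hence "(norm z)\<^sup>2 \<le> (1/2)\<^sup>2" by (intro power_mono) auto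
      hence "z \<bullet> z \<le> 1 / 4" by (simp add: power2_norm_eq_inner power_divide)
        thus ?thesis using True by (simp add: bump_def)
    qed (simp add: bump_nonneg)
  qed
  moreover have "0 < (LINT z|lborel. (3 / 4) * indicat_real (cball (0::'a) (1/2)) z)"
    using content_cball_pos[of "1/2" "0::'a"] by simp
  ultimately show ?thesis by linarith
qed

section \<open>Scale invariant energy estimate on balls\<close>

context bounded_solution
begin

lemma cont_powr_f_u: "continuous_on S (\<lambda>x. f (u x) powr p)"
  by (intro continuous_on_powr cont_f_u continuous_on_const) (metis u_pos pos less_irrefl)

text \<open>On a ball of radius \<open>R\<close>, \<open>stable_energy\<close> leaves f(u)^(2a) /
  R^2 on the right, without the factor f'(u). At the level \<open>t\<close> with
  \<open>f' t = 1 / R\<^sup>2\<close> the two sides balance, and \<open>young_absorb\<close> trades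
  the right side for half of the left one plus a multiple of \<open>f t powr (2 * a)\<close>. In the
  rescaled variable the volume of the ball drops out.\<close>

lemma energy_bound:
  assumes K: "\<And>\<phi>. \<phi> \<in> C1_compact_support_off K \<Longrightarrow>
        (LINT x|lborel. f' (u x) * (\<phi> x)\<^sup>2) \<le> (LINT x|lborel. (norm (gradient \<phi> x))\<^sup>2)"
    and a: "1 < a" and sig: "(a - 1)\<^sup>2 < \<sigma>"
    and ev: "\<forall>\<^sub>F t in at_right 0. \<sigma> * (f' t)\<^sup>2 \<le> f t * f'' t"
  obtains C n where "0 < C" "1 \<le> n" "\<And>x R t. 0 < R \<Longrightarrow> cball x R \<inter> K = {} \<Longrightarrow> 0 < t \<Longrightarrow> t \<le> M \<Longrightarrow> f' t = 1 / R\<^sup>2 \<Longrightarrow>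
    (LINT z|lborel. f' (u (x + R *\<^sub>R z)) * f (u (x + R *\<^sub>R z)) powr (2 * a) * bump n z)
      \<le> C / R\<^sup>2 * f t powr (2 * a)"
proof (rule exists_multipliers[OF a sig M_pos ev])
  fix \<kappa> c1 c2 :: real and \<alpha> \<alpha>' \<beta>
  assume m: "0 < \<kappa>" "\<kappa> < 1" "0 < c1" "0 < c2"
    "\<And>t. 0 < t \<Longrightarrow> 0 < \<alpha> t" "\<And>t. 0 < t \<Longrightarrow> 0 \<le> \<alpha>' t"
    "\<And>t. 0 < t \<Longrightarrow> (\<alpha> has_real_derivative \<alpha>' t) (at t)" "continuous_on {0<..} \<alpha>'"
    "\<And>t. 0 < t \<Longrightarrow> (\<beta> has_real_derivative (\<alpha>' t)\<^sup>2) (at t)"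
    "\<And>t. 0 < t \<Longrightarrow> 0 \<le> \<beta> t"
    "\<And>t. 0 < t \<Longrightarrow> t \<le> M \<Longrightarrow> \<beta> t \<le> \<alpha> t * \<alpha>' t"
    "\<And>t. 0 < t \<Longrightarrow> t \<le> M \<Longrightarrow> \<beta> t * f t \<le> \<kappa> * (f' t * (\<alpha> t)\<^sup>2)"
    "\<And>t. 0 < t \<Longrightarrow> t \<le> M \<Longrightarrow> c1 * f t powr (2 * a) \<le> (\<alpha> t)\<^sup>2"
    "\<And>t. 0 < t \<Longrightarrow> t \<le> M \<Longrightarrow> (\<alpha> t)\<^sup>2 \<le> c2 * f t powr (2 * a)"
  have \<sigma>: "0 < \<sigma>" using sig zero_le_power2[of "a - 1"] by linarith
  obtain c where c: "0 < c"
    "\<And>s t. 0 < s \<Longrightarrow> s \<le> t \<Longrightarrow> t \<le> M \<Longrightarrow> c * (f' s * f t powr \<sigma>) \<le> f' t * f s powr \<sigma>"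
    by (rule deriv_growth_lower[OF ev M_pos less_imp_le[OF \<sigma>]]) (rule that)
  \<comment> \<open>\<open>2 * k\<close> has to reach the exponent that \<open>young_absorb\<close>
    demands for the power \<open>2 * a\<close>; the successor ensures \<open>k \<ge> 1\<close>,
    which makes the cutoff \<open>bump (Suc k)\<close> of class C^1.\<close>
  obtain k0 :: nat where k0: "2 * (2 * a) / \<sigma> + 1 \<le> real k0" using real_arch_simple by blast
  define k where "k = Suc k0"
  have k: "2 * (2 * a) / \<sigma> + 1 \<le> real (2 * k)" "1 \<le> k" using k0 by (auto simp: k_def)
  define C3 where "C3 = 32 * (4 * (real (Suc k))\<^sup>2) * c2 / ((1 - \<kappa>)\<^sup>2 * c1)"
  have C3: "0 < C3" using m by (simp add: C3_def)
  \<comment> \<open>Then \<open>C3 / R\<^sup>2 * (\<epsilon> * R\<^sup>2) = 1 / 2\<close>, so half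
    of the energy is absorbed.\<close>
  define \<epsilon> where "\<epsilon> = 1 / (2 * C3)"
  have \<epsilon>: "0 < \<epsilon>" using C3 by (simp add: \<epsilon>_def)
  have a2: "0 < 2 * a" using a by simp
  obtain Y where Y: "0 < Y" "\<And>s t \<xi>. 0 < s \<Longrightarrow> s \<le> M \<Longrightarrow> 0 < t \<Longrightarrow> t \<le> M \<Longrightarrow> 0 \<le> \<xi> \<Longrightarrow> \<xi> \<le> 1 \<Longrightarrow>
    f s powr (2 * a) * \<xi> ^ (2 * k) \<le> \<epsilon> * (f' s / f' t) * f s powr (2 * a) * \<xi> ^ (2 * k + 2) + Y * f t powr (2 * a) * \<xi>"
    by (rule young_absorb[where M=M and c=c and \<epsilon>=\<epsilon> and p="2 * a" and \<sigma>=\<sigma> and k=k])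
       (assumption | rule c \<epsilon> a2 \<sigma> k(1) that)+
  define mass where "mass = (LINT z|lborel. bump 1 (z::real^'n))"
  have mass: "0 < mass" unfolding mass_def by (rule integral_bump_pos)
  show thesis
  proof (rule that[of "2 * C3 * Y * mass" "2 * k + 2"])
    show "0 < 2 * C3 * Y * mass" "1 \<le> 2 * k + 2" using C3 Y mass by auto
    fix x :: "real^'n" and R t :: real
    assume R: "0 < R" "cball x R \<inter> K = {}" and t: "0 < t" "t \<le> M" "f' t = 1 / R\<^sup>2"
    define U where "U z = u (x + R *\<^sub>R z)" for z
    have U: "0 < U z" "U z \<le> M" for z by (auto simp: U_def u_pos u_le)
    have cs: "continuous_on UNIV (\<lambda>z. x + R *\<^sub>R z)" by (intro continuous_intros)
    have cU: "continuous_on UNIV (\<lambda>z. h (U z))" if "continuous_on UNIV (\<lambda>x. h (u x))" for h :: "real \<Rightarrow> real"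
      unfolding U_def by (rule continuous_on_compose2[OF that cs]) auto
    have c\<alpha>: "continuous_on {0<..} \<alpha>"
      by (auto intro!: continuous_at_imp_continuous_on DERIV_isCont m(7))
    note cc = cU[OF cont_f'_u] cU[OF cont_powr_f_u] cU[OF cont_compose_u[OF c\<alpha>]]
    define \<eta> where "\<eta> y = bump (Suc k) ((1 / R) *\<^sub>R (y - x))" for y
    define E where "E y = (- 2 * real (Suc k) * bump k ((1 / R) *\<^sub>R (y - x)) / R) *\<^sub>R ((1 / R) *\<^sub>R (y - x))" for y
    have \<eta>: "(\<eta> has_derivative (\<lambda>h. E y \<bullet> h)) (at y)" for y
    proof -
      have d: "((\<lambda>y. (1 / R) *\<^sub>R (y - x)) has_derivative (\<lambda>h. (1 / R) *\<^sub>R h)) (at y)"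
        by (auto intro!: derivative_eq_intros)
      have "(\<eta> has_derivative (\<lambda>h. ((- 2 * real (Suc k) * bump k ((1 / R) *\<^sub>R (y - x))) *\<^sub>R
          ((1 / R) *\<^sub>R (y - x))) \<bullet> ((1 / R) *\<^sub>R h))) (at y)"
        unfolding \<eta>_def by (rule has_derivative_compose[OF d bump_has_derivative[OF k(2)]])
      thus ?thesis by (simp add: E_def)
    qed
    have cE: "continuous_on UNIV E" unfolding E_def by (intro continuous_intros) (use R in auto)
    have c\<eta>: "continuous_on UNIV \<eta>" by (rule C1_continuous[OF C1I(1)[OF \<eta> cE]])
    have zero: "\<eta> y = 0" if "y \<notin> cball x R" for y
      unfolding \<eta>_def using that R by (intro bump_eq_0) (auto simp: dist_norm norm_minus_commute divide_simps)
    have "(1 - \<kappa>)\<^sup>2 * (LINT x|lborel. f' (u x) * (\<alpha> (u x))\<^sup>2 * (\<eta> x)\<^sup>2) \<le>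
      32 * (LINT x|lborel. (\<alpha> (u x))\<^sup>2 * (norm (E x))\<^sup>2)"
      by (rule stable_energy[where K=K and \<kappa>=\<kappa> and \<alpha>=\<alpha> and \<alpha>'=\<alpha>' and \<beta>=\<beta> and \<eta>=\<eta> and E=E and S="cball x R"])
         (assumption | rule K m(1,2,5-12) \<eta> cE compact_cball zero R(2))+
    also have "(LINT x|lborel. f' (u x) * (\<alpha> (u x))\<^sup>2 * (\<eta> x)\<^sup>2) =
        R ^ DIM(real^'n) * (LINT z|lborel. f' (U z) * (\<alpha> (U z))\<^sup>2 * bump (2 * k + 2) z)"
    proof (subst integral_lborel_scale[OF _ R(1), where c=x])
      show "(\<lambda>x. f' (u x) * (\<alpha> (u x))\<^sup>2 * (\<eta> x)\<^sup>2) \<in> borel_measurable borel"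
        by (intro borel_measurable_continuous_onI continuous_intros cont_f'_u cont_compose_u c\<alpha> c\<eta>)
      have "(\<eta> (x + R *\<^sub>R z))\<^sup>2 = bump (2 * k + 2) z" for z
        using R by (simp add: \<eta>_def bump_power mult.commute)
      thus "R ^ DIM(real^'n) * (LINT z|lborel. f' (u (x + R *\<^sub>R z)) * (\<alpha> (u (x + R *\<^sub>R z)))\<^sup>2 * (\<eta> (x + R *\<^sub>R z))\<^sup>2) =
        R ^ DIM(real^'n) * (LINT z|lborel. f' (U z) * (\<alpha> (U z))\<^sup>2 * bump (2 * k + 2) z)"
        by (simp add: U_def)
    qed
    also have "(LINT x|lborel. (\<alpha> (u x))\<^sup>2 * (norm (E x))\<^sup>2) =
        R ^ DIM(real^'n) * (LINT z|lborel. (\<alpha> (U z))\<^sup>2 * (4 * (real (Suc k))\<^sup>2 / R\<^sup>2 * (norm z)\<^sup>2 * bump (2 * k) z))"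
    proof (subst integral_lborel_scale[OF _ R(1), where c=x])
      show "(\<lambda>x. (\<alpha> (u x))\<^sup>2 * (norm (E x))\<^sup>2) \<in> borel_measurable borel"
        by (intro borel_measurable_continuous_onI continuous_intros cont_compose_u c\<alpha> cE)
      have "(norm (E (x + R *\<^sub>R z)))\<^sup>2 = 4 * (real (Suc k))\<^sup>2 / R\<^sup>2 * (norm z)\<^sup>2 * bump (2 * k) z" for z
      proof -
        have "E (x + R *\<^sub>R z) = (- 2 * real (Suc k) * bump k z / R) *\<^sub>R z" using R by (simp add: E_def)
        hence "(norm (E (x + R *\<^sub>R z)))\<^sup>2 = (- 2 * real (Suc k) * bump k z / R)\<^sup>2 * (norm z)\<^sup>2"
          by (simp only: norm_scaleR power_mult_distrib power2_abs)
        also have "\<dots> = 4 * (real (Suc k))\<^sup>2 / R\<^sup>2 * (norm z)\<^sup>2 * (bump k z)\<^sup>2"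
          by (simp add: power2_eq_square del: of_nat_Suc)
        finally show ?thesis by (simp add: bump_power mult.commute)
      qed
      thus "R ^ DIM(real^'n) * (LINT z|lborel. (\<alpha> (u (x + R *\<^sub>R z)))\<^sup>2 * (norm (E (x + R *\<^sub>R z)))\<^sup>2) =
        R ^ DIM(real^'n) * (LINT z|lborel. (\<alpha> (U z))\<^sup>2 * (4 * (real (Suc k))\<^sup>2 / R\<^sup>2 * (norm z)\<^sup>2 * bump (2 * k) z))"
        by (simp add: U_def)
    qed
    finally have "R ^ DIM(real^'n) * ((1 - \<kappa>)\<^sup>2 * (LINT z|lborel. f' (U z) * (\<alpha> (U z))\<^sup>2 * bump (2 * k + 2) z)) \<le>
      R ^ DIM(real^'n) * (32 * (LINT z|lborel. (\<alpha> (U z))\<^sup>2 * (4 * (real (Suc k))\<^sup>2 / R\<^sup>2 * (norm z)\<^sup>2 * bump (2 * k) z)))"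
      by (simp only: mult_ac)
    hence en: "(1 - \<kappa>)\<^sup>2 * (LINT z|lborel. f' (U z) * (\<alpha> (U z))\<^sup>2 * bump (2 * k + 2) z) \<le>
      32 * (LINT z|lborel. (\<alpha> (U z))\<^sup>2 * (4 * (real (Suc k))\<^sup>2 / R\<^sup>2 * (norm z)\<^sup>2 * bump (2 * k) z))"
      using R by (subst (asm) mult_le_cancel_left_pos) auto
    define F where "F z = f' (U z) * f (U z) powr (2 * a) * bump (2 * k + 2) z" for z
    define G where "G z = f (U z) powr (2 * a) * bump (2 * k) z" for z
    have iF: "integrable lborel F" unfolding F_def
      by (rule integral_cbox_eq_lborel(2)) (intro continuous_intros cc, simp add: bump_eq_0)
    have iG: "integrable lborel G" unfolding G_def
      by (rule integral_cbox_eq_lborel(2)) (intro continuous_intros cc, use k in \<open>simp add: bump_eq_0\<close>)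
    have "(1 - \<kappa>)\<^sup>2 * (c1 * (LINT z|lborel. F z)) = (1 - \<kappa>)\<^sup>2 * (LINT z|lborel. c1 * F z)" by simp
    also have "\<dots> \<le> (1 - \<kappa>)\<^sup>2 * (LINT z|lborel. f' (U z) * (\<alpha> (U z))\<^sup>2 * bump (2 * k + 2) z)"
    proof (intro mult_left_mono integral_mono)
      show "integrable lborel (\<lambda>z. c1 * F z)" by (intro integrable_mult_right iF)
      show "integrable lborel (\<lambda>z. f' (U z) * (\<alpha> (U z))\<^sup>2 * bump (2 * k + 2) z)"
        by (rule integral_cbox_eq_lborel(2)) (intro continuous_intros cc, simp add: bump_eq_0)
      fix z
      have "f' (U z) * bump (2 * k + 2) z * (c1 * f (U z) powr (2 * a)) \<le> f' (U z) * bump (2 * k + 2) z * (\<alpha> (U z))\<^sup>2"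
        using deriv_pos[OF U(1)[of z]] by (intro mult_left_mono m(13) U) (auto simp: bump_nonneg)
      thus "c1 * F z \<le> f' (U z) * (\<alpha> (U z))\<^sup>2 * bump (2 * k + 2) z" by (simp add: F_def mult_ac)
    qed simp
    also note en
    also have "(LINT z|lborel. (\<alpha> (U z))\<^sup>2 * (4 * (real (Suc k))\<^sup>2 / R\<^sup>2 * (norm z)\<^sup>2 * bump (2 * k) z)) \<le>
        (LINT z|lborel. (4 * (real (Suc k))\<^sup>2 / R\<^sup>2 * c2) * G z)"
    proof (rule integral_mono)
      show "integrable lborel (\<lambda>z. (\<alpha> (U z))\<^sup>2 * (4 * (real (Suc k))\<^sup>2 / R\<^sup>2 * (norm z)\<^sup>2 * bump (2 * k) z))"
        by (rule integral_cbox_eq_lborel(2)) (intro continuous_intros cc, use k in \<open>simp add: bump_eq_0\<close>)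
      show "integrable lborel (\<lambda>z. (4 * (real (Suc k))\<^sup>2 / R\<^sup>2 * c2) * G z)" by (intro integrable_mult_right iG)
      fix z :: "real^'n"
      have "(norm z)\<^sup>2 * bump (2 * k) z \<le> 1 * bump (2 * k) z"
      proof (cases "norm z \<le> 1")
        case True
        thus ?thesis by (intro mult_right_mono power_le_one bump_nonneg) auto
      qed (use k in \<open>simp add: bump_eq_0\<close>)
      hence *: "4 * (real (Suc k))\<^sup>2 / R\<^sup>2 * ((norm z)\<^sup>2 * bump (2 * k) z) \<le> 4 * (real (Suc k))\<^sup>2 / R\<^sup>2 * (1 * bump (2 * k) z)"
        by (rule mult_left_mono) simp
      have "(\<alpha> (U z))\<^sup>2 * (4 * (real (Suc k))\<^sup>2 / R\<^sup>2 * ((norm z)\<^sup>2 * bump (2 * k) z)) \<le>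
         (c2 * f (U z) powr (2 * a)) * (4 * (real (Suc k))\<^sup>2 / R\<^sup>2 * (1 * bump (2 * k) z))"
        by (rule mult_mono[OF m(14)[OF U] *]) (use m(4) in \<open>auto simp: bump_nonneg\<close>)
      thus "(\<alpha> (U z))\<^sup>2 * (4 * (real (Suc k))\<^sup>2 / R\<^sup>2 * (norm z)\<^sup>2 * bump (2 * k) z) \<le> (4 * (real (Suc k))\<^sup>2 / R\<^sup>2 * c2) * G z"
        by (simp add: G_def mult_ac)
    qed
    finally have *: "(1 - \<kappa>)\<^sup>2 * (c1 * (LINT z|lborel. F z)) \<le> 32 * ((4 * (real (Suc k))\<^sup>2 / R\<^sup>2 * c2) * (LINT z|lborel. G z))"
      by simp
    hence FG: "(LINT z|lborel. F z) \<le> C3 / R\<^sup>2 * (LINT z|lborel. G z)"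
    proof -
      define P where "P = (1 - \<kappa>)\<^sup>2 * c1"
      have P: "0 < P" using m(2,3) by (simp add: P_def)
      have "P * C3 = 32 * (4 * (real (Suc k))\<^sup>2) * c2"
        using P unfolding C3_def P_def[symmetric] by simp
      hence "P * (C3 / R\<^sup>2 * (LINT z|lborel. G z)) =
          32 * (4 * (real (Suc k))\<^sup>2) * c2 / R\<^sup>2 * (LINT z|lborel. G z)"
        by (metis mult.assoc times_divide_eq_right)
      moreover have "P * (LINT z|lborel. F z) \<le> 32 * (4 * (real (Suc k))\<^sup>2) * c2 / R\<^sup>2 * (LINT z|lborel. G z)"
        using * by (simp add: P_def mult_ac)
      ultimately have "P * (LINT z|lborel. F z) \<le> P * (C3 / R\<^sup>2 * (LINT z|lborel. G z))" by linarith
      thus ?thesis using P by (subst (asm) mult_le_cancel_left_pos)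
    qed
    have "(LINT z|lborel. G z) \<le> (LINT z|lborel. \<epsilon> * R\<^sup>2 * F z + Y * f t powr (2 * a) * bump 1 z)"
    proof (rule integral_mono[OF iG])
      have ib: "integrable lborel (\<lambda>z::real^'n. bump 1 z)"
        by (rule integral_cbox_eq_lborel(2)) (intro continuous_intros, simp add: bump_eq_0)
      show "integrable lborel (\<lambda>z. \<epsilon> * R\<^sup>2 * F z + Y * f t powr (2 * a) * bump 1 z)"
        by (intro Bochner_Integration.integrable_add integrable_mult_right iF ib)
      fix z
      show "G z \<le> \<epsilon> * R\<^sup>2 * F z + Y * f t powr (2 * a) * bump 1 z"
        using Y(2)[OF U(1)[of z] U(2)[of z] t(1,2) bump_nonneg[of 1 z] bump_le_1[of 1 z]] R
        unfolding bump_power by (simp add: G_def F_def t(3) mult_ac)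
    qed
    also have "\<dots> = \<epsilon> * R\<^sup>2 * (LINT z|lborel. F z) + Y * f t powr (2 * a) * mass"
    proof -
      have ib: "integrable lborel (\<lambda>z::real^'n. bump 1 z)"
        by (rule integral_cbox_eq_lborel(2)) (intro continuous_intros, simp add: bump_eq_0)
      show ?thesis unfolding mass_def using iF ib by (subst Bochner_Integration.integral_add) auto
    qed
    finally have "C3 / R\<^sup>2 * (LINT z|lborel. G z) \<le> C3 / R\<^sup>2 * (\<epsilon> * R\<^sup>2 * (LINT z|lborel. F z) + Y * f t powr (2 * a) * mass)"
      using C3 by (intro mult_left_mono) auto
    also have "\<dots> = (LINT z|lborel. F z) / 2 + C3 / R\<^sup>2 * (Y * f t powr (2 * a) * mass)"
      using C3 R by (simp add: \<epsilon>_def field_simps)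
    finally have "(LINT z|lborel. F z) \<le> 2 * (C3 / R\<^sup>2 * (Y * f t powr (2 * a) * mass))" using FG by linarith
    thus "(LINT z|lborel. f' (u (x + R *\<^sub>R z)) * f (u (x + R *\<^sub>R z)) powr (2 * a) * bump (2 * k + 2) z)
      \<le> 2 * C3 * Y * mass / R\<^sup>2 * f t powr (2 * a)" by (simp add: F_def U_def mult_ac)
  qed
qed

end

section \<open>Pointwise decay\<close>

text \<open>In the original variable both sides integrate \<open>Z\<close> against a weight. The one
  on the left is at most 1 and lives in the half ball about \<open>x\<close>, where the one on the
  right is at least \<open>(3 / 4) ^ n\<close>.\<close>

lemma bump_integral_le_larger_ball:
  fixes Z :: "'a::euclidean_space \<Rightarrow> real"
  assumes Z: "continuous_on UNIV Z" "\<And>y. 0 \<le> Z y" and s: "0 < s" and r: "0 < r"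
    and sub: "cball c s \<subseteq> cball x (r / 2)" and n: "1 \<le> n"
  shows "s ^ DIM('a) * (LINT z|lborel. Z (c + s *\<^sub>R z) * bump 1 z) \<le>
    (4 / 3) ^ n * r ^ DIM('a) * (LINT z|lborel. Z (x + r *\<^sub>R z) * bump n z)"
proof -
  define F where "F n x r y = Z y * bump n ((1 / r) *\<^sub>R (y - x))" for n x r y
  have cF: "continuous_on UNIV (F n x r)" for n x r unfolding F_def by (intro continuous_intros Z)
  have nm: "norm ((1 / r) *\<^sub>R (y - x)) = dist x y / r" if "0 < r" for x y :: 'a and r
    using that unfolding norm_scaleR by (simp add: dist_norm norm_minus_commute)
  have F0: "F n x r y = 0" if "r \<le> dist x y" "0 < r" "1 \<le> n" for n x r y
    unfolding F_def using that by (subst bump_eq_0) (simp_all add: nm del: norm_scaleR)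
  have iF: "integrable lborel (F n x r)" if "0 < r" "1 \<le> n" for n x r
    by (rule continuous_compact_support_integrable[OF cF compact_cball[of x r]]) (auto intro: F0 that)
  have eq: "(LINT y|lborel. F n x r y) = r ^ DIM('a) * (LINT z|lborel. Z (x + r *\<^sub>R z) * bump n z)"
    if "0 < r" for n x r
    using integral_lborel_scale[OF borel_measurable_continuous_onI[OF cF] that, of n x r x] that
    by (simp add: F_def)
  have "(LINT y|lborel. F 1 c s y) \<le> (LINT y|lborel. (4 / 3) ^ n * F n x r y)"
  proof (rule integral_mono)
    show "integrable lborel (F 1 c s)" "integrable lborel (\<lambda>y. (4 / 3) ^ n * F n x r y)"
      using iF s r n by auto
    fix y
    show "F 1 c s y \<le> (4 / 3) ^ n * F n x r y"
    proof (cases "dist c y \<le> s")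
      case True
      define z where "z = (1 / r) *\<^sub>R (y - x)"
      have "dist x y \<le> r / 2" using True sub by auto
      hence "norm z \<le> 1 / 2" using nm[OF r] r by (simp add: z_def del: norm_scaleR)
      hence "(norm z)\<^sup>2 \<le> (1 / 2)\<^sup>2" by (intro power_mono) auto
      hence "z \<bullet> z \<le> 1 / 4" by (simp add: power2_norm_eq_inner power_divide)
      hence "(3 / 4) ^ n \<le> bump n z" unfolding bump_def by (intro power_mono) auto
      hence "(4 / 3) ^ n * (3 / 4) ^ n \<le> (4 / 3) ^ n * bump n z" by (intro mult_left_mono) auto
      hence "1 \<le> (4 / 3) ^ n * bump n z" by (simp flip: power_mult_distrib)
      hence "Z y * 1 \<le> Z y * ((4 / 3) ^ n * bump n z)" by (intro mult_left_mono Z)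
      moreover have "F 1 c s y \<le> Z y * 1" unfolding F_def by (intro mult_left_mono Z bump_le_1)
      ultimately show ?thesis by (simp add: F_def z_def mult_ac)
    next
      case False
      have "0 \<le> F n x r y" unfolding F_def by (intro mult_nonneg_nonneg Z bump_nonneg)
      thus ?thesis using False s by (simp add: F0)
    qed
  qed
  thus ?thesis by (simp add: eq s r)
qed

context bounded_solution
begin

text \<open>Point picking: at a maximum point of \<open>(\<rho> - |y - x|)\<^sup>2 f' (u y)\<close> the potential \<open>f' \<circ> u\<close> is
  comparable to its value \<open>1 / r\<^sup>2\<close> on the ball of radius \<open>r\<close>, where the mean value inequality for
  \<open>f \<circ> u\<close> meets the energy bound on the large ball.\<close>

lemma potential_decay:
  assumes en: "0 < C" "\<And>x R t. 0 < R \<Longrightarrow> cball x R \<inter> K = {} \<Longrightarrow> 0 < t \<Longrightarrow> t \<le> M \<Longrightarrow> f' t = 1 / R\<^sup>2 \<Longrightarrow>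
    (LINT z|lborel. f' (u (x + R *\<^sub>R z)) * f (u (x + R *\<^sub>R z)) powr (2 * a) * bump n z)
      \<le> C / R\<^sup>2 * f t powr (2 * a)"
    and n: "1 \<le> n" and a: "1 < a" and ev: "\<forall>\<^sub>F t in at_right 0. f t * f'' t \<le> \<sigma> * (f' t)\<^sup>2" and \<sigma>: "0 < \<sigma>"
    and dim: "real CARD('n) - 2 < 4 * a / \<sigma>"
  obtains D where "0 < D" "\<And>x R t. 0 < R \<Longrightarrow> cball x R \<inter> K = {} \<Longrightarrow> 0 < t \<Longrightarrow> t \<le> M \<Longrightarrow> f' t = 1 / R\<^sup>2 \<Longrightarrow>
    f' (u x) \<le> D / R\<^sup>2"
proof -
  define N where "N = real CARD('n)"
  obtain U where U: "0 < U"
    "\<And>s t. 0 < s \<Longrightarrow> s \<le> t \<Longrightarrow> t \<le> M \<Longrightarrow> f' t * f s powr \<sigma> \<le> U * (f' s * f t powr \<sigma>)"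
    by (rule deriv_growth_upper[OF ev M_pos less_imp_le[OF \<sigma>]]) (rule that)
  \<comment> \<open>The mean value inequality on the ball of radius \<open>r\<close> costs
    \<open>exp 4\<close>, the potential being at most \<open>4 / r\<^sup>2\<close> there; this
    \<delta> makes the first term of the splitting half of the left side.\<close>
  define \<delta> :: real where "\<delta> = exp (-4) / 2"
  have \<delta>: "0 < \<delta>" by (simp add: \<delta>_def)
  have p: "1 \<le> 2 * a" using a by simp
  obtain V where V: "0 < V" "\<And>s s0. 0 < s \<Longrightarrow> s \<le> M \<Longrightarrow> 0 < s0 \<Longrightarrow> s0 \<le> M \<Longrightarrow>
    f s \<le> \<delta> * f s0 + V * ((f' s / f' s0) * f s powr (2 * a) * f s0 powr (1 - 2 * a))"
    by (rule split_by_potential[where U=U and M=M and \<sigma>=\<sigma> and \<delta>=\<delta> and p="2 * a"])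
       (assumption | rule U \<delta> p less_imp_le[OF \<sigma>] that)+
  define mass where "mass = (LINT z|lborel. bump 1 (z::real^'n))"
  have mass: "0 < mass" unfolding mass_def by (rule integral_bump_pos)
  define C1 where "C1 = 2 * exp 4 * V * (4 / 3) ^ n * C / mass"
  have C1: "0 < C1" using V en mass by (simp add: C1_def)
  \<comment> \<open>The surplus in the dimension condition. The relations \<open>vq\<close> and
    \<open>qv\<close> below combine to \<open>q powr \<gamma> \<le> B\<close>.\<close>
  define \<gamma> where "\<gamma> = 4 * a / \<sigma> - (N - 2)"
  have \<gamma>: "0 < \<gamma>" using dim by (simp add: \<gamma>_def N_def)
  define B where "B = C1 * U powr (2 * a / \<sigma>)"
  have B: "0 < B" using C1 U by (simp add: B_def)
  \<comment> \<open>16 serves the case \<open>d \<le> 2 * r\<close>, in which \<open>y0\<close> is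
    close to the boundary at its own scale; the power of \<open>B\<close> serves the other
    case.\<close>
  define D where "D = 16 + B powr (2 / \<gamma>)"
  show thesis
  proof (rule that[of D])
    show "0 < D" by (simp add: D_def add_pos_nonneg)
    fix x :: "real^'n" and R t :: real
    assume R: "0 < R" "cball x R \<inter> K = {}" and t: "0 < t" "t \<le> M" "f' t = 1 / R\<^sup>2"
    define W where "W y = f' (u y)" for y
    have W: "0 < W y" for y unfolding W_def using deriv_pos u_pos by blast
    define \<rho> where "\<rho> = R / 2"
    have \<rho>: "0 < \<rho>" using R by (simp add: \<rho>_def)
    have "\<exists>y\<in>cball x \<rho>. \<forall>z\<in>cball x \<rho>. (\<rho> - dist x z)\<^sup>2 * W z \<le> (\<rho> - dist x y)\<^sup>2 * W y"
      unfolding W_def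
      by (rule continuous_attains_sup) (use \<rho> in \<open>auto intro!: continuous_intros cont_f'_u\<close>)
    then obtain y0 where y0: "dist x y0 \<le> \<rho>"
      "\<And>z. dist x z \<le> \<rho> \<Longrightarrow> (\<rho> - dist x z)\<^sup>2 * W z \<le> (\<rho> - dist x y0)\<^sup>2 * W y0"
      by auto
    define d where "d = \<rho> - dist x y0"
    have Wx: "\<rho>\<^sup>2 * W x \<le> d\<^sup>2 * W y0" using y0(2)[of x] \<rho> by (simp add: d_def)
    hence "0 < d\<^sup>2 * W y0" using \<rho> W[of x] by (intro less_le_trans[OF _ Wx]) simp
    hence d: "0 < d" "d \<le> \<rho>" using y0(1) by (auto simp: d_def zero_less_mult_iff order_less_le)
    define r where "r = 1 / sqrt (W y0)"
    have r: "0 < r" "W y0 = 1 / r\<^sup>2" using W[of y0] by (auto simp: r_def power_divide)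
    show "f' (u x) \<le> D / R\<^sup>2"
    proof (cases "d \<le> 2 * r")
      case True
      have "d\<^sup>2 * W y0 \<le> (2 * r)\<^sup>2 * W y0" using True d W[of y0] by (intro mult_right_mono power_mono) auto
      also have "\<dots> = 4" using r by (simp add: power_mult_distrib)
      finally have "\<rho>\<^sup>2 * W x \<le> 4" using Wx by linarith
      hence "W x \<le> 16 / R\<^sup>2" using R by (simp add: \<rho>_def field_simps power_divide)
      also have "\<dots> \<le> D / R\<^sup>2" by (intro divide_right_mono) (auto simp: D_def)
      finally show ?thesis by (simp add: W_def)
    next
      case False
      hence dr: "2 * r < d" by simp
      have rR: "r < R" using dr d r by (simp add: \<rho>_def)
      define w where "w y = f (u y)" for y
      have w: "0 < w y" for y unfolding w_def using pos u_pos by blast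
      have cw: "continuous_on UNIV w" unfolding w_def by (rule cont_f_u)
      \<comment> \<open>A point within \<open>r < d / 2\<close> of \<open>y0\<close> keeps at least
        half of the distance \<open>d\<close> to the boundary, so by maximality of the weighted
        potential \<open>W\<close> is there at most 4 times \<open>W y0\<close>.\<close>
      have near: "W y \<le> 4 / r\<^sup>2" "dist x y \<le> \<rho>" if y: "dist y0 y \<le> r" for y
      proof -
        have tri: "dist x y \<le> dist x y0 + r" using dist_triangle[of x y y0] y by linarith
        thus le: "dist x y \<le> \<rho>" using dr d r by (simp add: d_def)
        have "d / 2 \<le> \<rho> - dist x y" using tri dr by (simp add: d_def)
        hence "(d / 2)\<^sup>2 * W y \<le> (\<rho> - dist x y)\<^sup>2 * W y"
          using d W[of y] by (intro mult_right_mono power_mono) auto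
        also have "\<dots> \<le> d\<^sup>2 * W y0" using y0(2)[OF le] by (simp add: d_def)
        finally have "d\<^sup>2 * W y \<le> d\<^sup>2 * (4 * W y0)" by (simp add: power_divide)
        hence "W y \<le> 4 * W y0" using d by (subst (asm) mult_le_cancel_left_pos) auto
        thus "W y \<le> 4 / r\<^sup>2" using r by simp
      qed
      define Z where "Z y = W y * w y powr (2 * a)" for y
      have Z: "0 \<le> Z y" for y using W[of y] by (simp add: Z_def)
      have cZ: "continuous_on UNIV Z"
        unfolding Z_def W_def w_def by (intro continuous_intros cont_f'_u cont_powr_f_u)
      define X where "X = bump_mean Z y0 r"
      have sub: "w y0 * mass \<le> exp 4 * bump_mean w y0 r"
      proof -
        have "w y0 * mass \<le> exp (4 / r\<^sup>2 * r\<^sup>2) * bump_mean w y0 r"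
          unfolding mass_def
        proof (rule subsolution_le_bump_mean)
          show "C2_fun w" unfolding w_def by (rule f_u_C2)
          show "0 \<le> 4 / r\<^sup>2" "0 \<le> r" using r by auto
          show "0 \<le> w y" for y using w[of y] by simp
          fix y assume y: "dist y0 y \<le> r"
          have "- laplacian w y \<le> W y * w y" unfolding w_def W_def by (rule laplacian_f_u)
          also have "\<dots> \<le> 4 / r\<^sup>2 * w y" using near(1)[OF y] w[of y] by (intro mult_right_mono) auto
          finally show "- laplacian w y \<le> 4 / r\<^sup>2 * w y" .
        qed
        thus ?thesis using r by simp
      qed
      have ib: "integrable lborel (\<lambda>z::real^'n. bump 1 z)"
        by (rule integral_cbox_eq_lborel(2)) (intro continuous_intros, simp add: bump_eq_0)
      define T where "T = V * r\<^sup>2 * w y0 powr (1 - 2 * a)"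
      have T: "0 < T" using V r w[of y0] by (simp add: T_def)
      have pw: "w y \<le> \<delta> * w y0 + T * Z y" for y
      proof -
        have "w y \<le> \<delta> * w y0 + V * ((W y / W y0) * w y powr (2 * a) * w y0 powr (1 - 2 * a))"
          unfolding w_def W_def by (rule V(2)) (rule u_pos u_le)+
        thus ?thesis using r by (simp add: T_def Z_def mult_ac)
      qed
      have "bump_mean w y0 r \<le> (LINT z|lborel. \<delta> * w y0 * bump 1 z + T * (Z (y0 + r *\<^sub>R z) * bump 1 z))"
        unfolding bump_mean_def
      proof (rule integral_mono)
        show "integrable lborel (\<lambda>z. w (y0 + r *\<^sub>R z) * bump 1 z)" by (intro integrable_bump cw) simp
        show "integrable lborel (\<lambda>z. \<delta> * w y0 * bump 1 z + T * (Z (y0 + r *\<^sub>R z) * bump 1 z))"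
          by (intro Bochner_Integration.integrable_add integrable_mult_right ib integrable_bump cZ) simp
        fix z :: "real^'n"
        have "w (y0 + r *\<^sub>R z) * bump 1 z \<le> (\<delta> * w y0 + T * Z (y0 + r *\<^sub>R z)) * bump 1 z"
          by (intro mult_right_mono pw bump_nonneg)
        thus "w (y0 + r *\<^sub>R z) * bump 1 z \<le> \<delta> * w y0 * bump 1 z + T * (Z (y0 + r *\<^sub>R z) * bump 1 z)"
          by (simp add: algebra_simps)
      qed
      also have "\<dots> = \<delta> * w y0 * mass + T * X"
        unfolding mass_def X_def bump_mean_def
        using ib integrable_bump[OF cZ, of 1 y0 r] by (subst Bochner_Integration.integral_add) auto
      finally have "exp 4 * bump_mean w y0 r \<le> exp 4 * (\<delta> * w y0 * mass + T * X)" by simp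
      also have "\<dots> = w y0 * mass / 2 + exp 4 * (T * X)"
        by (simp add: \<delta>_def distrib_left flip: exp_add mult.assoc)
      finally have 1: "w y0 * mass \<le> 2 * exp 4 * T * X" using sub by linarith
      have 2: "r ^ CARD('n) * X \<le> (4 / 3) ^ n * (R ^ CARD('n) * (C / R\<^sup>2 * f t powr (2 * a)))"
      proof -
        have "cball y0 r \<subseteq> cball x (R / 2)" using near(2) by (auto simp: \<rho>_def)
        from bump_integral_le_larger_ball[OF cZ Z r(1) R(1) this n]
        have "r ^ CARD('n) * X \<le> (4 / 3) ^ n * R ^ CARD('n) * (LINT z|lborel. Z (x + R *\<^sub>R z) * bump n z)"
          by (simp add: X_def bump_mean_def)
        also have "\<dots> \<le> (4 / 3) ^ n * R ^ CARD('n) * (C / R\<^sup>2 * f t powr (2 * a))"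
          using en(2)[OF R t] R by (intro mult_left_mono) (auto simp: Z_def W_def w_def)
        finally show ?thesis by (simp add: mult.assoc)
      qed
      define q where "q = R / r"
      have q: "1 < q" using rR r by (simp add: q_def)
      have ft: "0 < f t" using pos t by blast
      define v where "v = w y0 / f t"
      have v: "0 < v" using w ft by (simp add: v_def)
      \<comment> \<open>The mean value inequality at scale \<open>r\<close> meets the energy at
        scale \<open>R\<close>: the volumes contribute \<open>q ^ CARD('n)\<close>, and the factors
        \<open>r\<^sup>2\<close> and \<open>1 / R\<^sup>2\<close> contribute \<open>q\<close> to the
        power -2.\<close>
      have vq: "v powr (2 * a) \<le> C1 * q powr (N - 2)"
      proof -
        have one: "w y0 powr (2 * a - 1) * w y0 powr (1 - 2 * a) = 1"
          using w[of y0] by (simp flip: powr_add)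
        have "w y0 powr (2 * a - 1) * (w y0 * mass) \<le> w y0 powr (2 * a - 1) * (2 * exp 4 * T * X)"
          using 1 by (intro mult_left_mono) auto
        also have "\<dots> = (w y0 powr (2 * a - 1) * w y0 powr (1 - 2 * a)) * (2 * exp 4 * V * r\<^sup>2 * X)"
          by (simp add: T_def mult_ac)
        also have "\<dots> = 2 * exp 4 * V * r\<^sup>2 * X" unfolding one by simp
        also have "w y0 powr (2 * a - 1) * (w y0 * mass) = w y0 powr (2 * a) * mass"
          using w[of y0] by (simp add: powr_diff)
        finally have "r ^ CARD('n) * (w y0 powr (2 * a) * mass) \<le> r ^ CARD('n) * (2 * exp 4 * V * r\<^sup>2 * X)"
          using r by (intro mult_left_mono) auto
        also have "\<dots> = 2 * exp 4 * V * r\<^sup>2 * (r ^ CARD('n) * X)" by (simp add: mult_ac)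
        also have "\<dots> \<le> 2 * exp 4 * V * r\<^sup>2 * ((4 / 3) ^ n * (R ^ CARD('n) * (C / R\<^sup>2 * f t powr (2 * a))))"
          using 2 V by (intro mult_left_mono) auto
        also have "\<dots> = (C1 * mass) * (r\<^sup>2 / R\<^sup>2 * R ^ CARD('n) * f t powr (2 * a))"
          using mass by (simp add: C1_def mult_ac)
        finally have *: "r ^ CARD('n) * (w y0 powr (2 * a) * mass) \<le>
            (C1 * mass) * (r\<^sup>2 / R\<^sup>2 * R ^ CARD('n) * f t powr (2 * a))" .
        have "v powr (2 * a) = (r ^ CARD('n) * (w y0 powr (2 * a) * mass)) / (r ^ CARD('n) * mass * f t powr (2 * a))"
          using r mass ft w[of y0] by (simp add: v_def powr_divide)
        also have "\<dots> \<le> ((C1 * mass) * (r\<^sup>2 / R\<^sup>2 * R ^ CARD('n) * f t powr (2 * a))) / (r ^ CARD('n) * mass * f t powr (2 * a))"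
          using * r mass by (intro divide_right_mono) auto
        also have "\<dots> = C1 * (q ^ CARD('n) / q\<^sup>2)"
          using r R(1) mass ft by (simp add: q_def power_divide mult_ac)
        also have "q ^ CARD('n) / q\<^sup>2 = q powr (N - 2)"
          using q by (simp add: N_def powr_diff powr_realpow)
        finally show ?thesis .
      qed
      \<comment> \<open>\<open>f'\<close> equals \<open>1 / r\<^sup>2\<close> at \<open>u y0\<close>
        and \<open>1 / R\<^sup>2\<close> at \<open>t\<close>, hence \<open>t < u y0\<close>, and the
        upper growth estimate bounds the quotient of these values by a power of
        \<open>v\<close>.\<close>
      have qv: "q\<^sup>2 \<le> U * v powr \<sigma>"
      proof -
        have "1 / R\<^sup>2 < 1 / r\<^sup>2"
          using r rR by (intro divide_strict_left_mono power_strict_mono) auto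
        hence "t < u y0" using deriv_mono[OF u_pos[of y0], of t] r(2) t(3) by (force simp: W_def)
        hence "f' (u y0) * f t powr \<sigma> \<le> U * (f' t * f (u y0) powr \<sigma>)"
          using t u_le by (intro U(2)) auto
        hence "1 / r\<^sup>2 * f t powr \<sigma> \<le> U * (1 / R\<^sup>2 * w y0 powr \<sigma>)"
          using r(2) t(3) by (simp add: W_def w_def)
        hence "1 / r\<^sup>2 * f t powr \<sigma> * (R\<^sup>2 / f t powr \<sigma>) \<le> U * (1 / R\<^sup>2 * w y0 powr \<sigma>) * (R\<^sup>2 / f t powr \<sigma>)"
          by (intro mult_right_mono) auto
        moreover have "1 / r\<^sup>2 * f t powr \<sigma> * (R\<^sup>2 / f t powr \<sigma>) = q\<^sup>2"
          using ft by (simp add: q_def power_divide)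
        moreover have "U * (1 / R\<^sup>2 * w y0 powr \<sigma>) * (R\<^sup>2 / f t powr \<sigma>) = U * v powr \<sigma>"
          using R(1) ft w[of y0] by (simp add: v_def powr_divide)
        ultimately show ?thesis by simp
      qed
      have "q\<^sup>2 = q powr 2" using q by (simp add: powr_numeral)
      \<comment> \<open>Raising \<open>qv\<close> to the power \<open>2 * a / \<sigma>\<close>
        produces \<open>v powr (2 * a)\<close>, to which \<open>vq\<close> applies; then
        \<open>q powr (N - 2)\<close> cancels.\<close>
      have "q powr (N - 2) * q powr \<gamma> = q powr (4 * a / \<sigma>)" by (simp add: \<gamma>_def flip: powr_add)
      also have "\<dots> = (q\<^sup>2) powr (2 * a / \<sigma>)"
        unfolding \<open>q\<^sup>2 = q powr 2\<close> by (simp add: powr_powr)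
      also have "\<dots> \<le> (U * v powr \<sigma>) powr (2 * a / \<sigma>)" using qv a \<sigma> by (intro powr_mono2) auto
      also have "\<dots> = U powr (2 * a / \<sigma>) * v powr (2 * a)"
        using U v \<sigma> by (simp add: powr_mult powr_powr)
      also have "\<dots> \<le> U powr (2 * a / \<sigma>) * (C1 * q powr (N - 2))" by (intro mult_left_mono vq) auto
      also have "\<dots> = q powr (N - 2) * B" by (simp add: B_def)
      finally have "q powr \<gamma> \<le> B" using q by simp
      hence "(q powr \<gamma>) powr (2 / \<gamma>) \<le> B powr (2 / \<gamma>)" using \<gamma> by (intro powr_mono2) auto
      hence "q\<^sup>2 \<le> B powr (2 / \<gamma>)" using \<gamma> q by (simp add: powr_powr powr_numeral)
      hence qD: "q\<^sup>2 \<le> D" by (simp add: D_def)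
      have "d\<^sup>2 * W y0 \<le> \<rho>\<^sup>2 * W y0"
        using d W[of y0] by (intro mult_right_mono power_mono) auto
      with Wx have "\<rho>\<^sup>2 * W x \<le> \<rho>\<^sup>2 * W y0" by (rule order_trans)
      hence "W x \<le> W y0" using \<rho> by simp
      also have "W y0 = q\<^sup>2 / R\<^sup>2" using r R(1) by (simp add: q_def power_divide)
      also have "\<dots> \<le> D / R\<^sup>2" using qD by (intro divide_right_mono) auto
      finally show ?thesis by (simp add: W_def)
    qed
  qed
qed

end

section \<open>Harnack inequality and what the existence of \<open>u\<close> says about
  \<open>f\<close>\<close>

lemma bump_mean_le_larger_ball:
  fixes Z :: "'a::euclidean_space \<Rightarrow> real"
  assumes Z: "continuous_on UNIV Z" "\<And>y. 0 \<le> Z y" and s: "0 < s" and r: "0 < r"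
    and sub: "cball c s \<subseteq> cball x (r / 2)"
  shows "s ^ DIM('a) * bump_mean Z c s \<le> 4 / 3 * r ^ DIM('a) * bump_mean Z x r"
  using bump_integral_le_larger_ball[OF Z s r sub order_refl] by (simp add: bump_mean_def)

context bounded_solution
begin

text \<open>Four times the constant \<open>(N + 2)\<^sup>2 / 2\<close> of the eigenvalue comparison,
  so that a ball of radius |x|/2 contributes \<open>eig\<close> divided by |x|^2.\<close>

definition "eig = 2 * (real CARD('n) + 2)\<^sup>2"

lemma eig_pos: "0 < eig"
  by (simp add: eig_def)

lemma superharmonic: "laplacian u x \<le> 0"
  using pos[OF u_pos[of x]] by (simp add: lap)

lemma exists_small_quotient_in_ball:
  assumes "0 < r"
  obtains y where "dist x y < r" "f (u y) \<le> eig / (2 * r)\<^sup>2 * u y"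
  using exists_small_potential[OF u2 u_pos assms, of x] that by (auto simp: lap eig_def power2_eq_square)

text \<open>Near \<open>x\<close> the function \<open>u\<close> is a subsolution with potential
  \<open>L / r\<^sup>2\<close>, which bounds \<open>u x\<close> by its mean over the ball of radius
  \<open>r\<close>. That ball lies in the one of radius \<open>2 * r\<close> about \<open>y\<close>,
  and superharmonicity bounds the mean over radius \<open>4 * r\<close> by
  \<open>u y\<close>.\<close>

lemma harnack:
  assumes r: "0 < r" and L: "0 \<le> L" and W: "\<And>y. dist x y \<le> r \<Longrightarrow> f' (u y) \<le> L / r\<^sup>2"
    and y: "dist x y \<le> r"
  shows "u x \<le> exp L * (4 / 3) * 4 ^ CARD('n) * u y"
proof -
  define mass where "mass = (LINT z|lborel. bump 1 (z::real^'n))"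
  have mass: "0 < mass" unfolding mass_def by (rule integral_bump_pos)
  have "u x * mass \<le> exp (L / r\<^sup>2 * r\<^sup>2) * bump_mean u x r"
    unfolding mass_def
  proof (rule subsolution_le_bump_mean[OF u2])
    show "0 \<le> L / r\<^sup>2" "0 \<le> r" using L r by auto
    show "0 \<le> u z" for z using u_pos[of z] by simp
    fix z assume z: "dist x z \<le> r"
    have "- laplacian u z \<le> u z * f' (u z)" using le_deriv[OF u_pos[of z]] by (simp add: lap)
    also have "\<dots> \<le> u z * (L / r\<^sup>2)" using W[OF z] u_pos[of z] by (intro mult_left_mono) auto
    finally show "- laplacian u z \<le> L / r\<^sup>2 * u z" by (simp add: mult.commute)
  qed
  hence a: "u x * mass \<le> exp L * bump_mean u x r" using r by simp
  have "r ^ DIM(real^'n) * bump_mean u x r \<le> 4 / 3 * (4 * r) ^ DIM(real^'n) * bump_mean u y (4 * r)"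
  proof (rule bump_mean_le_larger_ball)
    show "0 \<le> u z" for z using u_pos[of z] by simp
    show "cball x r \<subseteq> cball y (4 * r / 2)"
    proof
      fix z assume "z \<in> cball x r"
      thus "z \<in> cball y (4 * r / 2)" using dist_triangle[of y z x] y by (simp add: dist_commute)
    qed
  qed (use r cont_u in auto)
  hence "r ^ CARD('n) * bump_mean u x r \<le> r ^ CARD('n) * (4 / 3 * 4 ^ CARD('n) * bump_mean u y (4 * r))"
    by (simp add: power_mult_distrib mult_ac)
  hence "bump_mean u x r \<le> 4 / 3 * 4 ^ CARD('n) * bump_mean u y (4 * r)"
    using r by (subst (asm) mult_le_cancel_left_pos) auto
  also have "\<dots> \<le> 4 / 3 * 4 ^ CARD('n) * (u y * mass)"
    unfolding mass_def by (intro mult_left_mono superharmonic_ge_bump_mean[OF u2] superharmonic) (use r in auto)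
  finally have "exp L * bump_mean u x r \<le> exp L * (4 / 3 * 4 ^ CARD('n) * (u y * mass))"
    by (intro mult_left_mono) auto
  with a have "u x * mass \<le> exp L * (4 / 3 * 4 ^ CARD('n) * (u y * mass))" by (rule order_trans)
  hence "u x * mass \<le> (exp L * (4 / 3) * 4 ^ CARD('n) * u y) * mass" by (simp add: mult_ac)
  thus ?thesis using mass by (subst (asm) mult_le_cancel_right_pos)
qed

text \<open>The mean over the unit ball is positive, by the subsolution inequality at 0. For |x| at
  least 1 the unit ball lies in the ball of radius 2|x| about \<open>x\<close>, so this mean is
  dominated by the one about \<open>x\<close> with radius 4|x|, hence by \<open>u x\<close>; the
  power is the ratio of the volumes. The exponent is cruder than that of the fundamental solution,
  but any polynomial rate suffices.\<close>

lemma superharmonic_lower_bound: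
  obtains c where "0 < c" "\<And>x. 1 \<le> norm x \<Longrightarrow> c / norm x ^ CARD('n) \<le> u x"
proof -
  define mass where "mass = (LINT z|lborel. bump 1 (z::real^'n))"
  have mass: "0 < mass" unfolding mass_def by (rule integral_bump_pos)
  define b where "b = bump_mean u 0 1"
  have "u 0 * mass \<le> exp (f' M * 1\<^sup>2) * b"
    unfolding mass_def b_def
  proof (rule subsolution_le_bump_mean[OF u2])
    show "0 \<le> f' M" using deriv_pos[OF M_pos] by simp
    show "0 \<le> u z" for z using u_pos[of z] by simp
    fix z :: "real^'n"
    have "- laplacian u z \<le> u z * f' (u z)" using le_deriv[OF u_pos[of z]] by (simp add: lap)
    also have "\<dots> \<le> u z * f' M"
      using deriv_mono[OF u_pos[of z] u_le] u_pos[of z] by (intro mult_left_mono) auto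
    finally show "- laplacian u z \<le> f' M * u z" by (simp add: mult.commute)
  qed simp
  moreover have "0 < u 0 * mass" using u_pos mass by simp
  ultimately have "0 < exp (f' M * 1\<^sup>2) * b" by linarith
  hence b: "0 < b" by (simp add: zero_less_mult_iff)
  define c where "c = 3 / 4 * b / (4 ^ CARD('n) * mass)"
  show thesis
  proof (rule that[of c])
    show "0 < c" using b mass by (simp add: c_def)
    fix x :: "real^'n" assume x: "1 \<le> norm x"
    have n0: "0 < norm x" using x by linarith
    have "1 ^ DIM(real^'n) * bump_mean u 0 1 \<le> 4 / 3 * (4 * norm x) ^ DIM(real^'n) * bump_mean u x (4 * norm x)"
    proof (rule bump_mean_le_larger_ball)
      show "0 \<le> u z" for z using u_pos[of z] by simp
      show "cball 0 1 \<subseteq> cball x (4 * norm x / 2)"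
      proof
        fix z :: "real^'n" assume "z \<in> cball 0 1"
        thus "z \<in> cball x (4 * norm x / 2)" using dist_triangle[of x z 0] x by simp
      qed
    qed (use n0 cont_u in auto)
    also have "\<dots> \<le> 4 / 3 * (4 * norm x) ^ DIM(real^'n) * (u x * mass)"
      unfolding mass_def by (intro mult_left_mono superharmonic_ge_bump_mean[OF u2] superharmonic) auto
    finally have "b \<le> 4 / 3 * (4 ^ CARD('n) * norm x ^ CARD('n)) * (u x * mass)"
      by (simp add: b_def power_mult_distrib)
    thus "c / norm x ^ CARD('n) \<le> u x" using n0 mass by (simp add: c_def field_simps)
  qed
qed

text \<open>The eigenvalue comparison applies on balls of every radius, so the existence of
  \<open>u\<close> on the whole space forces f(t)/t to tend to 0.\<close>

lemma quotient_small:
  assumes "0 < \<epsilon>"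
  obtains t where "0 < t" "t \<le> M" "f t < \<epsilon> * t"
proof -
  define r where "r = sqrt (eig / \<epsilon>)"
  have r: "0 < r" using assms eig_pos by (simp add: r_def)
  obtain y where y: "f (u y) \<le> eig / (2 * r)\<^sup>2 * u y"
    by (rule exists_small_quotient_in_ball[OF r, of 0]) (rule that)
  have "eig / (2 * r)\<^sup>2 = \<epsilon> / 4"
    using assms eig_pos by (simp add: r_def power_mult_distrib)
  also have "\<dots> < \<epsilon>" using assms by simp
  finally have "eig / (2 * r)\<^sup>2 * u y < \<epsilon> * u y" using u_pos by (rule mult_strict_right_mono)
  with y show ?thesis using that[of "u y"] u_pos u_le by force
qed

lemma deriv_small:
  assumes "0 < \<epsilon>"
  obtains t where "0 < t" "t \<le> M" "f' t < \<epsilon>"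
proof -
  obtain t where t: "0 < t" "t \<le> M" "f t < \<epsilon> / 2 * t"
    by (rule quotient_small[of "\<epsilon> / 2"]) (use assms that in auto)
  have "f' (t / 2) * (t - t / 2) \<le> f t - f (t / 2)" using t by (intro above_tangent) auto
  also have "\<dots> < \<epsilon> / 2 * t" using t pos[of "t / 2"] by simp
  also have "\<dots> = \<epsilon> * (t - t / 2)" by simp
  finally have "f' (t / 2) < \<epsilon>" using t by (subst (asm) mult_less_cancel_right_pos) auto
  thus ?thesis using that[of "t / 2"] t by auto
qed

text \<open>Convexity gives weak monotonicity only. Equality at \<open>s < t\<close> would give the
  tangent at \<open>s\<close> a slope of at most \<open>c = f s / s\<close>, hence
  \<open>f r \<ge> c * r\<close> for all \<open>r \<le> s\<close>, against
  \<open>quotient_small\<close>. The uniqueness of \<open>s(R)\<close> rests on this.\<close>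

lemma quotient_strict_mono:
  assumes "0 < s" "s < t"
  shows "f s / s < f t / t"
proof (rule ccontr)
  define c where "c = f s / s"
  assume "\<not> f s / s < f t / t"
  hence ct: "f t / t = c" using quotient_mono[of s t] assms by (simp add: c_def)
  have fs: "f s = c * s" "f t = c * t" 
    using assms ct by (simp_all add: divide_eq_eq) (simp add: c_def)
  have c0: "0 < c" using assms pos[of s] by (simp add: c_def)
  have "f' s * (t - s) \<le> c * (t - s)" using above_tangent[of s t] assms by (simp add: fs right_diff_distrib)
  hence le: "f' s \<le> c" using assms by simp
  obtain r where r: "0 < r" "f r < c * r" by (rule quotient_small[OF c0]) (rule that)
  show False
  proof (cases "r \<le> s")
    case True
    have "c * (r - s) \<le> f' s * (r - s)" using le True by (intro mult_right_mono_neg) auto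
    also have "\<dots> \<le> f r - f s" using assms r by (intro above_tangent) auto
    finally show False using r by (simp add: fs right_diff_distrib)
  next
    case False
    thus False using quotient_mono[of s r] assms r by (simp add: c_def field_simps)
  qed
qed

lemma quotient_solvable:
  assumes "0 < \<epsilon>" "\<epsilon> \<le> f M / M"
  obtains s where "0 < s" "s \<le> M" "f s / s = \<epsilon>"
proof -
  obtain t where t: "0 < t" "t \<le> M" "f t < \<epsilon> * t" by (rule quotient_small[OF assms(1)]) (rule that)
  have "continuous_on {t..M} (\<lambda>s. f s / s)"
    using t by (intro continuous_intros continuous_on_subset[OF cont]) auto
  hence "\<exists>s\<ge>t. s \<le> M \<and> f s / s = \<epsilon>"
    using t assms by (intro IVT') (auto simp: field_simps)
  then obtain s where "t \<le> s" "s \<le> M" "f s / s = \<epsilon>" by blast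
  thus ?thesis using that[of s] t by simp
qed

lemma deriv_solvable:
  assumes "0 < \<epsilon>" "\<epsilon> \<le> f' M"
  obtains s where "0 < s" "s \<le> M" "f' s = \<epsilon>"
proof -
  obtain t where t: "0 < t" "t \<le> M" "f' t < \<epsilon>" by (rule deriv_small[OF assms(1)]) (rule that)
  have "continuous_on {t..M} f'"
    using t by (auto intro!: continuous_at_imp_continuous_on DERIV_isCont has_deriv2)
  hence "\<exists>s\<ge>t. s \<le> M \<and> f' s = \<epsilon>"
    using t assms by (intro IVT') auto
  then obtain s where "t \<le> s" "s \<le> M" "f' s = \<epsilon>" by blast
  thus ?thesis using that[of s] t by simp
qed

text \<open>A positive superharmonic function decays at most polynomially, so \<open>f\<close> cannot be almost linear.\<close>

lemma not_almost_linear: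
  assumes ev: "\<forall>\<^sub>F t in at_right 0. f t * f'' t \<le> 1 / (real CARD('n) + 2) * (f' t)\<^sup>2"
  shows False
proof -
  define N where "N = real CARD('n)"
  \<comment> \<open>Solves \<open>2 * (1 - \<sigma>) = N * \<sigma> + 1\<close>. With
    \<open>t = u y\<close> at distance about \<open>R\<close>, the upper bound for
    \<open>t powr \<sigma>\<close> then decays faster than the lower bound by exactly one factor
    \<open>R\<close>, so \<open>R\<close> would be bounded.\<close>
  define \<sigma> where "\<sigma> = 1 / (N + 2)"
  have N: "0 < N" by (simp add: N_def)
  have \<sigma>: "0 < \<sigma>" "\<sigma> < 1" "2 * (1 - \<sigma>) = N * \<sigma> + 1" using N by (auto simp: \<sigma>_def field_simps)
  have ev': "\<forall>\<^sub>F t in at_right 0. f t * f'' t \<le> \<sigma> * (f' t)\<^sup>2" using ev by (simp add: \<sigma>_def N_def)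
  obtain k where k: "0 < k" "\<And>t. 0 < t \<Longrightarrow> t \<le> M \<Longrightarrow> k * t \<le> f t powr (1 - \<sigma>)"
    by (rule lower_power_bound[OF ev' M_pos less_imp_le[OF \<sigma>(1)] \<sigma>(2)]) (rule that)
  obtain c where c: "0 < c" "\<And>x. 1 \<le> norm x \<Longrightarrow> c / norm x ^ CARD('n) \<le> u x"
    by (rule superharmonic_lower_bound) (rule that)
  define B where "B = eig powr (1 - \<sigma>) / (k * (c / 2 ^ CARD('n)) powr \<sigma>)"
  have R_le: "R \<le> B" if R: "2 \<le> R" for R
  proof -
    define x :: "real^'n" where "x = R *\<^sub>R axis undefined 1"
    have nx: "norm x = R" using R by (simp add: x_def)
    obtain y where y: "dist x y < R / 2" "f (u y) \<le> eig / (2 * (R / 2))\<^sup>2 * u y"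
      by (rule exists_small_quotient_in_ball[of "R / 2" x]) (use R that in auto)
    have ny: "R / 2 \<le> norm y" "norm y \<le> 2 * R"
      using norm_triangle_ineq2[of x y] norm_triangle_ineq2[of y x] y(1) R
      unfolding dist_norm norm_minus_commute[of y x] nx by linarith+
    define t where "t = u y"
    have t: "0 < t" "t \<le> M" using u_pos u_le by (auto simp: t_def)
    have "k * t \<le> f t powr (1 - \<sigma>)" by (rule k(2)[OF t])
    also have "\<dots> \<le> (eig / R\<^sup>2 * t) powr (1 - \<sigma>)"
      using y(2) pos[OF t(1)] \<sigma> by (intro powr_mono2) (auto simp: t_def)
    also have "\<dots> = eig powr (1 - \<sigma>) / R powr (2 * (1 - \<sigma>)) * t powr (1 - \<sigma>)"
    proof -
      have "R\<^sup>2 = R powr 2" using R by (simp add: powr_numeral)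
      hence "(R\<^sup>2) powr (1 - \<sigma>) = R powr (2 * (1 - \<sigma>))" by (simp only: powr_powr)
      thus ?thesis using R t eig_pos by (simp add: powr_mult powr_divide)
    qed
    finally have "k * t * R powr (2 * (1 - \<sigma>)) \<le> eig powr (1 - \<sigma>) * t powr (1 - \<sigma>)"
      using R by (simp add: field_simps)
    also have "t powr (1 - \<sigma>) = t / t powr \<sigma>" using t by (simp add: powr_diff)
    finally have "t * (k * t powr \<sigma> * R powr (2 * (1 - \<sigma>))) \<le> t * eig powr (1 - \<sigma>)"
      using t by (simp add: field_simps)
    hence 1: "k * t powr \<sigma> * R powr (2 * (1 - \<sigma>)) \<le> eig powr (1 - \<sigma>)" using t by simp
    have "0 < norm y" using ny R by linarith
    hence "c / (2 * R) ^ CARD('n) \<le> c / norm y ^ CARD('n)"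
      using ny R c by (intro divide_left_mono power_mono mult_pos_pos) auto
    also have "\<dots> \<le> t" unfolding t_def using ny R by (intro c) auto
    finally have "(c / (2 * R) ^ CARD('n)) powr \<sigma> \<le> t powr \<sigma>"
      using c R \<sigma> by (intro powr_mono2) auto
    moreover have "(c / (2 * R) ^ CARD('n)) powr \<sigma> = (c / 2 ^ CARD('n)) powr \<sigma> / R powr (N * \<sigma>)"
    proof -
      have "c / (2 * R) ^ CARD('n) = (c / 2 ^ CARD('n)) / R powr N"
        using R by (simp add: power_mult_distrib N_def powr_realpow)
      thus ?thesis using c R by (simp add: powr_divide powr_powr powr_mult)
    qed
    ultimately have "(c / 2 ^ CARD('n)) powr \<sigma> / R powr (N * \<sigma>) \<le> t powr \<sigma>" by simp
    hence "k * ((c / 2 ^ CARD('n)) powr \<sigma> / R powr (N * \<sigma>)) * R powr (2 * (1 - \<sigma>)) \<le> k * t powr \<sigma> * R powr (2 * (1 - \<sigma>))"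
      using k by (intro mult_right_mono mult_left_mono) auto
    also note 1
    also have "R powr (2 * (1 - \<sigma>)) = R powr (N * \<sigma>) * R"
      unfolding \<sigma>(3) using R by (simp add: powr_add)
    finally have "k * (c / 2 ^ CARD('n)) powr \<sigma> * R \<le> eig powr (1 - \<sigma>)" using R by simp
    thus "R \<le> B" using k c by (simp add: B_def field_simps)
  qed
  from R_le[of "2 + \<bar>B\<bar>"] show False by simp
qed

end

text \<open>With s = sqrt(N - 1) the critical exponent factors into (s - 1)^2 / ((s + 1)(s - 3)),
  the conjugate of the square of b = (s - 1)/2, and N - 2 = 4 b^2 + 4 b. So p0 < p_c(N) means sqrt q
  > b. For N = 10 there would be equality at q = 1, which a finite p0 excludes; for N at most 9 even
  q = 1 is enough.\<close>

lemma subcritical_dimension: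
  assumes q: "1 \<le> q" and N: "1 \<le> N"
    and "N \<le> 9 \<or> (N = 10 \<and> conj_exponent (ereal q) < \<infinity>) \<or>
      (N \<ge> 11 \<and> conj_exponent (ereal q) < ereal (p_crit N))"
  shows "real N - 2 < 4 * q + 4 * sqrt q"
proof -
  have s1: "1 \<le> sqrt q" using q by simp
  have q1: "1 < q" if "conj_exponent (ereal q) < \<infinity>"
    using that q by (cases "q = 1") (auto simp: conj_exponent_def one_ereal_def)
  from assms(3) show ?thesis
  proof (elim disjE conjE)
    assume "N \<le> 9"
    hence "real N \<le> 9" by simp
    thus ?thesis using q s1 by linarith
  next
    assume N: "N = 10" and "conj_exponent (ereal q) < \<infinity>"
    from q1[OF this(2)] s1 N have "1 < q" "1 \<le> sqrt q" "real N = 10" by auto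
    thus ?thesis by linarith
  next
    assume N: "11 \<le> N" and c: "conj_exponent (ereal q) < ereal (p_crit N)"
    have "ereal (p_crit N) < \<infinity>" by simp
    with c have "conj_exponent (ereal q) < \<infinity>" by (rule less_trans)
    hence q1: "1 < q" by (rule q1)
    hence "conj_exponent (ereal q) = ereal (q / (q - 1))"
      by (simp add: conj_exponent_def one_ereal_def)
    with c have c': "q / (q - 1) < p_crit N" by simp
    define s where "s = sqrt (real N - 1)"
    have "s\<^sup>2 = real N - 1" using N by (simp add: s_def)
    hence Ns: "real N = s\<^sup>2 + 1" by simp
    have "sqrt 9 < s" unfolding s_def using N by (subst real_sqrt_less_iff) simp
    moreover have "sqrt 9 = (3::real)" by (rule real_sqrt_unique) auto
    ultimately have s3: "3 < s" by simp
    have "p_crit N = ((s\<^sup>2 + 1 - 2)\<^sup>2 - 4 * (s\<^sup>2 + 1) + 8 * s) / ((s\<^sup>2 + 1 - 2) * (s\<^sup>2 + 1 - 10))"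
      unfolding p_crit_def s_def[symmetric] unfolding Ns ..
    also have "(s\<^sup>2 + 1 - 2)\<^sup>2 - 4 * (s\<^sup>2 + 1) + 8 * s = ((s - 1) * (s + 3)) * (s - 1)\<^sup>2"
      by (simp add: power2_eq_square algebra_simps)
    also have "(s\<^sup>2 + 1 - 2) * (s\<^sup>2 + 1 - 10) = ((s - 1) * (s + 3)) * ((s + 1) * (s - 3))"
      by (simp add: power2_eq_square algebra_simps)
    finally have "p_crit N = (s - 1)\<^sup>2 / ((s + 1) * (s - 3))" using s3 by simp
    with c' have "q * ((s + 1) * (s - 3)) < (s - 1)\<^sup>2 * (q - 1)"
      using q1 s3 by (simp add: divide_simps mult_ac split: if_splits)
    hence "((s - 1) / 2)\<^sup>2 < q" by (simp add: power2_eq_square algebra_simps)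
    moreover from this have "(s - 1) / 2 < sqrt q" by (rule real_less_rsqrt)
    moreover have "real N - 2 = 4 * ((s - 1) / 2)\<^sup>2 + 4 * ((s - 1) / 2)"
      unfolding Ns by (simp add: power2_eq_square field_simps)
    ultimately show ?thesis by linarith
  qed
qed

section \<open>From the limit \<open>q0\<close> to differential inequalities near 0\<close>

context convex_nonlinearity
begin

text \<open>Where \<open>f'' t = 0\<close> the left side vanishes, consistently with the value
  infinity of \<open>q_fun\<close>; elsewhere the bound on the quotient is rearranged.\<close>

lemma q_fun_upper:
  assumes lim: "(q_fun f \<longlongrightarrow> q0) (at_right 0)" and \<sigma>: "0 < \<sigma>" and less: "ereal (1 / \<sigma>) < q0"
  shows "\<forall>\<^sub>F t in at_right 0. f t * f'' t \<le> \<sigma> * (f' t)\<^sup>2"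
proof -
  have "\<forall>\<^sub>F t in at_right 0. ereal (1 / \<sigma>) < q_fun f t" using lim less by (rule order_tendstoD)
  moreover have "\<forall>\<^sub>F t in at_right (0::real). 0 < t" by (rule eventually_at_right_less)
  ultimately show ?thesis
  proof eventually_elim
    case (elim t)
    have "0 \<le> f t * f'' t" using pos[OF elim(2)] deriv2_nonneg[OF elim(2)] by simp
    thus ?case using elim(1) \<sigma>
      by (cases "f t * f'' t = 0") (auto simp: q_fun_def divide_simps mult_ac order_less_le split: if_splits)
  qed
qed

text \<open>A finite upper bound for \<open>q_fun\<close> rules out \<open>f'' t = 0\<close> near 0,
  so the quotient can be rearranged.\<close>

lemma q_fun_lower:
  assumes lim: "(q_fun f \<longlongrightarrow> q0) (at_right 0)" and \<sigma>: "0 < \<sigma>" and less: "q0 < ereal (1 / \<sigma>)"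
  shows "\<forall>\<^sub>F t in at_right 0. \<sigma> * (f' t)\<^sup>2 \<le> f t * f'' t"
proof -
  have "\<forall>\<^sub>F t in at_right 0. q_fun f t < ereal (1 / \<sigma>)" using lim less by (rule order_tendstoD)
  moreover have "\<forall>\<^sub>F t in at_right (0::real). 0 < t" by (rule eventually_at_right_less)
  ultimately show ?thesis
  proof eventually_elim
    case (elim t)
    have "0 \<le> f t * f'' t" using pos[OF elim(2)] deriv2_nonneg[OF elim(2)] by simp
    thus ?case using elim(1) \<sigma>
      by (cases "f t * f'' t = 0") (auto simp: q_fun_def divide_simps mult_ac order_less_le split: if_splits)
  qed
qed

lemma q_limit_ge_1:
  assumes lim: "(q_fun f \<longlongrightarrow> q0) (at_right 0)"
  shows "1 \<le> q0"
proof (rule ccontr)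
  assume "\<not> 1 \<le> q0"
  hence "max q0 0 < ereal 1" by (simp add: one_ereal_def not_le)
  then obtain b where b: "max q0 0 < ereal b" "ereal b < ereal 1" using ereal_dense2 by blast
  hence "0 < b" "b < 1" by auto
  with b growth_exponent_le_1[OF q_fun_lower[OF lim, of "1 / b"]] show False by simp
qed

end

context bounded_solution
begin

lemma potential_quadratic_decay:
  assumes st: "stable_outside_compact f u" and lim: "(q_fun f \<longlongrightarrow> q0) (at_right 0)"
    and dim: "CARD('n) \<le> 9 \<or> (CARD('n) = 10 \<and> conj_exponent q0 < \<infinity>) \<or>
      (CARD('n) \<ge> 11 \<and> conj_exponent q0 < ereal (p_crit (CARD('n))))"
  obtains D R0 where "0 < D" "0 < R0" "\<And>x. R0 \<le> norm x \<Longrightarrow> f' (u x) \<le> D / (norm x)\<^sup>2"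
proof -
  define N where "N = real CARD('n)"
  \<comment> \<open>For infinite \<open>q0\<close> the upper differential inequality holds with
    every positive exponent, in particular with the one that \<open>not_almost_linear\<close>
    refutes.\<close>
  have "q0 \<noteq> \<infinity>"
  proof
    assume "q0 = \<infinity>"
    thus False using not_almost_linear[OF q_fun_upper[OF lim]] by simp
  qed
  moreover have "1 \<le> q0" by (rule q_limit_ge_1[OF lim])
  ultimately obtain q where q0: "q0 = ereal q" and q: "1 \<le> q"
    by (cases q0) (auto simp: one_ereal_def)
  have sq: "1 \<le> sqrt q" using q by simp
  have sqq: "sqrt q * sqrt q = q" using q by simp
  have N1: "1 \<le> CARD('n)" by (simp add: Suc_le_eq)
  have sub: "N - 2 < 4 * q + 4 * sqrt q"
    unfolding N_def using subcritical_dimension[OF q N1] dim by (simp add: q0)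
  \<comment> \<open>Room for \<open>a\<close>: above 1 for the multipliers, above
    \<open>(N - 2) / (4 * q)\<close> for the pointwise decay, and below
    \<open>1 + 1 / sqrt q\<close> for stability. The conditions are strict, so \<open>1 / q\<close>
    can be moved to \<open>\<sigma>1 < 1 / q < \<sigma>2\<close>, where the differential
    inequalities are available.\<close>
  have "max 1 ((N - 2) / (4 * q)) < 1 + 1 / sqrt q"
  proof -
    have "(N - 2) / (4 * q) < (4 * q + 4 * sqrt q) / (4 * q)"
      using sub q by (intro divide_strict_right_mono) auto
    also have "\<dots> = 1 + 1 / sqrt q" using sq q sqq by (simp add: field_simps)
    finally show ?thesis using sq by simp
  qed
  then obtain a where a: "max 1 ((N - 2) / (4 * q)) < a" "a < 1 + 1 / sqrt q"
    using dense by blast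
  have a1: "1 < a" and aN: "N - 2 < 4 * a * q" using a(1) q by (auto simp: field_simps)
  have "(a - 1)\<^sup>2 < (1 / sqrt q)\<^sup>2" using a1 a(2) by (intro power_strict_mono) auto
  also have "(1 / sqrt q)\<^sup>2 = 1 / q" using q by (simp add: power_divide)
  finally obtain \<sigma>1 where \<sigma>1: "(a - 1)\<^sup>2 < \<sigma>1" "\<sigma>1 < 1 / q" using dense by blast
  have \<sigma>1_pos: "0 < \<sigma>1" using \<sigma>1(1) zero_le_power2[of "a - 1"] by linarith
  have lower: "\<forall>\<^sub>F t in at_right 0. \<sigma>1 * (f' t)\<^sup>2 \<le> f t * f'' t"
    by (rule q_fun_lower[OF lim \<sigma>1_pos]) (use \<sigma>1(2) \<sigma>1_pos q in \<open>simp add: q0 field_simps\<close>)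
  \<comment> \<open>For \<open>N \<le> 2\<close> the second condition holds for every positive
    value, so \<open>2 / q\<close> will do.\<close>
  obtain \<sigma>2 where \<sigma>2: "1 / q < \<sigma>2" "(N - 2) * \<sigma>2 < 4 * a"
  proof (cases "N \<le> 2")
    case True
    have "1 / q < 2 / q" using q by (simp add: divide_strict_right_mono)
    moreover have "(N - 2) * (2 / q) \<le> 0" using True q by (intro mult_nonpos_nonneg) auto
    ultimately show ?thesis using that[of "2 / q"] a1 by linarith
  next
    case False
    have "1 / q < 4 * a / (N - 2)" using False q aN by (simp add: field_simps)
    then obtain s where "1 / q < s" "s < 4 * a / (N - 2)" using dense by blast
    thus ?thesis using that[of s] False by (simp add: field_simps)
  qed
  have "0 < 1 / q" using q by simp
  with \<sigma>2(1) have \<sigma>2_pos: "0 < \<sigma>2" by (rule less_trans[rotated])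
  have upper: "\<forall>\<^sub>F t in at_right 0. f t * f'' t \<le> \<sigma>2 * (f' t)\<^sup>2"
    by (rule q_fun_upper[OF lim \<sigma>2_pos]) (use \<sigma>2(1) \<sigma>2_pos q in \<open>simp add: q0 field_simps\<close>)
  have dim2: "real CARD('n) - 2 < 4 * a / \<sigma>2"
    using \<sigma>2(2) \<sigma>2_pos by (simp add: N_def field_simps)
  obtain K where K: "compact K" "\<And>\<phi>. \<phi> \<in> C1_compact_support_off K \<Longrightarrow>
        (LINT x|lborel. f' (u x) * (\<phi> x)\<^sup>2) \<le> (LINT x|lborel. (norm (gradient \<phi> x))\<^sup>2)"
    using st by (auto simp: stable_outside_compact_def)
  obtain C n where C: "0 < C" "1 \<le> n"
    "\<And>x R t. 0 < R \<Longrightarrow> cball x R \<inter> K = {} \<Longrightarrow> 0 < t \<Longrightarrow> t \<le> M \<Longrightarrow> f' t = 1 / R\<^sup>2 \<Longrightarrow>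
    (LINT z|lborel. f' (u (x + R *\<^sub>R z)) * f (u (x + R *\<^sub>R z)) powr (2 * a) * bump n z)
      \<le> C / R\<^sup>2 * f t powr (2 * a)"
    by (rule energy_bound[where K=K and a=a and \<sigma>=\<sigma>1]) (assumption | rule K(2) a1 \<sigma>1(1) lower that)+
  obtain D where D: "0 < D" "\<And>x R t. 0 < R \<Longrightarrow> cball x R \<inter> K = {} \<Longrightarrow> 0 < t \<Longrightarrow> t \<le> M \<Longrightarrow>
      f' t = 1 / R\<^sup>2 \<Longrightarrow> f' (u x) \<le> D / R\<^sup>2"
    by (rule potential_decay[where K=K and a=a and \<sigma>=\<sigma>2 and C=C and n=n])
       (assumption | rule C a1 upper \<sigma>2_pos dim2 that)+
  obtain B where B: "\<And>x. x \<in> K \<Longrightarrow> norm x \<le> B"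
    using compact_imp_bounded[OF K(1)] by (auto simp: bounded_iff)
  have fM: "0 < f' M" by (rule deriv_pos[OF M_pos])
  \<comment> \<open>The first summand keeps the ball of radius |x|/2 about \<open>x\<close> away
    from \<open>K\<close>. The second makes \<open>1 / R\<^sup>2 \<le> f' M\<close> for
    \<open>R = norm x / 2\<close>, so that the reference level \<open>t\<close> exists below
    \<open>M\<close>.\<close>
  define R0 where "R0 = 2 * \<bar>B\<bar> + 2 / sqrt (f' M) + 1"
  have R0: "2 * \<bar>B\<bar> < R0" "2 / sqrt (f' M) \<le> R0" "0 < R0" using fM by (auto simp: R0_def add_nonneg_pos)
  show thesis
  proof (rule that[of "4 * D" R0])
    show "0 < 4 * D" "0 < R0" using D R0 by auto
    fix x :: "real^'n" assume x: "R0 \<le> norm x"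
    define R where "R = norm x / 2"
    have R: "0 < R" "\<bar>B\<bar> < R" "1 / sqrt (f' M) \<le> R" using x R0 by (auto simp: R_def)
    have disj: "cball x R \<inter> K = {}"
    proof (rule ccontr)
      assume "cball x R \<inter> K \<noteq> {}"
      then obtain y where y: "dist x y \<le> R" "y \<in> K" by auto
      have "norm x \<le> norm y + dist x y" using norm_triangle_ineq[of y "x - y"] by (simp add: dist_norm)
      with y B[OF y(2)] R show False by (simp add: R_def)
    qed
    have "(1 / sqrt (f' M))\<^sup>2 \<le> R\<^sup>2" using R fM by (intro power_mono) auto
    hence "1 / f' M \<le> R\<^sup>2" using fM by (simp add: power_divide)
    hence "1 / R\<^sup>2 \<le> f' M" using fM R by (simp add: field_simps)
    then obtain t where t: "0 < t" "t \<le> M" "f' t = 1 / R\<^sup>2"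
      by (rule deriv_solvable[rotated]) (use R that in auto)
    have "f' (u x) \<le> D / R\<^sup>2" by (rule D(2)[OF R(1) disj t])
    thus "f' (u x) \<le> 4 * D / (norm x)\<^sup>2" by (simp add: R_def power_divide mult.commute)
  qed
qed

section \<open>The function \<open>s\<close> and the final comparison\<close>

lemma s_eq_iff:
  assumes "R \<noteq> 0"
  shows "s_eq (1 / eig) 1 f R s \<longleftrightarrow> 0 < s \<and> f s / s = eig / R\<^sup>2"
proof (cases "0 < s")
  case True
  define t where "t = 1 / eig * R\<^sup>2 * f s"
  have t: "0 \<le> t" using eig_pos pos[OF True] by (simp add: t_def)
  have "f t = f s \<longleftrightarrow> t = s"
    using strict_mono[of t s] strict_mono[of s t] True t by (cases t s rule: linorder_cases) auto
  also have "\<dots> \<longleftrightarrow> f s / s = eig / R\<^sup>2"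
    using True assms eig_pos by (auto simp: t_def field_simps)
  finally show ?thesis using True by (simp add: s_eq_def t_def)
qed (simp add: s_eq_def)

lemma s_eq_ex1:
  assumes "R \<noteq> 0" "eig / R\<^sup>2 \<le> f M / M"
  shows "\<exists>!s. s_eq (1 / eig) 1 f R s"
    and "0 < s_fun (1 / eig) 1 f R" "s_fun (1 / eig) 1 f R \<le> M"
    and "f (s_fun (1 / eig) 1 f R) / s_fun (1 / eig) 1 f R = eig / R\<^sup>2"
proof -
  obtain s where s: "0 < s" "s \<le> M" "f s / s = eig / R\<^sup>2"
    by (rule quotient_solvable[of "eig / R\<^sup>2"]) (use assms eig_pos that in auto)
  have uniq: "s' = s" if "s_eq (1 / eig) 1 f R s'" for s'
  proof -
    have "0 < s'" "f s' / s' = f s / s" using that s by (auto simp: s_eq_iff[OF assms(1)])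
    thus ?thesis using quotient_strict_mono[of s s'] quotient_strict_mono[of s' s] s
      by (cases s s' rule: linorder_cases) auto
  qed
  have ex: "s_eq (1 / eig) 1 f R s" using s by (simp add: s_eq_iff[OF assms(1)])
  show "\<exists>!s. s_eq (1 / eig) 1 f R s" using ex uniq by blast
  have "s_fun (1 / eig) 1 f R = s" unfolding s_fun_def using ex uniq by (rule the_equality)
  thus "0 < s_fun (1 / eig) 1 f R" "s_fun (1 / eig) 1 f R \<le> M"
    "f (s_fun (1 / eig) 1 f R) / s_fun (1 / eig) 1 f R = eig / R\<^sup>2" using s by auto
qed

lemma eventually_eig_le: "\<forall>\<^sub>F R in at_top. R \<noteq> 0 \<and> eig / R\<^sup>2 \<le> f M / M"
proof -
  define R1 where "R1 = sqrt (eig * M / f M)"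
  have fM: "0 < f M" using pos M_pos by blast
  have "\<forall>\<^sub>F R in at_top. max 1 R1 \<le> R" by (rule eventually_ge_at_top)
  thus ?thesis
  proof eventually_elim
    case (elim R)
    have "R1\<^sup>2 \<le> R\<^sup>2" using elim eig_pos M_pos fM by (intro power_mono) (auto simp: R1_def)
    hence "eig * M / f M \<le> R\<^sup>2" using eig_pos M_pos fM by (simp add: R1_def)
    thus ?case using elim M_pos fM by (auto simp: field_simps)
  qed
qed

lemma inverse_formula: "s_inverse_formula eig eig f (s_fun (1 / eig) 1 f)"
proof -
  \<comment> \<open>The interval is open and \<open>s(R)\<close> is only known to be at most
    \<open>M\<close>, hence \<open>M + 1\<close>.\<close>
  define I where "I = {0<..<M + 1}"
  have inj: "inj_on f I"
  proof (rule inj_onI)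
    fix s t assume "s \<in> I" "t \<in> I" "f s = f t"
    thus "s = t" using strict_mono[of s t] strict_mono[of t s]
      by (cases s t rule: linorder_cases) (auto simp: I_def)
  qed
  have injq: "inj_on (\<lambda>t. f t / t) I"
  proof (rule inj_onI)
    fix s t assume "s \<in> I" "t \<in> I" "f s / s = f t / t"
    thus "s = t" using quotient_strict_mono[of s t] quotient_strict_mono[of t s]
      by (cases s t rule: linorder_cases) (auto simp: I_def)
  qed
  have "\<forall>\<^sub>F R in at_top. eig / R\<^sup>2 \<in> (\<lambda>t. f t / t) ` I \<and>
      eig / R\<^sup>2 * the_inv_into I (\<lambda>t. f t / t) (eig / R\<^sup>2) \<in> f ` I \<and>
      s_fun (1 / eig) 1 f R = the_inv_into I f (eig / R\<^sup>2 * the_inv_into I (\<lambda>t. f t / t) (eig / R\<^sup>2))"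
    using eventually_eig_le
  proof eventually_elim
    case (elim R)
    define s where "s = s_fun (1 / eig) 1 f R"
    have s: "0 < s" "s \<le> M" "f s / s = eig / R\<^sup>2"
      unfolding s_def using s_eq_ex1(2-4)[of R] elim by auto
    have sI: "s \<in> I" using s by (simp add: I_def)
    have g: "the_inv_into I (\<lambda>t. f t / t) (eig / R\<^sup>2) = s"
      using the_inv_into_f_f[OF injq sI] s(3) by simp
    have fs: "eig / R\<^sup>2 * s = f s" using s(1) by (simp flip: s(3))
    show ?case unfolding g fs s_def[symmetric]
      using sI s(3) the_inv_into_f_f[OF inj sI] by (auto intro!: image_eqI[of _ _ s])
  qed
  thus ?thesis using inj injq M_pos
    unfolding s_inverse_formula_def Let_def I_def by (intro exI[of _ "M + 1"]) auto
qed

lemma decay: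
  assumes "stable_outside_compact f u" "(q_fun f \<longlongrightarrow> q0) (at_right 0)"
    "CARD('n) \<le> 9 \<or> (CARD('n) = 10 \<and> conj_exponent q0 < \<infinity>) \<or>
      (CARD('n) \<ge> 11 \<and> conj_exponent q0 < ereal (p_crit (CARD('n))))"
  shows "\<exists>C>0. \<forall>\<^sub>F x in at_infinity. u x \<le> C * s_fun (1 / eig) 1 f (norm x)"
proof -
  obtain D R0 where D: "0 < D" "0 < R0" "\<And>x. R0 \<le> norm x \<Longrightarrow> f' (u x) \<le> D / (norm x)\<^sup>2"
    by (rule potential_quadratic_decay[OF assms]) (rule that)
  obtain R1 where R1: "\<And>R. R1 \<le> R \<Longrightarrow> R \<noteq> 0 \<and> eig / R\<^sup>2 \<le> f M / M"
    using eventually_eig_le by (auto simp: eventually_at_top_linorder)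
  define H where "H = exp D * (4 / 3) * 4 ^ CARD('n)"
  have H: "0 < H" by (simp add: H_def)
  \<comment> \<open>Points of the ball of radius |x|/2 about \<open>x\<close> have norm at least
    |x|/2, which explains \<open>2 * R0\<close>; \<open>R1\<close> guarantees that
    \<open>s(|x|)\<close> is defined by its equation.\<close>
  have "u x \<le> H * s_fun (1 / eig) 1 f (norm x)" if x: "max (2 * R0) R1 \<le> norm x" for x
  proof -
    define r where "r = norm x / 2"
    have r: "0 < r" "R0 \<le> r" using x D by (auto simp: r_def)
    have x0: "norm x \<noteq> 0" "eig / (norm x)\<^sup>2 \<le> f M / M" using R1[of "norm x"] x by auto
    obtain y where y: "dist x y < r" "f (u y) \<le> eig / (2 * r)\<^sup>2 * u y"
      by (rule exists_small_quotient_in_ball[OF r(1)]) (rule that)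
    have "u x \<le> H * u y"
      unfolding H_def
    proof (rule harnack[OF r(1)])
      show "0 \<le> D" "dist x y \<le> r" using D y by auto
      fix z assume z: "dist x z \<le> r"
      have "norm x \<le> norm z + dist x z" using norm_triangle_ineq[of z "x - z"] by (simp add: dist_norm)
      hence nz: "r \<le> norm z" using z by (simp add: r_def)
      have "f' (u z) \<le> D / (norm z)\<^sup>2" using nz r by (intro D) simp
      also have "\<dots> \<le> D / r\<^sup>2" using nz r D by (intro divide_left_mono power_mono mult_pos_pos) auto
      finally show "f' (u z) \<le> D / r\<^sup>2" .
    qed
    moreover have "u y \<le> s_fun (1 / eig) 1 f (norm x)"
    proof (rule ccontr)
      assume "\<not> u y \<le> s_fun (1 / eig) 1 f (norm x)"
      hence "eig / (norm x)\<^sup>2 < f (u y) / u y"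
        using quotient_strict_mono[of "s_fun (1 / eig) 1 f (norm x)" "u y"] s_eq_ex1(2,4)[OF x0] by simp
      moreover have "f (u y) / u y \<le> eig / (norm x)\<^sup>2"
        using y(2) u_pos[of y] by (simp add: r_def divide_le_eq)
      ultimately show False by simp
    qed
    ultimately show ?thesis using H by (meson mult_le_cancel_left_pos order_trans)
  qed
  hence "\<forall>\<^sub>F x in at_infinity. u x \<le> H * s_fun (1 / eig) 1 f (norm x)"
    unfolding eventually_at_infinity by blast
  with H show ?thesis by blast
qed

end

theorem theorem1p19:
  "\<exists>A1 A2 C1 C2 :: real. A1 > 0 \<and> A2 > 0 \<and> C1 > 0 \<and> C2 > 0 \<and>
    (\<forall>(f :: real \<Rightarrow> real) (q0 :: ereal) (u :: real^'n::finite \<Rightarrow> real).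
       continuous_on {0..} f \<and> C2_on_pos f \<and> mono_on {0..} f \<and> convex_on {0..} f \<and>
       (\<forall>t>0. f t > 0) \<and> f 0 = 0 \<and> (q_fun f \<longlongrightarrow> q0) (at_right 0) \<and>
       C2_fun u \<and> bounded (range u) \<and> (\<forall>x. u x > 0) \<and>
       (\<forall>x. - laplacian u x = f (u x)) \<and> stable_outside_compact f u \<and>
       ((1 \<le> CARD('n) \<and> CARD('n) \<le> 9) \<or>
        (CARD('n) = 10 \<and> conj_exponent q0 < \<infinity>) \<or>
        (CARD('n) \<ge> 11 \<and> conj_exponent q0 < ereal (p_crit (CARD('n)))))
       \<longrightarrow>
       (\<forall>\<^sub>F R in at_top. \<exists>!s. s_eq A1 A2 f R s) \<and>
       s_inverse_formula C1 C2 f (s_fun A1 A2 f) \<and>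
       (\<exists>C>0. \<forall>\<^sub>F x in at_infinity. u x \<le> C * s_fun A1 A2 f (norm x)))"
proof -
  \<comment> \<open>The value of \<open>eig\<close>, fixed before \<open>f\<close> and
    \<open>u\<close> are introduced: the four constants depend on the dimension only.\<close>
  define E where "E = 2 * (real CARD('n) + 2)\<^sup>2"
  have E: "0 < E" by (simp add: E_def)
  show ?thesis
  proof (rule exI[of _ "1 / E"], rule exI[of _ 1], rule exI[of _ E], rule exI[of _ E],
      intro conjI allI impI)
    show "0 < 1 / E" "0 < (1::real)" "0 < E" "0 < E" using E by auto
    fix f :: "real \<Rightarrow> real" and q0 :: ereal and u :: "real^'n \<Rightarrow> real"
    assume "continuous_on {0..} f \<and> C2_on_pos f \<and> mono_on {0..} f \<and> convex_on {0..} f \<and>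
       (\<forall>t>0. f t > 0) \<and> f 0 = 0 \<and> (q_fun f \<longlongrightarrow> q0) (at_right 0) \<and>
       C2_fun u \<and> bounded (range u) \<and> (\<forall>x. u x > 0) \<and>
       (\<forall>x. - laplacian u x = f (u x)) \<and> stable_outside_compact f u \<and>
       ((1 \<le> CARD('n) \<and> CARD('n) \<le> 9) \<or>
        (CARD('n) = 10 \<and> conj_exponent q0 < \<infinity>) \<or>
        (CARD('n) \<ge> 11 \<and> conj_exponent q0 < ereal (p_crit (CARD('n)))))"
    hence *: "continuous_on {0..} f" "C2_on_pos f" "convex_on {0..} f"
      "\<And>t. 0 < t \<Longrightarrow> 0 < f t" "f 0 = 0" "(q_fun f \<longlongrightarrow> q0) (at_right 0)"
      "C2_fun u" "bounded (range u)" "\<And>x. 0 < u x" "\<And>x. - laplacian u x = f (u x)"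
      "stable_outside_compact f u"
      "CARD('n) \<le> 9 \<or> (CARD('n) = 10 \<and> conj_exponent q0 < \<infinity>) \<or>
        (CARD('n) \<ge> 11 \<and> conj_exponent q0 < ereal (p_crit (CARD('n))))"
      by blast+
    obtain M where M: "\<And>x. \<bar>u x\<bar> \<le> M" using *(8) by (auto simp: bounded_iff)
    interpret bounded_solution f u M
    proof
      show "u x \<le> M" for x using M[of x] by linarith
      show "laplacian u x = - f (u x)" for x using *(10)[of x] by simp
    qed (use * in auto)
    have eq: "eig = E" by (simp add: eig_def E_def)
    show "\<forall>\<^sub>F R in at_top. \<exists>!s. s_eq (1 / E) 1 f R s"
      using eventually_eig_le by eventually_elim (use s_eq_ex1(1) in \<open>auto simp: eq\<close>)
    show "s_inverse_formula E E f (s_fun (1 / E) 1 f)" using inverse_formula by (simp add: eq)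
    show "\<exists>C>0. \<forall>\<^sub>F x in at_infinity. u x \<le> C * s_fun (1 / E) 1 f (norm x)"
      using decay[OF *(11,6,12)] by (simp add: eq)
  qed
qed

end
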